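(* Let $k,m,n\in\mathbb N$, let $D$ be a division algebra, and let $B \cong M_k(D)$. Let $f_1, \ldots, f_m \in B$ be pairwise orthogonal idempotents and $f'_1, \ldots, f'_n \in B$ be pairwise orthogonal idempotents (some of them could be zero) such that $\sum_{i=1}^n f_i' = \sum_{j=1}^m f_j = 1_B$. Let $J^{10}_{*1}, \ldots, J^{10}_{*m}$ be left $B$-modules and $J^{01}_{1*}, \ldots, J^{01}_{n*}$ be right $B$-modules for which there are injective homomorphisms $\varphi \colon J^{10}_{*j} \hookrightarrow B$ of left $B$-modules and $\varphi \colon J^{01}_{i*} \hookrightarrow B$ of right $B$-modules with $\varphi(J^{10}_{*j}) f_j = 0$ and $f_i' \varphi (J^{01}_{i*})= 0$ for all $i,j$ (all these maps are denoted by the same letter, and $\varphi$ is extended additively to $\bigoplus_{i=1}^n J^{01}_{i*} \oplus \bigoplus_{j=1}^m J^{10}_{*j}$). For $1\leqslant i\leqslant n$, $1\leqslant j\leqslant m$ let $J_{ij}$ be an isomorphic copy of the additive group $\varphi(J^{01}_{i*})\varphi(J^{10}_{*j}) \subseteq B$, with isomorphism $\Theta_{ij} \colon \varphi(J^{01}_{i*})\varphi(J^{10}_{*j}) \rightarrow J_{ij}$, and let $\mu \colon \bigoplus_{i=1}^n J^{01}_{i*} \times \bigoplus_{j=1}^m J^{10}_{*j} \rightarrow \bigoplus_{i=1}^n \bigoplus_{j=1}^m J_{ij}$ be the biadditive map with $\mu(v,w)=\Theta_{ij}(\varphi(v)\varphi(w))$ for $v\in J^{01}_{i*}$, $w\in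 J^{10}_{*j}$. Let $Q$ be the $m\times n$ matrix with each entry equal to $e$. Then the additive group $$A=B \oplus \bigoplus_{i=1}^n J^{01}_{i*} \oplus \bigoplus_{j=1}^m J^{10}_{*j} \oplus \bigoplus_{i=1}^n \bigoplus_{j=1}^m J_{ij}$$ is a $\mathcal{M}(\{ e\}^{0},n,m;Q)$-graded-simple ring for the multiplication defined by $$(b_1,v_1,w_1,u_1)(b_2,v_2,w_2,u_2) =(b_1 b_2,\ v_1 b_2,\ b_1 w_2,\ \mu(v_1, w_2)),$$ for $b_1,b_2 \in B$, $v_1,v_2\in \bigoplus_{i} J^{01}_{i*}$, $w_1,w_2 \in \bigoplus_{j} J^{10}_{*j}$, $u_1,u_2 \in \bigoplus_{i,j} J_{ij}$, with homogeneous components $$A_{ij}=(f_i' B f_j,0,0,0) \oplus \left\{ (\varphi(v),v,0, 0) \mid v \in J^{01}_{i*}f_j \right\} \oplus \left\{ (\varphi(w),0,w, 0) \mid w \in f_i'J^{10}_{*j} \right\}\oplus \left\langle (\varphi(v)\varphi(w), v\varphi(w), \varphi(v)w, \mu(v,w)) \mid v \in J^{01}_{i*},\ w \in J^{10}_{*j} \right\rangle_{\mathbb Z}$$ ($A_{ij}$ being the component of degree $(e,i,j)$).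
   Context: Rings are associative, not necessarily unital. The product $\varphi(J^{01}_{i*})\varphi(J^{10}_{*j})$ is the additive subgroup of $B$ generated by the products of elements. $\langle W\rangle_{\mathbb Z}$ is the additive subgroup generated by $W$. With all entries of $Q$ equal to $e$, $\mathcal{M}(\{e\}^0,n,m;Q)$ is the semigroup $\{(e,i,j)\mid 1\leqslant i\leqslant n,\ 1\leqslant j\leqslant m\}\cup\{\theta\}$ with zero $\theta$ and $(e,i,j)(e,k,\ell)=(e,i,\ell)$. A ring graded by a semigroup $S$ is a ring $R=\bigoplus_{s\in S}R^{(s)}$ (additive subgroups) with $R^{(s)}R^{(t)}\subseteq R^{(st)}$; here the component of degree $\theta$ is $0$. Such a ring $R$ is $S$-graded-simple if $R^2\neq0$ and $\{0\}$ and $R$ are the only two-sided ideals $I$ with $I=\bigoplus_{s}(I\cap R^{(s)})$. *)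

theory Defs
  imports
    "Jordan_Normal_Form.Matrix"
    "HOL-Algebra.Algebra"
begin

text \<open>
  Not necessarily unital rings. The field \<open>one\<close> of the ring record is ignored.
\<close>

locale nonunital_ring = abelian_group R for R (structure) +
  assumes m_closed: "\<lbrakk>x \<in> carrier R; y \<in> carrier R\<rbrakk> \<Longrightarrow> x \<otimes> y \<in> carrier R"
    and m_assoc: "\<lbrakk>x \<in> carrier R; y \<in> carrier R; z \<in> carrier R\<rbrakk>
          \<Longrightarrow> (x \<otimes> y) \<otimes> z = x \<otimes> (y \<otimes> z)"
    and l_distr: "\<lbrakk>x \<in> carrier R; y \<in> carrier R; z \<in> carrier R\<rbrakk>
          \<Longrightarrow> (x \<oplus> y) \<otimes> z = x \<otimes> z \<oplus> y \<otimes> z"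
    and r_distr: "\<lbrakk>x \<in> carrier R; y \<in> carrier R; z \<in> carrier R\<rbrakk>
          \<Longrightarrow> z \<otimes> (x \<oplus> y) = z \<otimes> x \<oplus> z \<otimes> y"

definition two_sided_ideal :: "'a set \<Rightarrow> ('a, 'c) ring_scheme \<Rightarrow> bool" where
  "two_sided_ideal I R \<longleftrightarrow>
     subgroup I (add_monoid R) \<and>
     (\<forall>a\<in>carrier R. \<forall>x\<in>I. a \<otimes>\<^bsub>R\<^esub> x \<in> I \<and> x \<otimes>\<^bsub>R\<^esub> a \<in> I)"

definition additive_product :: "('a, 'c) ring_scheme \<Rightarrow> 'a set \<Rightarrow> 'a set \<Rightarrow> 'a set" where
  "additive_product R U V = generate (add_monoid R) (U <#>\<^bsub>R\<^esub> V)"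

text \<open>
  One-sided modules over a noncommutative ring use the record of the library's
  modules, whose fields \<open>mult\<close> and \<open>one\<close> play no role. For a right module,
  \<open>a \<odot>\<^bsub>M\<^esub> x\<close> stands for the product \<open>x a\<close>. Unitality is not required.
\<close>

locale left_module = R?: ring R + M?: abelian_group M
  for R :: "('a, 'd) ring_scheme" (structure) and M :: "('a, 'b, 'c) module_scheme" (structure) +
  assumes smult_closed: "\<lbrakk>a \<in> carrier R; x \<in> carrier M\<rbrakk> \<Longrightarrow> a \<odot>\<^bsub>M\<^esub> x \<in> carrier M"
    and smult_l_distr: "\<lbrakk>a \<in> carrier R; b \<in> carrier R; x \<in> carrier M\<rbrakk>
          \<Longrightarrow> (a \<oplus>\<^bsub>R\<^esub> b) \<odot>\<^bsub>M\<^esub> x = a \<odot>\<^bsub>M\<^esub> x \<oplus>\<^bsub>M\<^esub> b \<odot>\<^bsub>M\<^esub> x"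
    and smult_r_distr: "\<lbrakk>a \<in> carrier R; x \<in> carrier M; y \<in> carrier M\<rbrakk>
          \<Longrightarrow> a \<odot>\<^bsub>M\<^esub> (x \<oplus>\<^bsub>M\<^esub> y) = a \<odot>\<^bsub>M\<^esub> x \<oplus>\<^bsub>M\<^esub> a \<odot>\<^bsub>M\<^esub> y"
    and smult_assoc: "\<lbrakk>a \<in> carrier R; b \<in> carrier R; x \<in> carrier M\<rbrakk>
          \<Longrightarrow> (a \<otimes>\<^bsub>R\<^esub> b) \<odot>\<^bsub>M\<^esub> x = a \<odot>\<^bsub>M\<^esub> (b \<odot>\<^bsub>M\<^esub> x)"

locale right_module = R?: ring R + M?: abelian_group M
  for R :: "('a, 'd) ring_scheme" (structure) and M :: "('a, 'b, 'c) module_scheme" (structure) +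
  assumes smult_closed: "\<lbrakk>a \<in> carrier R; x \<in> carrier M\<rbrakk> \<Longrightarrow> a \<odot>\<^bsub>M\<^esub> x \<in> carrier M"
    and smult_l_distr: "\<lbrakk>a \<in> carrier R; b \<in> carrier R; x \<in> carrier M\<rbrakk>
          \<Longrightarrow> (a \<oplus>\<^bsub>R\<^esub> b) \<odot>\<^bsub>M\<^esub> x = a \<odot>\<^bsub>M\<^esub> x \<oplus>\<^bsub>M\<^esub> b \<odot>\<^bsub>M\<^esub> x"
    and smult_r_distr: "\<lbrakk>a \<in> carrier R; x \<in> carrier M; y \<in> carrier M\<rbrakk>
          \<Longrightarrow> a \<odot>\<^bsub>M\<^esub> (x \<oplus>\<^bsub>M\<^esub> y) = a \<odot>\<^bsub>M\<^esub> x \<oplus>\<^bsub>M\<^esub> a \<odot>\<^bsub>M\<^esub> y"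
    and smult_assoc: "\<lbrakk>a \<in> carrier R; b \<in> carrier R; x \<in> carrier M\<rbrakk>
          \<Longrightarrow> (a \<otimes>\<^bsub>R\<^esub> b) \<odot>\<^bsub>M\<^esub> x = b \<odot>\<^bsub>M\<^esub> (a \<odot>\<^bsub>M\<^esub> x)"

definition left_module_hom ::
    "('a, 'r) ring_scheme \<Rightarrow> ('a, 'v, 'x) module_scheme \<Rightarrow> ('v \<Rightarrow> 'a) set" where
  "left_module_hom R M =
     {h \<in> hom (add_monoid M) (add_monoid R).
        \<forall>a\<in>carrier R. \<forall>x\<in>carrier M. h (a \<odot>\<^bsub>M\<^esub> x) = a \<otimes>\<^bsub>R\<^esub> h x}"

definition right_module_hom ::
    "('a, 'r) ring_scheme \<Rightarrow> ('a, 'v, 'x) module_scheme \<Rightarrow> ('v \<Rightarrow> 'a) set" where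
  "right_module_hom R M =
     {h \<in> hom (add_monoid M) (add_monoid R).
        \<forall>a\<in>carrier R. \<forall>x\<in>carrier M. h (a \<odot>\<^bsub>M\<^esub> x) = h x \<otimes>\<^bsub>R\<^esub> a}"

text \<open>
  The \<open>i\<close>-th coordinate embedding into the external direct sum \<^const>\<open>sum_group\<close>.
\<close>

definition sum_embed ::
    "'i set \<Rightarrow> ('i \<Rightarrow> ('a, 'c) monoid_scheme) \<Rightarrow> 'i \<Rightarrow> 'a \<Rightarrow> ('i \<Rightarrow> 'a)" where
  "sum_embed I G i x = (\<lambda>k\<in>I. if k = i then x else \<one>\<^bsub>G k\<^esub>)"

text \<open>
  \<open>U\<close> is the internal direct sum of the additive subgroups \<open>C s\<close>, \<open>s \<in> S\<close>: every element
  of \<open>U\<close> is uniquely a sum of a finitely supported family in the external direct sum.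
\<close>

definition internal_direct_sum ::
    "('a, 'c) ring_scheme \<Rightarrow> 'a set \<Rightarrow> 's set \<Rightarrow> ('s \<Rightarrow> 'a set) \<Rightarrow> bool" where
  "internal_direct_sum R U S C \<longleftrightarrow>
     (\<forall>s\<in>S. subgroup (C s) (add_monoid R)) \<and>
     bij_betw (\<lambda>x. finsum R x {s \<in> S. x s \<noteq> \<zero>\<^bsub>R\<^esub>})
       (carrier (sum_group S (\<lambda>s. (add_monoid R)\<lparr>carrier := C s\<rparr>))) U"

text \<open>
  A semigroup is represented by a monoid record whose field \<open>one\<close> is ignored.
\<close>

definition semigroup_on :: "('s, 'c) monoid_scheme \<Rightarrow> bool" where
  "semigroup_on S \<longleftrightarrow>
     (\<forall>s\<in>carrier S. \<forall>t\<in>carrier S. s \<otimes>\<^bsub>S\<^esub> t \<in> carrier S) \<and>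
     (\<forall>s\<in>carrier S. \<forall>t\<in>carrier S. \<forall>u\<in>carrier S.
        (s \<otimes>\<^bsub>S\<^esub> t) \<otimes>\<^bsub>S\<^esub> u = s \<otimes>\<^bsub>S\<^esub> (t \<otimes>\<^bsub>S\<^esub> u))"

definition semigroup_graded ::
    "('s, 'c) monoid_scheme \<Rightarrow> ('a, 'd) ring_scheme \<Rightarrow> ('s \<Rightarrow> 'a set) \<Rightarrow> bool" where
  "semigroup_graded S R C \<longleftrightarrow>
     semigroup_on S \<and> nonunital_ring R \<and>
     internal_direct_sum R (carrier R) (carrier S) C \<and>
     (\<forall>s\<in>carrier S. \<forall>t\<in>carrier S. C s <#>\<^bsub>R\<^esub> C t \<subseteq> C (s \<otimes>\<^bsub>S\<^esub> t))"

definition graded_ideal ::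
    "('s, 'c) monoid_scheme \<Rightarrow> ('a, 'd) ring_scheme \<Rightarrow> ('s \<Rightarrow> 'a set) \<Rightarrow> 'a set \<Rightarrow> bool" where
  "graded_ideal S R C I \<longleftrightarrow>
     two_sided_ideal I R \<and> internal_direct_sum R I (carrier S) (\<lambda>s. I \<inter> C s)"

definition graded_simple ::
    "('s, 'c) monoid_scheme \<Rightarrow> ('a, 'd) ring_scheme \<Rightarrow> ('s \<Rightarrow> 'a set) \<Rightarrow> bool" where
  "graded_simple S R C \<longleftrightarrow>
     semigroup_graded S R C \<and>
     additive_product R (carrier R) (carrier R) \<noteq> {\<zero>\<^bsub>R\<^esub>} \<and>
     {I. graded_ideal S R C I} = {{\<zero>\<^bsub>R\<^esub>}, carrier R}"

text \<open>
  The Rees matrix semigroup \<open>M(G\<^sup>0, n, m; P)\<close> over a group \<open>G\<close> with adjoined zero,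
  where \<open>P\<close> is an \<open>m \<times> n\<close> matrix over \<open>G\<^sup>0\<close>; the entry \<open>None\<close> is the zero of \<open>G\<^sup>0\<close>, and
  all triples with zero first entry are identified with the single zero element \<open>Theta\<close>.
\<close>

datatype 'g rees = Theta | Triple 'g nat nat

fun rees_mult ::
    "('g, 'c) monoid_scheme \<Rightarrow> (nat \<Rightarrow> nat \<Rightarrow> 'g option) \<Rightarrow> 'g rees \<Rightarrow> 'g rees \<Rightarrow> 'g rees" where
  "rees_mult G P (Triple g i j) (Triple h k l) =
     (case P j k of None \<Rightarrow> Theta | Some p \<Rightarrow> Triple (g \<otimes>\<^bsub>G\<^esub> p \<otimes>\<^bsub>G\<^esub> h) i l)"
| "rees_mult G P Theta y = Theta"
| "rees_mult G P x Theta = Theta"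

definition rees_matrix_semigroup ::
    "('g, 'c) monoid_scheme \<Rightarrow> nat \<Rightarrow> nat \<Rightarrow> (nat \<Rightarrow> nat \<Rightarrow> 'g option) \<Rightarrow> 'g rees monoid" where
  "rees_matrix_semigroup G n m P =
     \<lparr>carrier = insert Theta {Triple g i j | g i j. g \<in> carrier G \<and> i \<in> {1..n} \<and> j \<in> {1..m}},
      monoid.mult = rees_mult G P,
      monoid.one = undefined\<rparr>"

definition J01_sum :: "nat \<Rightarrow> (nat \<Rightarrow> ('b, 'v) module) \<Rightarrow> (nat \<Rightarrow> 'v) monoid" where
  "J01_sum n J01 = sum_group {1..n} (\<lambda>i. add_monoid (J01 i))"

definition J10_sum :: "nat \<Rightarrow> (nat \<Rightarrow> ('b, 'w) module) \<Rightarrow> (nat \<Rightarrow> 'w) monoid" where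
  "J10_sum m J10 = sum_group {1..m} (\<lambda>j. add_monoid (J10 j))"

text \<open>
  The additive groups \<open>J\<^sub>i\<^sub>j\<close>, and hence their direct sum, are written as (commutative)
  groups of the library, so their addition is the operation \<open>\<otimes>\<close> and their zero is \<open>\<one>\<close>.
\<close>

definition J_sum :: "nat \<Rightarrow> nat \<Rightarrow> (nat \<Rightarrow> nat \<Rightarrow> 'u monoid) \<Rightarrow> (nat \<times> nat \<Rightarrow> 'u) monoid" where
  "J_sum n m J = sum_group ({1..n} \<times> {1..m}) (\<lambda>(i, j). J i j)"

definition J01_embed ::
    "nat \<Rightarrow> (nat \<Rightarrow> ('b, 'v) module) \<Rightarrow> nat \<Rightarrow> 'v \<Rightarrow> (nat \<Rightarrow> 'v)" where
  "J01_embed n J01 i v = sum_embed {1..n} (\<lambda>i. add_monoid (J01 i)) i v"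

definition J10_embed ::
    "nat \<Rightarrow> (nat \<Rightarrow> ('b, 'w) module) \<Rightarrow> nat \<Rightarrow> 'w \<Rightarrow> (nat \<Rightarrow> 'w)" where
  "J10_embed m J10 j w = sum_embed {1..m} (\<lambda>j. add_monoid (J10 j)) j w"

definition J_embed ::
    "nat \<Rightarrow> nat \<Rightarrow> (nat \<Rightarrow> nat \<Rightarrow> 'u monoid) \<Rightarrow> nat \<Rightarrow> nat \<Rightarrow> 'u \<Rightarrow> (nat \<times> nat \<Rightarrow> 'u)" where
  "J_embed n m J i j u = sum_embed ({1..n} \<times> {1..m}) (\<lambda>(i, j). J i j) (i, j) u"

definition biadditive ::
    "('v, 'x) monoid_scheme \<Rightarrow> ('w, 'y) monoid_scheme \<Rightarrow> ('u, 'z) monoid_scheme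
       \<Rightarrow> ('v \<Rightarrow> 'w \<Rightarrow> 'u) \<Rightarrow> bool" where
  "biadditive G H K \<mu> \<longleftrightarrow>
     (\<forall>v\<in>carrier G. \<mu> v \<in> hom H K) \<and>
     (\<forall>w\<in>carrier H. (\<lambda>v. \<mu> v w) \<in> hom G K)"

type_synonym ('b, 'v, 'w, 'u) elt =
  "'b \<times> (nat \<Rightarrow> 'v) \<times> (nat \<Rightarrow> 'w) \<times> (nat \<times> nat \<Rightarrow> 'u)"

definition A_group ::
    "'b ring \<Rightarrow> nat \<Rightarrow> nat \<Rightarrow> (nat \<Rightarrow> ('b, 'v) module) \<Rightarrow> (nat \<Rightarrow> ('b, 'w) module)
       \<Rightarrow> (nat \<Rightarrow> nat \<Rightarrow> 'u monoid) \<Rightarrow> ('b, 'v, 'w, 'u) elt monoid" where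
  "A_group B n m J01 J10 J =
     add_monoid B \<times>\<times> J01_sum n J01 \<times>\<times> J10_sum m J10 \<times>\<times> J_sum n m J"

definition A_ring ::
    "'b ring \<Rightarrow> nat \<Rightarrow> nat \<Rightarrow> (nat \<Rightarrow> ('b, 'v) module) \<Rightarrow> (nat \<Rightarrow> ('b, 'w) module)
       \<Rightarrow> (nat \<Rightarrow> nat \<Rightarrow> 'u monoid)
       \<Rightarrow> ((nat \<Rightarrow> 'v) \<Rightarrow> (nat \<Rightarrow> 'w) \<Rightarrow> (nat \<times> nat \<Rightarrow> 'u))
       \<Rightarrow> ('b, 'v, 'w, 'u) elt ring" where
  "A_ring B n m J01 J10 J \<mu> =
     \<lparr>carrier = carrier (A_group B n m J01 J10 J),
      monoid.mult = (\<lambda>(b\<^sub>1, v\<^sub>1, w\<^sub>1, u\<^sub>1) (b\<^sub>2, v\<^sub>2, w\<^sub>2, u\<^sub>2).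
        (b\<^sub>1 \<otimes>\<^bsub>B\<^esub> b\<^sub>2,
         (\<lambda>i\<in>{1..n}. b\<^sub>2 \<odot>\<^bsub>J01 i\<^esub> v\<^sub>1 i),
         (\<lambda>j\<in>{1..m}. b\<^sub>1 \<odot>\<^bsub>J10 j\<^esub> w\<^sub>2 j),
         \<mu> v\<^sub>1 w\<^sub>2)),
      monoid.one = undefined,
      ring.zero = \<one>\<^bsub>A_group B n m J01 J10 J\<^esub>,
      ring.add = monoid.mult (A_group B n m J01 J10 J)\<rparr>"

text \<open>
  A list indexed by \<open>p = 0, 1, 2, 3\<close>, with the four summands of the component of degree \<open>(e, i, j)\<close>, in the order
  \<open>f'\<^sub>i B f\<^sub>j\<close>, \<open>v \<in> J01 i f\<^sub>j\<close>, \<open>w \<in> f'\<^sub>i J10 j\<close>, and the subgroup generated by products.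
\<close>

definition A_summand ::
    "'b ring \<Rightarrow> nat \<Rightarrow> nat \<Rightarrow> (nat \<Rightarrow> ('b, 'v) module) \<Rightarrow> (nat \<Rightarrow> ('b, 'w) module)
       \<Rightarrow> (nat \<Rightarrow> nat \<Rightarrow> 'u monoid)
       \<Rightarrow> ((nat \<Rightarrow> 'v) \<Rightarrow> (nat \<Rightarrow> 'w) \<Rightarrow> (nat \<times> nat \<Rightarrow> 'u))
       \<Rightarrow> (nat \<Rightarrow> 'b) \<Rightarrow> (nat \<Rightarrow> 'b) \<Rightarrow> (nat \<Rightarrow> 'v \<Rightarrow> 'b) \<Rightarrow> (nat \<Rightarrow> 'w \<Rightarrow> 'b)
       \<Rightarrow> nat \<Rightarrow> nat \<Rightarrow> nat \<Rightarrow> ('b, 'v, 'w, 'u) elt set" where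
  "A_summand B n m J01 J10 J \<mu> f' f \<phi>01 \<phi>10 i j p =
     [{(f' i \<otimes>\<^bsub>B\<^esub> b \<otimes>\<^bsub>B\<^esub> f j, \<one>\<^bsub>J01_sum n J01\<^esub>, \<one>\<^bsub>J10_sum m J10\<^esub>, \<one>\<^bsub>J_sum n m J\<^esub>) | b.
         b \<in> carrier B},
      {(\<phi>01 i v, J01_embed n J01 i v, \<one>\<^bsub>J10_sum m J10\<^esub>, \<one>\<^bsub>J_sum n m J\<^esub>) | v.
         v \<in> (\<lambda>x. f j \<odot>\<^bsub>J01 i\<^esub> x) ` carrier (J01 i)},
      {(\<phi>10 j w, \<one>\<^bsub>J01_sum n J01\<^esub>, J10_embed m J10 j w, \<one>\<^bsub>J_sum n m J\<^esub>) | w.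
         w \<in> (\<lambda>x. f' i \<odot>\<^bsub>J10 j\<^esub> x) ` carrier (J10 j)},
      generate (A_group B n m J01 J10 J)
        {(\<phi>01 i v \<otimes>\<^bsub>B\<^esub> \<phi>10 j w,
          J01_embed n J01 i (\<phi>10 j w \<odot>\<^bsub>J01 i\<^esub> v),
          J10_embed m J10 j (\<phi>01 i v \<odot>\<^bsub>J10 j\<^esub> w),
          \<mu> (J01_embed n J01 i v) (J10_embed m J10 j w)) | v w.
         v \<in> carrier (J01 i) \<and> w \<in> carrier (J10 j)}] ! p"

definition A_component ::
    "'b ring \<Rightarrow> nat \<Rightarrow> nat \<Rightarrow> (nat \<Rightarrow> ('b, 'v) module) \<Rightarrow> (nat \<Rightarrow> ('b, 'w) module)
       \<Rightarrow> (nat \<Rightarrow> nat \<Rightarrow> 'u monoid)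
       \<Rightarrow> ((nat \<Rightarrow> 'v) \<Rightarrow> (nat \<Rightarrow> 'w) \<Rightarrow> (nat \<times> nat \<Rightarrow> 'u))
       \<Rightarrow> (nat \<Rightarrow> 'b) \<Rightarrow> (nat \<Rightarrow> 'b) \<Rightarrow> (nat \<Rightarrow> 'v \<Rightarrow> 'b) \<Rightarrow> (nat \<Rightarrow> 'w \<Rightarrow> 'b)
       \<Rightarrow> nat \<Rightarrow> nat \<Rightarrow> ('b, 'v, 'w, 'u) elt set" where
  "A_component B n m J01 J10 J \<mu> f' f \<phi>01 \<phi>10 i j =
     (let A = A_ring B n m J01 J10 J \<mu>;
          P = A_summand B n m J01 J10 J \<mu> f' f \<phi>01 \<phi>10 i j
      in P 0 <+>\<^bsub>A\<^esub> P 1 <+>\<^bsub>A\<^esub> P 2 <+>\<^bsub>A\<^esub> P 3)"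

fun A_grading ::
    "'b ring \<Rightarrow> nat \<Rightarrow> nat \<Rightarrow> (nat \<Rightarrow> ('b, 'v) module) \<Rightarrow> (nat \<Rightarrow> ('b, 'w) module)
       \<Rightarrow> (nat \<Rightarrow> nat \<Rightarrow> 'u monoid)
       \<Rightarrow> ((nat \<Rightarrow> 'v) \<Rightarrow> (nat \<Rightarrow> 'w) \<Rightarrow> (nat \<times> nat \<Rightarrow> 'u))
       \<Rightarrow> (nat \<Rightarrow> 'b) \<Rightarrow> (nat \<Rightarrow> 'b) \<Rightarrow> (nat \<Rightarrow> 'v \<Rightarrow> 'b) \<Rightarrow> (nat \<Rightarrow> 'w \<Rightarrow> 'b)
       \<Rightarrow> 'g rees \<Rightarrow> ('b, 'v, 'w, 'u) elt set" where
  "A_grading B n m J01 J10 J \<mu> f' f \<phi>01 \<phi>10 Theta = {\<zero>\<^bsub>A_ring B n m J01 J10 J \<mu>\<^esub>}"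
| "A_grading B n m J01 J10 J \<mu> f' f \<phi>01 \<phi>10 (Triple g i j) =
     A_component B n m J01 J10 J \<mu> f' f \<phi>01 \<phi>10 i j"

end

theory Submission
  imports Defs
begin

text \<open>
  View all the summands of \<open>A\<close> inside \<open>B\<close>: \<open>J01 i\<close> as a right ideal \<open>R i\<close>, \<open>J10 j\<close> as a left ideal
  \<open>L j\<close> and \<open>J i j\<close> as \<open>R i L j\<close>. With \<open>R 0 = L 0 = B\<close>, an element of \<open>A\<close> is a matrix \<open>(a p q)\<close>,
  \<open>0 \<le> p \<le> n\<close>, \<open>0 \<le> q \<le> m\<close>, with \<open>a p q\<close> in \<open>R p L q\<close>, and the product is
  \<open>(a a') p q = a p 0 * a' 0 q\<close>. The idempotents \<open>f' i\<close> yield a complete system of orthogonal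
  additive projections of \<open>A\<close> that act on columns, hence are compatible with left factors, and
  the \<open>f j\<close> yield one acting on rows, compatible with right factors. Both systems commute because
  \<open>A\<close> is additively generated by products, and the component of degree \<open>(i, j)\<close> is the image of the
  product of the \<open>i\<close>-th and the \<open>j\<close>-th projection; this makes the grading multiplicative.

  Let \<open>e\<close> be the element with \<open>1\<close> in position \<open>(0, 0)\<close>. A nonzero homogeneous element \<open>a\<close> has
  \<open>a 0 0 \<noteq> 0\<close>, so by simplicity of \<open>B\<close> an ideal containing it contains \<open>e\<close>. As \<open>x y = x e y\<close> for
  all \<open>x, y\<close>, it contains all products, hence \<open>A\<close>.
\<close>

section \<open>Direct sums\<close>

text \<open>As \<open>(a a') 0 0 = a 0 0 * a' 0 0\<close>, the elements with \<open>0\<close> in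
  position \<open>(0, 0)\<close> form a two-sided ideal of \<open>A\<close>, usually neither
  \<open>0\<close> nor \<open>A\<close>, so simplicity has to come from the grading. This explains
  the repeated entries in the homogeneous components: splitting every position separately, with
  \<open>f' i B f j\<close> alone in position \<open>(0, 0)\<close>, would also be multiplicative,
  but then that ideal would be graded. Since the entries of row \<open>i\<close> are added into row
  \<open>0\<close>, and those of column \<open>j\<close> into column \<open>0\<close>, the
  projections must subtract these repetitions before the idempotents are applied; this is the origin
  of the differences in all formulas below. The conditions \<open>f' i R i = 0\<close> and
  \<open>L j f j = 0\<close> then force a homogeneous element with \<open>a 0 0 = 0\<close> to
  vanish: step by step, each further entry \<open>x\<close> satisfies \<open>x = f' i x\<close> or
  \<open>x = x f j\<close>.\<close>

lemma (in abelian_group_hom) hom_a_inv: "x \<in> carrier G \<Longrightarrow> h (\<ominus>\<^bsub>G\<^esub> x) = \<ominus>\<^bsub>H\<^esub> h x"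
  using group_hom.hom_inv[OF a_group_hom] by (simp add: a_inv_def)

lemma (in abelian_group_hom) hom_a_minus:
  "\<lbrakk>x \<in> carrier G; y \<in> carrier G\<rbrakk> \<Longrightarrow> h (x \<ominus>\<^bsub>G\<^esub> y) = h x \<ominus>\<^bsub>H\<^esub> h y"
  by (simp add: a_minus_def hom_a_inv)

lemma (in abelian_group_hom) hom_finsum:
  "\<lbrakk>finite S; \<And>s. s \<in> S \<Longrightarrow> x s \<in> carrier G\<rbrakk> \<Longrightarrow> h (finsum G x S) = finsum H (\<lambda>s. h (x s)) S"
  by (induction S rule: finite_induct) (auto simp: G.finsum_insert H.finsum_insert Pi_iff)

lemma (in abelian_group) subgroup_finsum_closed:
  assumes U: "subgroup U (add_monoid G)" and "finite T" and "\<And>t. t \<in> T \<Longrightarrow> x t \<in> U"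
  shows "finsum G x T \<in> U"
  using assms(2,3)
proof (induction T rule: finite_induct)
  case empty
  then show ?case using subgroup.one_closed[OF U] by simp
next
  case (insert t T)
  then have "x \<in> T \<rightarrow> carrier G" "x t \<in> carrier G"
    using subgroup.subset[OF U] by auto
  then show ?case
    using insert subgroup.m_closed[OF U] by simp
qed

lemma (in abelian_monoid) finsum_cartesian_product:
  assumes "finite I" and "finite K" and x: "\<And>i k. \<lbrakk>i \<in> I; k \<in> K\<rbrakk> \<Longrightarrow> x i k \<in> carrier G"
  shows "finsum G (\<lambda>(i, k). x i k) (I \<times> K) = (\<Oplus>i\<in>I. \<Oplus>k\<in>K. x i k)"
  using assms(1) x
proof (induction I rule: finite_induct)
  case empty
  then show ?case by simp
next
  case (insert i I)
  let ?x = "\<lambda>(i, k). x i k"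
  have row: "finsum G ?x (Pair i ` K) = (\<Oplus>k\<in>K. x i k)"
    using insert.prems by (subst finsum_reindex) (auto simp: inj_on_def)
  have "finsum G ?x (insert i I \<times> K) = finsum G ?x (Pair i ` K \<union> I \<times> K)"
    by (rule arg_cong[where f = "finsum G ?x"]) auto
  also have "\<dots> = finsum G ?x (Pair i ` K) \<oplus> finsum G ?x (I \<times> K)"
    using insert \<open>finite K\<close> by (intro finsum_Un_disjoint) auto
  also have "\<dots> = (\<Oplus>i\<in>insert i I. \<Oplus>k\<in>K. x i k)"
    using insert row by (subst finsum_insert) (auto intro!: finsum_closed)
  finally show ?case .
qed

text \<open>Contrapositively, a graded ideal other than \<open>0\<close> contains a nonzero
  homogeneous element, which is where the simplicity argument starts.\<close>

lemma internal_direct_sum_of_zero: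
  assumes "abelian_group R" and sum: "internal_direct_sum R U S C" and C: "\<And>s. s \<in> S \<Longrightarrow> C s \<subseteq> {\<zero>\<^bsub>R\<^esub>}"
  shows "U \<subseteq> {\<zero>\<^bsub>R\<^esub>}"
proof
  fix u assume "u \<in> U"
  interpret abelian_group R by fact
  have grp: "group ((add_monoid R)\<lparr>carrier := C s\<rparr>)" if "s \<in> S" for s
    using sum that by (intro add.subgroup_imp_group) (auto simp: internal_direct_sum_def)
  obtain x where x: "x \<in> carrier (sum_group S (\<lambda>s. (add_monoid R)\<lparr>carrier := C s\<rparr>))"
    and u: "u = finsum R x {s \<in> S. x s \<noteq> \<zero>\<^bsub>R\<^esub>}"
    using sum \<open>u \<in> U\<close> unfolding internal_direct_sum_def bij_betw_def by blast
  have supp: "{s \<in> S. x s \<noteq> \<zero>\<^bsub>R\<^esub>} = {}"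
    using x C grp by (fastforce simp: carrier_sum_group)
  then show "u \<in> {\<zero>\<^bsub>R\<^esub>}" unfolding u supp by simp
qed

text \<open>The tuple of all \<open>\<pi> s u\<close> inverts the summation map, so existence and
  uniqueness of decompositions both come from the projections. The hypotheses are stated on a stable
  subgroup \<open>U\<close>: it will be \<open>A\<close>, \<open>0\<close>, or a single component,
  on which four projections add up to the identity although they do not do so on all of
  \<open>A\<close>.\<close>

lemma (in abelian_group) internal_direct_sum_projections:
  assumes "finite S" and U: "subgroup U (add_monoid G)"
    and hom: "\<And>s. s \<in> S \<Longrightarrow> abelian_group_hom G G (\<pi> s)"
    and into: "\<And>s u. \<lbrakk>s \<in> S; u \<in> U\<rbrakk> \<Longrightarrow> \<pi> s u \<in> U"
    and orth: "\<And>s t u. \<lbrakk>s \<in> S; t \<in> S; u \<in> U\<rbrakk>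
                 \<Longrightarrow> \<pi> s (\<pi> t u) = (if s = t then \<pi> s u else \<zero>)"
    and sum: "\<And>u. u \<in> U \<Longrightarrow> (\<Oplus>s\<in>S. \<pi> s u) = u"
    and C: "\<And>s. s \<in> S \<Longrightarrow> C s = {u \<in> U. \<pi> s u = u}"
  shows "internal_direct_sum G U S C"
proof -
  have carr: "u \<in> carrier G" if "u \<in> U" for u
    using subgroup.subset[OF U] that by auto
  have sub: "subgroup (C s) (add_monoid G)" if s: "s \<in> S" for s
  proof -
    interpret \<pi>: abelian_group_hom G G "\<pi> s" using hom s .
    show ?thesis
      unfolding C[OF s]
    proof (rule add.subgroupI)
      show "{u \<in> U. \<pi> s u = u} \<noteq> {}"
        using subgroup.one_closed[OF U] \<pi>.hom_zero by auto
    next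
      fix a assume "a \<in> {u \<in> U. \<pi> s u = u}"
      then show "\<ominus> a \<in> {u \<in> U. \<pi> s u = u}"
        using subgroup.m_inv_closed[OF U] carr by (auto simp: \<pi>.hom_a_inv a_inv_def[symmetric])
    next
      fix a b assume "a \<in> {u \<in> U. \<pi> s u = u}" "b \<in> {u \<in> U. \<pi> s u = u}"
      then show "a \<oplus> b \<in> {u \<in> U. \<pi> s u = u}"
        using subgroup.m_closed[OF U] carr by auto
    qed (use carr in auto)
  qed
  have carrier_sum: "carrier (sum_group S (\<lambda>s. (add_monoid G)\<lparr>carrier := C s\<rparr>)) = Pi\<^sub>E S C"
    using add.subgroup_imp_group[OF sub] \<open>finite S\<close> by (auto simp: carrier_sum_group)
  have supp: "finsum G x {s \<in> S. x s \<noteq> \<zero>} = finsum G x S" if "x \<in> Pi\<^sub>E S C" for x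
  proof (rule add.finprod_mono_neutral_cong_left)
    show "x \<in> S \<rightarrow> carrier G"
      using that C carr by (fastforce simp: Pi_iff)
  qed (use \<open>finite S\<close> in auto)
  \<comment> \<open>Each \<open>x t\<close> is fixed by \<open>\<pi> t\<close>, so orthogonality
    kills all terms except the one at \<open>s\<close>.\<close>
  have coord: "\<pi> s (finsum G x S) = x s" if x: "x \<in> Pi\<^sub>E S C" and s: "s \<in> S" for x s
  proof -
    interpret \<pi>: abelian_group_hom G G "\<pi> s" using hom s .
    have xU: "x t \<in> U" "\<pi> t (x t) = x t" if "t \<in> S" for t
      using x that C by fastforce+
    have "\<pi> s (finsum G x S) = (\<Oplus>t\<in>S. \<pi> s (x t))"
      using xU carr \<open>finite S\<close> by (intro \<pi>.hom_finsum) auto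
    also have "\<dots> = (\<Oplus>t\<in>S. if s = t then x t else \<zero>)"
    proof (rule add.finprod_cong')
      fix t assume t: "t \<in> S"
      show "\<pi> s (x t) = (if s = t then x t else \<zero>)"
        using orth[OF s t xU(1)[OF t]] xU(2)[OF t] xU(2)[OF s] by auto
    qed (use xU carr in auto)
    also have "\<dots> = x s"
      using finsum_singleton[OF s \<open>finite S\<close>, of x] xU carr by auto
    finally show ?thesis .
  qed
  have "bij_betw (\<lambda>x. finsum G x {s \<in> S. x s \<noteq> \<zero>}) (Pi\<^sub>E S C) U"
  proof (rule bij_betw_byWitness[where f' = "\<lambda>u. \<lambda>s\<in>S. \<pi> s u"])
    show "\<forall>x\<in>Pi\<^sub>E S C. (\<lambda>s\<in>S. \<pi> s (finsum G x {s \<in> S. x s \<noteq> \<zero>})) = x"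
    proof
      fix x assume x: "x \<in> Pi\<^sub>E S C"
      show "(\<lambda>s\<in>S. \<pi> s (finsum G x {s \<in> S. x s \<noteq> \<zero>})) = x"
        unfolding supp[OF x] by (rule ext) (use coord[OF x] PiE_arb[OF x] in auto)
    qed
    have CU: "(\<lambda>s\<in>S. \<pi> s u) \<in> Pi\<^sub>E S C" if "u \<in> U" for u
      using that C into orth by auto
    show "\<forall>u\<in>U. (\<lambda>x. finsum G x {s \<in> S. x s \<noteq> \<zero>}) (\<lambda>s\<in>S. \<pi> s u) = u"
    proof
      fix u assume u: "u \<in> U"
      have "finsum G (\<lambda>s\<in>S. \<pi> s u) S = u"
        by (subst (2) sum[OF u, symmetric], rule add.finprod_cong') (use into u carr in auto)
      with supp[OF CU[OF u]] show "(\<lambda>x. finsum G x {s \<in> S. x s \<noteq> \<zero>}) (\<lambda>s\<in>S. \<pi> s u) = u"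
        by simp
    qed
    have "finsum G x S \<in> U" if x: "x \<in> Pi\<^sub>E S C" for x
      using U \<open>finite S\<close> by (rule subgroup_finsum_closed) (use x C in fastforce)
    then show "(\<lambda>x. finsum G x {s \<in> S. x s \<noteq> \<zero>}) ` Pi\<^sub>E S C \<subseteq> U"
      using supp by auto
    show "(\<lambda>u. \<lambda>s\<in>S. \<pi> s u) ` U \<subseteq> Pi\<^sub>E S C"
      using CU by blast
  qed
  then show ?thesis
    unfolding internal_direct_sum_def carrier_sum using sub by blast
qed

section \<open>Orthogonal projections and their shears\<close>

locale orthogonal_projections = abelian_group B for B (structure) +
  fixes n :: nat and F :: "nat \<Rightarrow> 'a \<Rightarrow> 'a"
  assumes hom: "i \<in> {1..n} \<Longrightarrow> abelian_group_hom B B (F i)"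
    and orth: "\<lbrakk>i \<in> {1..n}; k \<in> {1..n}; x \<in> carrier B\<rbrakk>
                 \<Longrightarrow> F i (F k x) = (if i = k then F i x else \<zero>)"
    and sum: "x \<in> carrier B \<Longrightarrow> (\<Oplus>i\<in>{1..n}. F i x) = x"
begin

text \<open>
  With respect to the coordinates \<open>c 0 - (c 1 + ... + c n), c 1, ..., c n\<close>, the map \<open>shear i\<close>
  applies \<open>F i\<close> to the first one and keeps only the \<open>i\<close>-th of the others.
\<close>

definition shear :: "nat \<Rightarrow> (nat \<Rightarrow> 'a) \<Rightarrow> nat \<Rightarrow> 'a" where
  "shear i c p =
     (if p = 0 then F i (c 0 \<ominus> (\<Oplus>k\<in>{1..n}. c k)) \<oplus> c i else if p = i then c i else \<zero>)"

lemma F_closed: "\<lbrakk>i \<in> {1..n}; x \<in> carrier B\<rbrakk> \<Longrightarrow> F i x \<in> carrier B"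
  using abelian_group_hom.hom_closed[OF hom] .

lemma tail_closed: "(\<And>p. p \<le> n \<Longrightarrow> c p \<in> carrier B) \<Longrightarrow> (\<Oplus>k\<in>{1..n}. c k) \<in> carrier B"
  by (rule finsum_closed) auto

lemma shear_closed:
  "\<lbrakk>i \<in> {1..n}; \<And>p. p \<le> n \<Longrightarrow> c p \<in> carrier B\<rbrakk> \<Longrightarrow> shear i c p \<in> carrier B"
  using tail_closed[of c] by (auto simp: shear_def intro!: F_closed add.m_closed minus_closed)

text \<open>Coordinates are controlled only for indices up to \<open>n\<close>, so families are
  compared there and not as functions.\<close>

lemma shear_cong:
  assumes "i \<in> {1..n}" "\<And>p. p \<le> n \<Longrightarrow> c p = d p" "\<And>p. p \<le> n \<Longrightarrow> d p \<in> carrier B"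
  shows "shear i c p = shear i d p"
proof -
  have "(\<Oplus>k\<in>{1..n}. c k) = (\<Oplus>k\<in>{1..n}. d k)"
    by (rule add.finprod_cong') (use assms in auto)
  then show ?thesis using assms by (simp add: shear_def)
qed

lemma shear_add:
  assumes i: "i \<in> {1..n}"
    and c: "\<And>p. p \<le> n \<Longrightarrow> c p \<in> carrier B" and d: "\<And>p. p \<le> n \<Longrightarrow> d p \<in> carrier B"
  shows "shear i (\<lambda>p. c p \<oplus> d p) p = shear i c p \<oplus> shear i d p"
proof -
  interpret F: abelian_group_hom B B "F i" using hom i .
  let ?c = "\<Oplus>k\<in>{1..n}. c k" and ?d = "\<Oplus>k\<in>{1..n}. d k"
  have t: "?c \<in> carrier B" "?d \<in> carrier B" using tail_closed c d by auto
  have c0: "c 0 \<in> carrier B" "d 0 \<in> carrier B" "c i \<in> carrier B" "d i \<in> carrier B"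
    using c d i by auto
  have "(\<Oplus>k\<in>{1..n}. c k \<oplus> d k) = ?c \<oplus> ?d"
    by (rule finsum_addf) (use c d in auto)
  moreover have "c 0 \<oplus> d 0 \<ominus> (?c \<oplus> ?d) = (c 0 \<ominus> ?c) \<oplus> (d 0 \<ominus> ?d)"
    using t c0 by (simp add: a_minus_def minus_add a_ac)
  ultimately show ?thesis
    using t c0 by (simp add: shear_def a_ac)
qed

lemma shear_shear:
  assumes i: "i \<in> {1..n}" and k: "k \<in> {1..n}" and c: "\<And>p. p \<le> n \<Longrightarrow> c p \<in> carrier B"
  shows "shear i (shear k c) p = (if i = k then shear i c p else \<zero>)"
proof -
  interpret F: abelian_group_hom B B "F i" using hom i .
  let ?x = "c 0 \<ominus> (\<Oplus>l\<in>{1..n}. c l)"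
  have x: "?x \<in> carrier B" using tail_closed c by auto
  have ck: "c k \<in> carrier B" using c k by auto
  \<comment> \<open>The only surviving tail entry \<open>c k\<close> cancels the \<open>c k\<close>
    added at index \<open>0\<close>. Hence the difference coordinate of \<open>shear k c\<close> is
    \<open>F k ?x\<close>, and orthogonality of the \<open>F\<close> applies to it.\<close>
  have "(\<Oplus>l\<in>{1..n}. shear k c l) = (\<Oplus>l\<in>{1..n}. if k = l then c l else \<zero>)"
    by (rule add.finprod_cong') (use c in \<open>auto simp: shear_def\<close>)
  also have "\<dots> = c k"
    using finsum_singleton[OF k, of c] c by auto
  finally have "shear k c 0 \<ominus> (\<Oplus>l\<in>{1..n}. shear k c l) = F k ?x"
    using F_closed[OF k x] ck by (simp add: shear_def a_minus_def a_assoc r_neg)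
  then have "F i (shear k c 0 \<ominus> (\<Oplus>l\<in>{1..n}. shear k c l)) = (if i = k then F i ?x else \<zero>)"
    using orth[OF i k x] by simp
  then show ?thesis
    using i by (auto simp: shear_def[of i] shear_def[of k])
qed

lemma sum_shear:
  assumes c: "\<And>p. p \<le> n \<Longrightarrow> c p \<in> carrier B" and p: "p \<le> n"
  shows "(\<Oplus>i\<in>{1..n}. shear i c p) = c p"
proof (cases "p = 0")
  case True
  let ?x = "c 0 \<ominus> (\<Oplus>l\<in>{1..n}. c l)"
  have t: "(\<Oplus>l\<in>{1..n}. c l) \<in> carrier B" using tail_closed c by auto
  then have x: "?x \<in> carrier B" using c by auto
  have "(\<Oplus>i\<in>{1..n}. shear i c p) = (\<Oplus>i\<in>{1..n}. F i ?x \<oplus> c i)"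
    using True by (simp add: shear_def)
  also have "\<dots> = ?x \<oplus> (\<Oplus>l\<in>{1..n}. c l)"
    using F_closed x c sum[OF x] by (subst finsum_addf) auto
  also have "\<dots> = c 0"
    using t c by (simp add: a_minus_def a_assoc l_neg)
  finally show ?thesis using True by simp
next
  case False
  have "(\<Oplus>i\<in>{1..n}. shear i c p) = (\<Oplus>i\<in>{1..n}. if p = i then c i else \<zero>)"
    by (rule add.finprod_cong') (use c False in \<open>auto simp: shear_def\<close>)
  also have "\<dots> = c p"
    using finsum_singleton[of p "{1..n}" c] False p c by auto
  finally show ?thesis .
qed

text \<open>For \<open>h\<close> a multiplication from one side and \<open>F\<close> multiplication
  by idempotents from the other, associativity gives \<open>comm\<close>. This is what makes the
  projections of \<open>A\<close> compatible with products.\<close>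

lemma shear_hom:
  assumes "orthogonal_projections B' n F'" and h: "abelian_group_hom B B' h"
    and comm: "\<And>x. x \<in> carrier B \<Longrightarrow> F' i (h x) = h (F i x)"
    and i: "i \<in> {1..n}" and c: "\<And>p. p \<le> n \<Longrightarrow> c p \<in> carrier B"
  shows "orthogonal_projections.shear B' n F' i (\<lambda>p. h (c p)) p = h (shear i c p)"
proof -
  interpret h: abelian_group_hom B B' h by fact
  have t: "(\<Oplus>l\<in>{1..n}. c l) \<in> carrier B" using tail_closed c by auto
  have "(\<Oplus>\<^bsub>B'\<^esub>l\<in>{1..n}. h (c l)) = h (\<Oplus>l\<in>{1..n}. c l)"
    using h.hom_finsum[of "{1..n}" c] c by simp
  then show ?thesis
    using t c i by (simp add: orthogonal_projections.shear_def[OF assms(1)] shear_def h.hom_a_minus[symmetric] comm F_closed)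
qed

text \<open>A fixed family vanishes outside \<open>0\<close> and \<open>i\<close>, so its tail sum
  is \<open>c i\<close> and the condition at index \<open>0\<close> concerns
  \<open>c 0 - c i\<close> alone. These differences will describe the homogeneous
  components.\<close>

lemma shear_fixed_iff:
  assumes i: "i \<in> {1..n}" and c: "\<And>p. p \<le> n \<Longrightarrow> c p \<in> carrier B"
  shows "(\<forall>p\<le>n. shear i c p = c p) \<longleftrightarrow>
         (\<forall>p\<le>n. p \<noteq> 0 \<longrightarrow> p \<noteq> i \<longrightarrow> c p = \<zero>) \<and> F i (c 0 \<ominus> c i) = c 0 \<ominus> c i"
proof -
  have c0: "c 0 \<in> carrier B" "c i \<in> carrier B" using c i by auto
  have iff: "F i y \<oplus> c i = c 0 \<longleftrightarrow> F i y = c 0 \<ominus> c i" if "y \<in> carrier B" for y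
  proof
    assume "F i y \<oplus> c i = c 0"
    then have "c 0 \<ominus> c i = F i y \<oplus> c i \<ominus> c i" by simp
    then show "F i y = c 0 \<ominus> c i"
      using F_closed[OF i that] c0 by (simp add: a_minus_def a_assoc r_neg)
  next
    assume "F i y = c 0 \<ominus> c i"
    then show "F i y \<oplus> c i = c 0"
      using c0 by (simp add: a_minus_def a_assoc l_neg)
  qed
  have tail: "(\<Oplus>l\<in>{1..n}. c l) = c i" if "\<forall>p\<le>n. p \<noteq> 0 \<longrightarrow> p \<noteq> i \<longrightarrow> c p = \<zero>"
  proof -
    have "(\<Oplus>l\<in>{1..n}. c l) = (\<Oplus>l\<in>{1..n}. if i = l then c l else \<zero>)"
      by (rule add.finprod_cong') (use c that in auto)
    then show ?thesis using finsum_singleton[OF i, of c] c by auto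
  qed
  have "(\<forall>p\<le>n. shear i c p = c p) \<longleftrightarrow>
        (\<forall>p\<le>n. p \<noteq> 0 \<longrightarrow> p \<noteq> i \<longrightarrow> c p = \<zero>) \<and>
        F i (c 0 \<ominus> (\<Oplus>l\<in>{1..n}. c l)) \<oplus> c i = c 0"
    using i by (force simp: shear_def)
  then show ?thesis
    using tail iff[of "c 0 \<ominus> c i"] c0 by auto
qed

end

section \<open>Matrix rings over division rings\<close>

text \<open>A single nonzero entry of \<open>x\<close> produces any prescribed row in any prescribed
  place, so an arbitrary matrix \<open>y\<close> is assembled row by row; \<open>?y t\<close>
  consists of its first \<open>t\<close> rows.\<close>

lemma mat_ideal_eq_carrier:
  fixes H :: "'d :: division_ring mat set"
  assumes H: "H \<subseteq> carrier_mat k k" and zero: "0\<^sub>m k k \<in> H"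
    and add: "\<And>x y. \<lbrakk>x \<in> H; y \<in> H\<rbrakk> \<Longrightarrow> x + y \<in> H"
    and mult: "\<And>a x c. \<lbrakk>x \<in> H; a \<in> carrier_mat k k; c \<in> carrier_mat k k\<rbrakk> \<Longrightarrow> a * x * c \<in> H"
    and x: "x \<in> H" "x \<noteq> 0\<^sub>m k k"
  shows "H = carrier_mat k k"
proof
  have xk: "x \<in> carrier_mat k k" using H x by blast
  obtain p q where pq: "p < k" "q < k" "x $$ (p, q) \<noteq> 0"
  proof (rule ccontr)
    assume "\<not> thesis"
    with that have "x = 0\<^sub>m k k" using xk by (intro eq_matI) auto
    with x show False by blast
  qed
  show "carrier_mat k k \<subseteq> H"
  proof
    fix y :: "'d mat" assume y: "y \<in> carrier_mat k k"
    let ?y = "\<lambda>t. mat k k (\<lambda>(i, j). if i < t then y $$ (i, j) else 0)"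
    have "?y t \<in> H" if "t \<le> k" for t
      using that
    proof (induction t)
      case 0
      then show ?case using zero by (simp add: zero_mat_def)
    next
      case (Suc t)
      \<comment> \<open>\<open>?u\<close> moves row \<open>p\<close> of \<open>x\<close> to row
        \<open>t\<close>, scaled from the left so that its entry in column \<open>q\<close> becomes
        \<open>1\<close>; \<open>?v\<close> then turns that entry into row \<open>t\<close> of
        \<open>y\<close>.\<close>
      let ?u = "mat k k (\<lambda>(i, j). if i = t \<and> j = p then inverse (x $$ (p, q)) else 0)"
      let ?v = "mat k k (\<lambda>(i, j). if i = q then y $$ (t, j) else 0)"
      have ux: "(?u * x) $$ (i, j) = (if i = t then inverse (x $$ (p, q)) * x $$ (p, j) else 0)"
        if "i < k" "j < k" for i j
      proof -
        have "(?u * x) $$ (i, j) = (\<Sum>l = 0..<k. ?u $$ (i, l) * x $$ (l, j))"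
          using that xk by (simp add: scalar_prod_def)
        also have "\<dots> = (\<Sum>l = 0..<k. if l = p then (if i = t then inverse (x $$ (p, q)) * x $$ (p, j) else 0) else 0)"
          by (rule sum.cong) (use that in auto)
        finally show ?thesis using pq by simp
      qed
      have "(?u * x * ?v) $$ (i, j) = (if i = t then y $$ (t, j) else 0)"
        if "i < k" "j < k" for i j
      proof -
        have "(?u * x * ?v) $$ (i, j) = (\<Sum>l = 0..<k. (?u * x) $$ (i, l) * ?v $$ (l, j))"
          using that xk by (simp add: scalar_prod_def)
        also have "\<dots> = (\<Sum>l = 0..<k. if l = q then (if i = t then y $$ (t, j) else 0) else 0)"
          by (rule sum.cong) (use that pq in \<open>auto simp: ux simp del: index_mult_mat\<close>)
        finally show ?thesis using pq by simp
      qed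
      then have "?y (Suc t) = ?y t + ?u * x * ?v"
        using xk by (intro eq_matI) (auto simp del: index_mult_mat(1))
      moreover have "?u * x * ?v \<in> H" by (rule mult[OF x(1)]) auto
      ultimately show ?case using add Suc by simp
    qed
    from this[of k] have "?y k \<in> H" by simp
    moreover have "?y k = y" using y by (intro eq_matI) auto
    ultimately show "y \<in> H" by simp
  qed
qed (rule H)

lemma ring_iso_ring_mat_simple:
  fixes B :: "('b, 'c) ring_scheme"
  assumes "1 \<le> k" and "ring B" and iso: "B \<simeq> ring_mat TYPE('d :: division_ring) k ()"
  shows "\<one>\<^bsub>B\<^esub> \<noteq> \<zero>\<^bsub>B\<^esub>" and "two_sided_ideal H B \<Longrightarrow> H = {\<zero>\<^bsub>B\<^esub>} \<or> H = carrier B"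
proof -
  interpret ring B by fact
  obtain h where h: "h \<in> ring_hom B (ring_mat TYPE('d) k ())"
    and bij: "bij_betw h (carrier B) (carrier_mat k k)"
    using iso by (auto simp: is_ring_iso_def ring_iso_def ring_mat_simps)
  have h_closed: "h x \<in> carrier_mat k k" if "x \<in> carrier B" for x
    using ring_hom_closed[OF h that] by (simp add: ring_mat_simps)
  have h_add: "h (x \<oplus>\<^bsub>B\<^esub> y) = h x + h y" if "x \<in> carrier B" "y \<in> carrier B" for x y
    using ring_hom_add[OF h that] by (simp add: ring_mat_simps)
  have h_mult: "h (x \<otimes>\<^bsub>B\<^esub> y) = h x * h y" if "x \<in> carrier B" "y \<in> carrier B" for x y
    using ring_hom_mult[OF h that] by (simp add: ring_mat_simps)
  have h_one: "h \<one>\<^bsub>B\<^esub> = 1\<^sub>m k"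
    using ring_hom_one[OF h] by (simp add: ring_mat_simps)
  \<comment> \<open>Read off entrywise from \<open>h (0 + 0) = h 0 + h 0\<close>, since membership
    in \<open>ring_hom\<close> does not mention zero.\<close>
  have h_zero: "h \<zero>\<^bsub>B\<^esub> = 0\<^sub>m k k"
  proof (rule eq_matI)
    fix i j assume "i < dim_row (0\<^sub>m k k :: 'd mat)" "j < dim_col (0\<^sub>m k k :: 'd mat)"
    then show "h \<zero>\<^bsub>B\<^esub> $$ (i, j) = 0\<^sub>m k k $$ (i, j)"
      using arg_cong[OF h_add[of "\<zero>\<^bsub>B\<^esub>" "\<zero>\<^bsub>B\<^esub>"], of "\<lambda>A. A $$ (i, j)"] h_closed[of "\<zero>\<^bsub>B\<^esub>"] by simp
  qed (use h_closed[of "\<zero>\<^bsub>B\<^esub>"] in auto)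
  have inj: "x = y" if "x \<in> carrier B" "y \<in> carrier B" "h x = h y" for x y
    using bij that by (meson bij_betw_def inj_onD)
  \<comment> \<open>Here \<open>k\<close> must be positive: matrices of size \<open>0\<close> form
    the zero ring.\<close>
  have "(1\<^sub>m k :: 'd mat) $$ (0, 0) \<noteq> 0\<^sub>m k k $$ (0, 0)"
    using \<open>1 \<le> k\<close> by simp
  then show "\<one>\<^bsub>B\<^esub> \<noteq> \<zero>\<^bsub>B\<^esub>"
    using h_one h_zero by metis
  show "H = {\<zero>\<^bsub>B\<^esub>} \<or> H = carrier B" if H: "two_sided_ideal H B"
  proof (cases "H = {\<zero>\<^bsub>B\<^esub>}")
    case False
    have sub: "subgroup H (add_monoid B)"
      using H by (simp add: two_sided_ideal_def)
    have mult: "a \<otimes>\<^bsub>B\<^esub> x \<in> H" "x \<otimes>\<^bsub>B\<^esub> a \<in> H" if "a \<in> carrier B" "x \<in> H" for a x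
      using H that by (auto simp: two_sided_ideal_def)
    have HB: "x \<in> carrier B" if "x \<in> H" for x
      using subgroup.subset[OF sub] that by auto
    have zero: "\<zero>\<^bsub>B\<^esub> \<in> H" using subgroup.one_closed[OF sub] by simp
    with False obtain x where x: "x \<in> H" "x \<noteq> \<zero>\<^bsub>B\<^esub>" by blast
    have surj: "\<exists>b\<in>carrier B. a = h b" if "a \<in> carrier_mat k k" for a :: "'d mat"
      using bij that by (auto simp: bij_betw_def)
    have "h ` H = carrier_mat k k"
    proof (rule mat_ideal_eq_carrier)
      show "h ` H \<subseteq> carrier_mat k k" using HB h_closed by blast
      show "0\<^sub>m k k \<in> h ` H" using zero h_zero by force
      show "h x \<in> h ` H" using x by blast
      show "h x \<noteq> 0\<^sub>m k k" using inj[OF HB[OF x(1)] zero_closed] h_zero x by auto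
    next
      fix u v :: "'d mat" assume "u \<in> h ` H" "v \<in> h ` H"
      then obtain x y where "u = h x" "v = h y" and xy: "x \<in> H" "y \<in> H" by blast
      then have "u + v = h (x \<oplus>\<^bsub>B\<^esub> y)" using h_add HB by simp
      moreover have "x \<oplus>\<^bsub>B\<^esub> y \<in> H" using subgroup.m_closed[OF sub] xy by simp
      ultimately show "u + v \<in> h ` H" by blast
    next
      fix a u c :: "'d mat" assume "u \<in> h ` H" "a \<in> carrier_mat k k" "c \<in> carrier_mat k k"
      then obtain x b d where "u = h x" "a = h b" "c = h d" and xy: "x \<in> H" "b \<in> carrier B" "d \<in> carrier B"
        using surj[of a] surj[of c] by auto
      then have "a * u * c = h (b \<otimes>\<^bsub>B\<^esub> x \<otimes>\<^bsub>B\<^esub> d)" using h_mult HB by simp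
      moreover have "b \<otimes>\<^bsub>B\<^esub> x \<otimes>\<^bsub>B\<^esub> d \<in> H" using mult xy by simp
      ultimately show "a * u * c \<in> h ` H" by blast
    qed
    then have "b \<in> H" if "b \<in> carrier B" for b
      using inj HB that h_closed[OF that] by (metis imageE)
    with HB show ?thesis by blast
  qed simp
qed

section \<open>Rings in sandwich coordinates\<close>

text \<open>
  The index \<open>0\<close> stands for an absent index: the coordinates \<open>(0, 0)\<close>, \<open>(i, 0)\<close>, \<open>(0, j)\<close> and
  \<open>(i, j)\<close> of an element of \<open>A\<close> are its components in \<open>B\<close>, \<open>J01 i\<close>, \<open>J10 j\<close> and \<open>J i j\<close>,
  all viewed in \<open>B\<close>.
\<close>

locale sandwich_data = B?: ring B
  for B :: "('b, 'c) ring_scheme" (structure) +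
  fixes n m :: nat and R L :: "nat \<Rightarrow> 'b set" and f' f :: "nat \<Rightarrow> 'b"
  assumes R_0: "R 0 = carrier B" and L_0: "L 0 = carrier B"
    and R_subgroup: "p \<le> n \<Longrightarrow> subgroup (R p) (add_monoid B)"
    and R_mult: "\<lbrakk>p \<le> n; r \<in> R p; b \<in> carrier B\<rbrakk> \<Longrightarrow> r \<otimes> b \<in> R p"
    and L_subgroup: "q \<le> m \<Longrightarrow> subgroup (L q) (add_monoid B)"
    and L_mult: "\<lbrakk>q \<le> m; l \<in> L q; b \<in> carrier B\<rbrakk> \<Longrightarrow> b \<otimes> l \<in> L q"
    and f'_closed: "i \<in> {1..n} \<Longrightarrow> f' i \<in> carrier B"
    and f'_orth: "\<lbrakk>i \<in> {1..n}; k \<in> {1..n}\<rbrakk> \<Longrightarrow> f' i \<otimes> f' k = (if i = k then f' i else \<zero>)"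
    and f'_sum: "(\<Oplus>i\<in>{1..n}. f' i) = \<one>"
    and f_closed: "j \<in> {1..m} \<Longrightarrow> f j \<in> carrier B"
    and f_orth: "\<lbrakk>j \<in> {1..m}; k \<in> {1..m}\<rbrakk> \<Longrightarrow> f j \<otimes> f k = (if j = k then f j else \<zero>)"
    and f_sum: "(\<Oplus>j\<in>{1..m}. f j) = \<one>"
    and f'_R: "\<lbrakk>i \<in> {1..n}; r \<in> R i\<rbrakk> \<Longrightarrow> f' i \<otimes> r = \<zero>"
    and L_f: "\<lbrakk>j \<in> {1..m}; l \<in> L j\<rbrakk> \<Longrightarrow> l \<otimes> f j = \<zero>"
    and simple: "two_sided_ideal H B \<Longrightarrow> H = {\<zero>} \<or> H = carrier B"
    and one_neq_zero: "\<one> \<noteq> \<zero>"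
begin

section \<open>Products of right ideals with left ideals\<close>

abbreviation M :: "nat \<Rightarrow> nat \<Rightarrow> 'b set" where
  "M p q \<equiv> additive_product B (R p) (L q)"

lemma R_carrier: "\<lbrakk>p \<le> n; r \<in> R p\<rbrakk> \<Longrightarrow> r \<in> carrier B"
  using subgroup.subset[OF R_subgroup] by auto

lemma L_carrier: "\<lbrakk>q \<le> m; l \<in> L q\<rbrakk> \<Longrightarrow> l \<in> carrier B"
  using subgroup.subset[OF L_subgroup] by auto

lemma M_subgroup:
  assumes "p \<le> n" "q \<le> m"
  shows "subgroup (M p q) (add_monoid B)"
  unfolding additive_product_def
  by (rule add.generate_is_subgroup) (use assms R_carrier L_carrier in \<open>auto simp: set_mult_def\<close>)

lemma M_carrier: "\<lbrakk>p \<le> n; q \<le> m; x \<in> M p q\<rbrakk> \<Longrightarrow> x \<in> carrier B"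
  using subgroup.subset[OF M_subgroup] by auto

lemma zero_M: "\<lbrakk>p \<le> n; q \<le> m\<rbrakk> \<Longrightarrow> \<zero> \<in> M p q"
  using subgroup.one_closed[OF M_subgroup] by simp

lemma add_M: "\<lbrakk>p \<le> n; q \<le> m; x \<in> M p q; y \<in> M p q\<rbrakk> \<Longrightarrow> x \<oplus> y \<in> M p q"
  using subgroup.m_closed[OF M_subgroup] by simp

lemma minus_M: "\<lbrakk>p \<le> n; q \<le> m; x \<in> M p q; y \<in> M p q\<rbrakk> \<Longrightarrow> x \<ominus> y \<in> M p q"
  using subgroup.m_inv_closed[OF M_subgroup] add_M by (simp add: a_minus_def a_inv_def)

lemma mult_M: "\<lbrakk>r \<in> R p; l \<in> L q\<rbrakk> \<Longrightarrow> r \<otimes> l \<in> M p q"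
  unfolding additive_product_def by (rule generate.incl) (auto simp: set_mult_def)

lemma M_subset_R: "\<lbrakk>p \<le> n; q \<le> m\<rbrakk> \<Longrightarrow> M p q \<subseteq> R p"
  unfolding additive_product_def
  by (rule add.generate_subgroup_incl[OF _ R_subgroup])
    (auto simp: set_mult_def intro: R_mult L_carrier)

lemma M_subset_L: "\<lbrakk>p \<le> n; q \<le> m\<rbrakk> \<Longrightarrow> M p q \<subseteq> L q"
  unfolding additive_product_def
  by (rule add.generate_subgroup_incl[OF _ L_subgroup])
    (auto simp: set_mult_def intro: L_mult R_carrier)

text \<open>Since \<open>1\<close> lies in \<open>R 0 = L 0 = B\<close>, the products
  \<open>R p B\<close> and \<open>B L q\<close> collapse to \<open>R p\<close> and
  \<open>L q\<close>. The border positions thus need no separate treatment: every entry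
  \<open>(p, q)\<close> lies in \<open>M p q\<close>.\<close>

lemma M_0_right: assumes "p \<le> n" shows "M p 0 = R p"
proof
  show "R p \<subseteq> M p 0"
    using mult_M[of _ p \<one> 0] L_0 R_carrier[OF assms] by fastforce
qed (use M_subset_R assms in auto)

lemma M_0_left: assumes "q \<le> m" shows "M 0 q = L q"
proof
  show "L q \<subseteq> M 0 q"
    using mult_M[of \<one> 0 _ q] R_0 L_carrier[OF assms] by fastforce
qed (use M_subset_L assms in auto)

end

text \<open>An interface that forgets the tuples: equations in \<open>A\<close> are verified
  entrywise by \<open>co_inj\<close>, elements are built from their entries by
  \<open>co_surj\<close>, and products are computed by \<open>co_mult\<close>.\<close>

locale sandwich_ring = sandwich_data B n m R L f' f + A: abelian_group A
  for B :: "('b, 'c) ring_scheme" (structure) and n m R L f' f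
    and A :: "('a, 'd) ring_scheme" +
  fixes co :: "nat \<Rightarrow> nat \<Rightarrow> 'a \<Rightarrow> 'b"
  assumes mult_closed: "\<lbrakk>a \<in> carrier A; a' \<in> carrier A\<rbrakk> \<Longrightarrow> a \<otimes>\<^bsub>A\<^esub> a' \<in> carrier A"
    and co_hom: "\<lbrakk>p \<le> n; q \<le> m\<rbrakk> \<Longrightarrow> abelian_group_hom A B (co p q)"
    and co_mult: "\<lbrakk>p \<le> n; q \<le> m; a \<in> carrier A; a' \<in> carrier A\<rbrakk>
          \<Longrightarrow> co p q (a \<otimes>\<^bsub>A\<^esub> a') = co p 0 a \<otimes> co 0 q a'"
    and co_inj: "\<lbrakk>a \<in> carrier A; a' \<in> carrier A; \<And>p q. \<lbrakk>p \<le> n; q \<le> m\<rbrakk> \<Longrightarrow> co p q a = co p q a'\<rbrakk>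
          \<Longrightarrow> a = a'"
    and co_image: "\<lbrakk>p \<le> n; q \<le> m; a \<in> carrier A\<rbrakk> \<Longrightarrow> co p q a \<in> M p q"
    and co_surj: "(\<And>p q. \<lbrakk>p \<le> n; q \<le> m\<rbrakk> \<Longrightarrow> y p q \<in> M p q)
          \<Longrightarrow> \<exists>a\<in>carrier A. \<forall>p\<le>n. \<forall>q\<le>m. co p q a = y p q"
begin

section \<open>Elements given by their coordinates\<close>

lemma co_closed: "\<lbrakk>p \<le> n; q \<le> m; a \<in> carrier A\<rbrakk> \<Longrightarrow> co p q a \<in> carrier B"
  using co_image M_carrier by blast

lemma co_add: "\<lbrakk>p \<le> n; q \<le> m; a \<in> carrier A; a' \<in> carrier A\<rbrakk>
    \<Longrightarrow> co p q (a \<oplus>\<^bsub>A\<^esub> a') = co p q a \<oplus> co p q a'"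
  using abelian_group_hom.hom_add[OF co_hom] .

lemma co_zero: "\<lbrakk>p \<le> n; q \<le> m\<rbrakk> \<Longrightarrow> co p q \<zero>\<^bsub>A\<^esub> = \<zero>"
  using abelian_group_hom.hom_zero[OF co_hom] .

text \<open>The inverse of the passage to coordinates; by \<open>co_inj\<close> the choice is unique
  whenever the entries are admissible.\<close>

definition mk :: "(nat \<Rightarrow> nat \<Rightarrow> 'b) \<Rightarrow> 'a" where
  "mk y = (SOME a. a \<in> carrier A \<and> (\<forall>p\<le>n. \<forall>q\<le>m. co p q a = y p q))"

lemma mk:
  assumes "\<And>p q. \<lbrakk>p \<le> n; q \<le> m\<rbrakk> \<Longrightarrow> y p q \<in> M p q"
  shows mk_closed: "mk y \<in> carrier A"
    and co_mk: "\<lbrakk>p \<le> n; q \<le> m\<rbrakk> \<Longrightarrow> co p q (mk y) = y p q"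
proof -
  have "\<exists>a. a \<in> carrier A \<and> (\<forall>p\<le>n. \<forall>q\<le>m. co p q a = y p q)"
    using co_surj[of y] assms by blast
  from someI_ex[OF this] show "mk y \<in> carrier A"
    and "\<lbrakk>p \<le> n; q \<le> m\<rbrakk> \<Longrightarrow> co p q (mk y) = y p q"
    unfolding mk_def by auto
qed

lemma abelian_group_hom_mkI:
  assumes "\<And>a p q. \<lbrakk>a \<in> carrier A; p \<le> n; q \<le> m\<rbrakk> \<Longrightarrow> y a p q \<in> M p q"
    and "\<And>a a' p q. \<lbrakk>a \<in> carrier A; a' \<in> carrier A; p \<le> n; q \<le> m\<rbrakk>
           \<Longrightarrow> y (a \<oplus>\<^bsub>A\<^esub> a') p q = y a p q \<oplus> y a' p q"
  shows "abelian_group_hom A A (\<lambda>a. mk (y a))"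
proof (rule abelian_group_homI)
  show "abelian_group A" "abelian_group A" by (rule A.abelian_group_axioms)+
  have cl: "mk (y a) \<in> carrier A" if "a \<in> carrier A" for a
    using mk_closed assms(1) that .
  have "mk (y (a \<oplus>\<^bsub>A\<^esub> a')) = mk (y a) \<oplus>\<^bsub>A\<^esub> mk (y a')"
    if a: "a \<in> carrier A" "a' \<in> carrier A" for a a'
  proof (rule co_inj)
    fix p q assume pq: "p \<le> n" "q \<le> m"
    have "co p q (mk (y b)) = y b p q" if "b \<in> carrier A" for b
      by (rule co_mk) (use assms(1) that pq in auto)
    then show "co p q (mk (y (a \<oplus>\<^bsub>A\<^esub> a'))) = co p q (mk (y a) \<oplus>\<^bsub>A\<^esub> mk (y a'))"
      using a pq cl assms(2) by (simp add: co_add)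
  qed (use a cl in auto)
  with cl have "(\<lambda>a. mk (y a)) \<in> hom (add_monoid A) (add_monoid A)"
    by (auto simp: hom_def)
  then show "group_hom (add_monoid A) (add_monoid A) (\<lambda>a. mk (y a))"
    by (intro group_hom.intro group_hom_axioms.intro A.a_group)
qed

text \<open>Under either bracketing, entry \<open>(p, q)\<close> of a triple product is
  \<open>co p 0 x * co 0 0 y * co 0 q z\<close>; the distributive laws are likewise those of
  \<open>B\<close>.\<close>

lemma nonunital: "nonunital_ring A"
proof -
  have eq: "a = a'" if "a \<in> carrier A" "a' \<in> carrier A" "\<And>p q. \<lbrakk>p \<le> n; q \<le> m\<rbrakk> \<Longrightarrow> co p q a = co p q a'" for a a'
    using co_inj that .
  show ?thesis
  proof (intro nonunital_ring.intro nonunital_ring_axioms.intro A.abelian_group_axioms)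
    fix x y z assume "x \<in> carrier A" "y \<in> carrier A" "z \<in> carrier A"
    then show "x \<otimes>\<^bsub>A\<^esub> y \<otimes>\<^bsub>A\<^esub> z = x \<otimes>\<^bsub>A\<^esub> (y \<otimes>\<^bsub>A\<^esub> z)"
      "(x \<oplus>\<^bsub>A\<^esub> y) \<otimes>\<^bsub>A\<^esub> z = x \<otimes>\<^bsub>A\<^esub> z \<oplus>\<^bsub>A\<^esub> y \<otimes>\<^bsub>A\<^esub> z"
      "z \<otimes>\<^bsub>A\<^esub> (x \<oplus>\<^bsub>A\<^esub> y) = z \<otimes>\<^bsub>A\<^esub> x \<oplus>\<^bsub>A\<^esub> z \<otimes>\<^bsub>A\<^esub> y"
      by (auto intro!: eq simp: mult_closed co_mult co_add co_closed m_assoc l_distr r_distr)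
  qed (rule mult_closed)
qed

definition single :: "nat \<Rightarrow> nat \<Rightarrow> 'b \<Rightarrow> 'a" where
  "single p q x = mk (\<lambda>p' q'. if p' = p \<and> q' = q then x else \<zero>)"

lemma single:
  assumes "p \<le> n" "q \<le> m" "x \<in> M p q"
  shows single_closed: "single p q x \<in> carrier A"
    and co_single: "\<lbrakk>p' \<le> n; q' \<le> m\<rbrakk> \<Longrightarrow> co p' q' (single p q x) = (if p' = p \<and> q' = q then x else \<zero>)"
  unfolding single_def using assms zero_M by (auto intro!: mk_closed simp: co_mk)

lemma single_add:
  assumes "p \<le> n" "q \<le> m" "x \<in> M p q" "y \<in> M p q"
  shows "single p q (x \<oplus> y) = single p q x \<oplus>\<^bsub>A\<^esub> single p q y"
  using assms by (intro co_inj) (auto simp: single_closed co_single co_add add_M)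

text \<open>
  Every element is a sum of products, since the coordinates of \<open>A\<close> range over sums of
  products \<open>r l\<close> with \<open>r \<in> R p\<close> and \<open>l \<in> L q\<close>, and \<open>1\<close> lies in \<open>R 0\<close> and \<open>L 0\<close>.
\<close>

lemma subgroup_of_products:
  assumes H: "subgroup H (add_monoid A)"
    and prods: "\<And>a a'. \<lbrakk>a \<in> carrier A; a' \<in> carrier A\<rbrakk> \<Longrightarrow> a \<otimes>\<^bsub>A\<^esub> a' \<in> H"
  shows "H = carrier A"
proof
  show "H \<subseteq> carrier A" using subgroup.subset[OF H] by simp
  \<comment> \<open>Membership in \<open>M p q\<close> is carried through the induction because the
    properties of \<open>single p q\<close> are available only there.\<close>
  have mem: "x \<in> M p q \<and> single p q x \<in> H" if pq: "p \<le> n" "q \<le> m" and x: "x \<in> M p q" for p q x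
    using x unfolding additive_product_def
  proof (induction rule: generate.induct)
    case one
    have "single p q \<zero> = \<zero>\<^bsub>A\<^esub>"
      using pq by (intro co_inj) (auto simp: single_closed co_single co_zero zero_M)
    then show ?case
      using subgroup.one_closed[OF H] zero_M[OF pq] by (simp add: additive_product_def)
  next
    case (incl x)
    then obtain r l where x: "x = r \<otimes> l" and r: "r \<in> R p" and l: "l \<in> L q"
      by (auto simp: set_mult_def)
    \<comment> \<open>Entry \<open>(p, q)\<close> is split into a left factor in column
      \<open>0\<close> and a right factor in row \<open>0\<close>, the only places that a product
      looks at.\<close>
    have "single p q x = single p 0 r \<otimes>\<^bsub>A\<^esub> single 0 q l"
      using pq r l M_0_left M_0_right mult_M[OF r l] R_carrier L_carrier unfolding x
      by (intro co_inj) (auto simp: single_closed co_single co_mult mult_closed)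
    then show ?case
      using prods[of "single p 0 r" "single 0 q l"] mult_M[OF r l] pq r l M_0_left M_0_right
      by (simp add: x single_closed additive_product_def)
  next
    case (inv x)
    then obtain r l where x: "x = r \<otimes> l" and r: "r \<in> R p" and l: "l \<in> L q"
      by (auto simp: set_mult_def)
    \<comment> \<open>The inverse of a generator is again a product: the sign moves to
      \<open>r\<close>, which stays in \<open>R p\<close>.\<close>
    have r': "\<ominus> r \<in> R p"
      using subgroup.m_inv_closed[OF R_subgroup[OF pq(1)] r] by (simp add: a_inv_def)
    have ix: "inv\<^bsub>add_monoid B\<^esub> x = (\<ominus> r) \<otimes> l"
      using r l pq R_carrier L_carrier by (simp add: x l_minus a_inv_def[symmetric])
    have "single p q ((\<ominus> r) \<otimes> l) = single p 0 (\<ominus> r) \<otimes>\<^bsub>A\<^esub> single 0 q l"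
      using pq r' l M_0_left M_0_right mult_M[OF r' l] R_carrier L_carrier
      by (intro co_inj) (auto simp: single_closed co_single co_mult mult_closed)
    then show ?case
      using prods[of "single p 0 (\<ominus> r)" "single 0 q l"] mult_M[OF r' l] pq r' l M_0_left M_0_right
      by (simp add: ix single_closed additive_product_def)
  next
    case (eng x y)
    then show ?case
      using subgroup.m_closed[OF H] add_M[OF pq] single_add[OF pq]
      by (simp add: additive_product_def)
  qed
  show "carrier A \<subseteq> H"
  proof
    fix a assume a: "a \<in> carrier A"
    \<comment> \<open>\<open>a\<close> is the sum of its entries, each placed on its own in an
      otherwise zero matrix.\<close>
    let ?s = "\<lambda>(p, q). single p q (co p q a)"
    have s: "?s t \<in> carrier A" if "t \<in> {..n} \<times> {..m}" for t
      using that a co_image by (auto intro: single_closed)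
    have "finsum A ?s ({..n} \<times> {..m}) = a"
    proof (rule co_inj)
      fix p q assume pq: "p \<le> n" "q \<le> m"
      interpret co: abelian_group_hom A B "co p q" using co_hom pq .
      have "co p q (finsum A ?s ({..n} \<times> {..m})) = (\<Oplus>t\<in>{..n} \<times> {..m}. co p q (?s t))"
        using s by (intro co.hom_finsum) auto
      also have "\<dots> = (\<Oplus>t\<in>{..n} \<times> {..m}. if (p, q) = t then co p q a else \<zero>)"
        by (rule B.add.finprod_cong') (use a pq co_image co_closed in \<open>auto simp: co_single split: if_splits\<close>)
      also have "\<dots> = co p q a"
        using B.finsum_singleton[of "(p, q)" "{..n} \<times> {..m}" "\<lambda>_. co p q a"] pq a co_closed by auto
      finally show "co p q (finsum A ?s ({..n} \<times> {..m})) = co p q a" .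
    qed (use s a in auto)
    moreover have "finsum A ?s ({..n} \<times> {..m}) \<in> H"
      by (rule A.subgroup_finsum_closed[OF H]) (use mem a co_image in auto)
    ultimately show "a \<in> H" by simp
  qed
qed

section \<open>Row and column projections\<close>

sublocale rows: orthogonal_projections B n "\<lambda>i x. f' i \<otimes> x"
proof (intro orthogonal_projections.intro orthogonal_projections_axioms.intro abelian_group_axioms)
  fix i assume i: "i \<in> {1..n}"
  show "abelian_group_hom B B (\<lambda>x. f' i \<otimes> x)"
    by (rule abelian_group_homI)
      (use i f'_closed in \<open>auto simp: hom_def r_distr abelian_group_axioms
         intro!: group_hom.intro group_hom_axioms.intro a_group\<close>)
next
  fix i k x assume "i \<in> {1..n}" "k \<in> {1..n}" "x \<in> carrier B"
  then show "f' i \<otimes> (f' k \<otimes> x) = (if i = k then f' i \<otimes> x else \<zero>)"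
    using f'_orth[of i k] f'_closed by (simp add: m_assoc[symmetric])
next
  fix x assume x: "x \<in> carrier B"
  have "(\<Oplus>i\<in>{1..n}. f' i \<otimes> x) = (\<Oplus>i\<in>{1..n}. f' i) \<otimes> x"
    using f'_closed x by (intro finsum_ldistr[symmetric]) auto
  then show "(\<Oplus>i\<in>{1..n}. f' i \<otimes> x) = x" using f'_sum x by simp
qed

text \<open>The mirror image: shears use only additive maps, so right multiplications fit as well.
  Composition reverses the order of the factors, which is why the indices are exchanged in the
  appeal to \<open>f_orth\<close>.\<close>

sublocale cols: orthogonal_projections B m "\<lambda>j x. x \<otimes> f j"
proof (intro orthogonal_projections.intro orthogonal_projections_axioms.intro abelian_group_axioms)
  fix j assume j: "j \<in> {1..m}"
  show "abelian_group_hom B B (\<lambda>x. x \<otimes> f j)"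
    by (rule abelian_group_homI)
      (use j f_closed in \<open>auto simp: hom_def l_distr abelian_group_axioms
         intro!: group_hom.intro group_hom_axioms.intro a_group\<close>)
next
  fix j k x assume "j \<in> {1..m}" "k \<in> {1..m}" "x \<in> carrier B"
  then show "(x \<otimes> f k) \<otimes> f j = (if j = k then x \<otimes> f j else \<zero>)"
    using f_orth[of k j] f_closed by (simp add: m_assoc)
next
  fix x assume x: "x \<in> carrier B"
  have "(\<Oplus>j\<in>{1..m}. x \<otimes> f j) = x \<otimes> (\<Oplus>j\<in>{1..m}. f j)"
    using f_closed x by (intro finsum_rdistr[symmetric]) auto
  then show "(\<Oplus>j\<in>{1..m}. x \<otimes> f j) = x" using f_sum x by simp
qed

text \<open>In a homogeneous element of row index \<open>i\<close> the entries of row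
  \<open>i\<close> recur inside row \<open>0\<close>. Hence row \<open>0\<close> is first freed of
  all other rows and multiplied by \<open>f' i\<close>, and then row \<open>i\<close> is added
  back.\<close>

definition row_proj :: "nat \<Rightarrow> 'a \<Rightarrow> 'a" where
  "row_proj i a = mk (\<lambda>p q. rows.shear i (\<lambda>p'. co p' q a) p)"

definition col_proj :: "nat \<Rightarrow> 'a \<Rightarrow> 'a" where
  "col_proj j a = mk (\<lambda>p q. cols.shear j (\<lambda>q'. co p q' a) q)"

text \<open>The entries of column \<open>q\<close> lie in different groups \<open>M p' q\<close>,
  but all of these are contained in the left ideal \<open>L q = M 0 q\<close>, where the sum and the
  multiplication by \<open>f' i\<close> take place. Row \<open>i\<close> keeps its own
  entry.\<close>

lemma row_shear_M:
  assumes i: "i \<in> {1..n}" and a: "a \<in> carrier A" and pq: "p \<le> n" "q \<le> m"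
  shows "rows.shear i (\<lambda>p'. co p' q a) p \<in> M p q"
proof -
  have c: "co p' q a \<in> M 0 q" if "p' \<le> n" for p'
    using that a pq co_image M_subset_L M_0_left by blast
  have t: "(\<Oplus>k\<in>{1..n}. co k q a) \<in> M 0 q"
    by (rule subgroup_finsum_closed[OF M_subgroup]) (use c pq in auto)
  have "f' i \<otimes> (co 0 q a \<ominus> (\<Oplus>k\<in>{1..n}. co k q a)) \<in> M 0 q"
    using minus_M[OF _ pq(2) c[of 0] t] L_mult[OF pq(2)] M_0_left[OF pq(2)] f'_closed[OF i] by auto
  then show ?thesis
    using c[of i] i a pq co_image zero_M add_M by (auto simp: rows.shear_def)
qed

lemma col_shear_M:
  assumes j: "j \<in> {1..m}" and a: "a \<in> carrier A" and pq: "p \<le> n" "q \<le> m"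
  shows "cols.shear j (\<lambda>q'. co p q' a) q \<in> M p q"
proof -
  have c: "co p q' a \<in> M p 0" if "q' \<le> m" for q'
    using that a pq co_image M_subset_R M_0_right by blast
  have t: "(\<Oplus>k\<in>{1..m}. co p k a) \<in> M p 0"
    by (rule subgroup_finsum_closed[OF M_subgroup]) (use c pq in auto)
  have "(co p 0 a \<ominus> (\<Oplus>k\<in>{1..m}. co p k a)) \<otimes> f j \<in> M p 0"
    using minus_M[OF pq(1) _ c[of 0] t] R_mult[OF pq(1)] M_0_right[OF pq(1)] f_closed[OF j] by auto
  then show ?thesis
    using c[of j] j a pq co_image zero_M add_M by (auto simp: cols.shear_def)
qed

lemma row_proj:
  assumes "i \<in> {1..n}" and "a \<in> carrier A"
  shows row_proj_closed: "row_proj i a \<in> carrier A"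
    and co_row_proj: "\<lbrakk>p \<le> n; q \<le> m\<rbrakk> \<Longrightarrow> co p q (row_proj i a) = rows.shear i (\<lambda>p'. co p' q a) p"
  unfolding row_proj_def using row_shear_M[OF assms] by (auto intro: mk_closed simp: co_mk)

lemma col_proj:
  assumes "j \<in> {1..m}" and "a \<in> carrier A"
  shows col_proj_closed: "col_proj j a \<in> carrier A"
    and co_col_proj: "\<lbrakk>p \<le> n; q \<le> m\<rbrakk> \<Longrightarrow> co p q (col_proj j a) = cols.shear j (\<lambda>q'. co p q' a) q"
  unfolding col_proj_def using col_shear_M[OF assms] by (auto intro: mk_closed simp: co_mk)

lemma row_shear_add:
  assumes "i \<in> {1..n}" "a \<in> carrier A" "a' \<in> carrier A" "q \<le> m"
  shows "rows.shear i (\<lambda>p'. co p' q (a \<oplus>\<^bsub>A\<^esub> a')) p =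
         rows.shear i (\<lambda>p'. co p' q a) p \<oplus> rows.shear i (\<lambda>p'. co p' q a') p"
proof -
  have "rows.shear i (\<lambda>p'. co p' q (a \<oplus>\<^bsub>A\<^esub> a')) p = rows.shear i (\<lambda>p'. co p' q a \<oplus> co p' q a') p"
    by (rule rows.shear_cong) (use assms in \<open>auto simp: co_add co_closed\<close>)
  also have "\<dots> = rows.shear i (\<lambda>p'. co p' q a) p \<oplus> rows.shear i (\<lambda>p'. co p' q a') p"
    by (rule rows.shear_add) (use assms in \<open>auto simp: co_closed\<close>)
  finally show ?thesis .
qed

lemma col_shear_add:
  assumes "j \<in> {1..m}" "a \<in> carrier A" "a' \<in> carrier A" "p \<le> n"
  shows "cols.shear j (\<lambda>q'. co p q' (a \<oplus>\<^bsub>A\<^esub> a')) q =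
         cols.shear j (\<lambda>q'. co p q' a) q \<oplus> cols.shear j (\<lambda>q'. co p q' a') q"
proof -
  have "cols.shear j (\<lambda>q'. co p q' (a \<oplus>\<^bsub>A\<^esub> a')) q = cols.shear j (\<lambda>q'. co p q' a \<oplus> co p q' a') q"
    by (rule cols.shear_cong) (use assms in \<open>auto simp: co_add co_closed\<close>)
  also have "\<dots> = cols.shear j (\<lambda>q'. co p q' a) q \<oplus> cols.shear j (\<lambda>q'. co p q' a') q"
    by (rule cols.shear_add) (use assms in \<open>auto simp: co_closed\<close>)
  finally show ?thesis .
qed

lemma row_proj_hom: "i \<in> {1..n} \<Longrightarrow> abelian_group_hom A A (row_proj i)"
  unfolding row_proj_def
  by (rule abelian_group_hom_mkI) (auto simp: row_shear_M row_shear_add)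

lemma col_proj_hom: "j \<in> {1..m} \<Longrightarrow> abelian_group_hom A A (col_proj j)"
  unfolding col_proj_def
  by (rule abelian_group_hom_mkI) (auto simp: col_shear_M col_shear_add)

lemma row_proj_row_proj:
  assumes i: "i \<in> {1..n}" and k: "k \<in> {1..n}" and a: "a \<in> carrier A"
  shows "row_proj i (row_proj k a) = (if i = k then row_proj i a else \<zero>\<^bsub>A\<^esub>)"
proof (rule co_inj)
  fix p q assume pq: "p \<le> n" "q \<le> m"
  have "co p q (row_proj i (row_proj k a)) = rows.shear i (\<lambda>p'. co p' q (row_proj k a)) p"
    using assms pq by (simp add: co_row_proj row_proj_closed)
  also have "\<dots> = rows.shear i (rows.shear k (\<lambda>p'. co p' q a)) p"
    by (rule rows.shear_cong) (use assms pq in \<open>auto simp: co_row_proj intro!: rows.shear_closed co_closed\<close>)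
  also have "\<dots> = (if i = k then rows.shear i (\<lambda>p'. co p' q a) p else \<zero>)"
    by (rule rows.shear_shear[OF i k]) (use a pq in \<open>auto simp: co_closed\<close>)
  finally show "co p q (row_proj i (row_proj k a)) = co p q (if i = k then row_proj i a else \<zero>\<^bsub>A\<^esub>)"
    using assms pq by (simp add: co_row_proj co_zero)
qed (use assms row_proj_closed in auto)

lemma col_proj_col_proj:
  assumes j: "j \<in> {1..m}" and k: "k \<in> {1..m}" and a: "a \<in> carrier A"
  shows "col_proj j (col_proj k a) = (if j = k then col_proj j a else \<zero>\<^bsub>A\<^esub>)"
proof (rule co_inj)
  fix p q assume pq: "p \<le> n" "q \<le> m"
  have "co p q (col_proj j (col_proj k a)) = cols.shear j (\<lambda>q'. co p q' (col_proj k a)) q"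
    using assms pq by (simp add: co_col_proj col_proj_closed)
  also have "\<dots> = cols.shear j (cols.shear k (\<lambda>q'. co p q' a)) q"
    by (rule cols.shear_cong) (use assms pq in \<open>auto simp: co_col_proj intro!: cols.shear_closed co_closed\<close>)
  also have "\<dots> = (if j = k then cols.shear j (\<lambda>q'. co p q' a) q else \<zero>)"
    by (rule cols.shear_shear[OF j k]) (use a pq in \<open>auto simp: co_closed\<close>)
  finally show "co p q (col_proj j (col_proj k a)) = co p q (if j = k then col_proj j a else \<zero>\<^bsub>A\<^esub>)"
    using assms pq by (simp add: co_col_proj co_zero)
qed (use assms col_proj_closed in auto)

lemma sum_row_proj:
  assumes a: "a \<in> carrier A"
  shows "(\<Oplus>\<^bsub>A\<^esub>i\<in>{1..n}. row_proj i a) = a"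
proof (rule co_inj)
  fix p q assume pq: "p \<le> n" "q \<le> m"
  interpret co: abelian_group_hom A B "co p q" using co_hom pq .
  have "co p q (\<Oplus>\<^bsub>A\<^esub>i\<in>{1..n}. row_proj i a) = (\<Oplus>i\<in>{1..n}. co p q (row_proj i a))"
    by (rule co.hom_finsum) (use a row_proj_closed in auto)
  also have "\<dots> = (\<Oplus>i\<in>{1..n}. rows.shear i (\<lambda>p'. co p' q a) p)"
    by (rule B.add.finprod_cong')
      (use a pq in \<open>auto simp: co_row_proj intro!: rows.shear_closed co_closed\<close>)
  also have "\<dots> = co p q a"
    by (rule rows.sum_shear) (use a pq in \<open>auto simp: co_closed\<close>)
  finally show "co p q (\<Oplus>\<^bsub>A\<^esub>i\<in>{1..n}. row_proj i a) = co p q a" .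
qed (use a row_proj_closed in auto)

lemma sum_col_proj:
  assumes a: "a \<in> carrier A"
  shows "(\<Oplus>\<^bsub>A\<^esub>j\<in>{1..m}. col_proj j a) = a"
proof (rule co_inj)
  fix p q assume pq: "p \<le> n" "q \<le> m"
  interpret co: abelian_group_hom A B "co p q" using co_hom pq .
  have "co p q (\<Oplus>\<^bsub>A\<^esub>j\<in>{1..m}. col_proj j a) = (\<Oplus>j\<in>{1..m}. co p q (col_proj j a))"
    by (rule co.hom_finsum) (use a col_proj_closed in auto)
  also have "\<dots> = (\<Oplus>j\<in>{1..m}. cols.shear j (\<lambda>q'. co p q' a) q)"
    by (rule B.add.finprod_cong')
      (use a pq in \<open>auto simp: co_col_proj intro!: cols.shear_closed co_closed\<close>)
  also have "\<dots> = co p q a"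
    by (rule cols.sum_shear) (use a pq in \<open>auto simp: co_closed\<close>)
  finally show "co p q (\<Oplus>\<^bsub>A\<^esub>j\<in>{1..m}. col_proj j a) = co p q a" .
qed (use a col_proj_closed in auto)

lemma mult_hom:
  assumes "y \<in> carrier B"
  shows "abelian_group_hom B B (\<lambda>x. x \<otimes> y)" and "abelian_group_hom B B (\<lambda>x. y \<otimes> x)"
  by (rule abelian_group_homI; use assms in \<open>auto simp: hom_def l_distr r_distr abelian_group_axioms
         intro!: group_hom.intro group_hom_axioms.intro a_group\<close>)+

text \<open>Column \<open>q\<close> of the product is column \<open>0\<close> of \<open>a\<close>
  times the single element \<open>?y\<close>, and right multiplication by \<open>?y\<close> commutes
  with left multiplication by \<open>f' i\<close>.\<close>

lemma row_proj_mult: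
  assumes i: "i \<in> {1..n}" and a: "a \<in> carrier A" "a' \<in> carrier A"
  shows "row_proj i (a \<otimes>\<^bsub>A\<^esub> a') = row_proj i a \<otimes>\<^bsub>A\<^esub> a'"
proof (rule co_inj)
  fix p q assume pq: "p \<le> n" "q \<le> m"
  let ?y = "co 0 q a'"
  have y: "?y \<in> carrier B" using a pq co_closed by simp
  have "co p q (row_proj i (a \<otimes>\<^bsub>A\<^esub> a')) = rows.shear i (\<lambda>p'. co p' q (a \<otimes>\<^bsub>A\<^esub> a')) p"
    using assms pq by (simp add: co_row_proj mult_closed)
  also have "\<dots> = rows.shear i (\<lambda>p'. co p' 0 a \<otimes> ?y) p"
    by (rule rows.shear_cong) (use assms pq y in \<open>auto simp: co_mult co_closed\<close>)
  also have "\<dots> = rows.shear i (\<lambda>p'. co p' 0 a) p \<otimes> ?y"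
    by (rule rows.shear_hom[OF rows.orthogonal_projections_axioms mult_hom(1)[OF y] _ i])
      (use i a y f'_closed in \<open>auto simp: co_closed m_assoc\<close>)
  finally show "co p q (row_proj i (a \<otimes>\<^bsub>A\<^esub> a')) = co p q (row_proj i a \<otimes>\<^bsub>A\<^esub> a')"
    using assms pq by (simp add: co_row_proj co_mult row_proj_closed)
qed (use assms row_proj_closed mult_closed in auto)

lemma col_proj_mult:
  assumes j: "j \<in> {1..m}" and a: "a \<in> carrier A" "a' \<in> carrier A"
  shows "col_proj j (a \<otimes>\<^bsub>A\<^esub> a') = a \<otimes>\<^bsub>A\<^esub> col_proj j a'"
proof (rule co_inj)
  fix p q assume pq: "p \<le> n" "q \<le> m"
  let ?y = "co p 0 a"
  have y: "?y \<in> carrier B" using a pq co_closed by simp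
  have "co p q (col_proj j (a \<otimes>\<^bsub>A\<^esub> a')) = cols.shear j (\<lambda>q'. co p q' (a \<otimes>\<^bsub>A\<^esub> a')) q"
    using assms pq by (simp add: co_col_proj mult_closed)
  also have "\<dots> = cols.shear j (\<lambda>q'. ?y \<otimes> co 0 q' a') q"
    by (rule cols.shear_cong) (use assms pq y in \<open>auto simp: co_mult co_closed\<close>)
  also have "\<dots> = ?y \<otimes> cols.shear j (\<lambda>q'. co 0 q' a') q"
    by (rule cols.shear_hom[OF cols.orthogonal_projections_axioms mult_hom(2)[OF y] _ j])
      (use j a y f_closed in \<open>auto simp: co_closed m_assoc\<close>)
  finally show "co p q (col_proj j (a \<otimes>\<^bsub>A\<^esub> a')) = co p q (a \<otimes>\<^bsub>A\<^esub> col_proj j a')"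
    using assms pq by (simp add: co_col_proj co_mult col_proj_closed)
qed (use assms col_proj_closed mult_closed in auto)

lemma row_proj_col_proj:
  assumes i: "i \<in> {1..n}" and j: "j \<in> {1..m}" and a: "a \<in> carrier A"
  shows "row_proj i (col_proj j a) = col_proj j (row_proj i a)"
proof -
  interpret \<rho>: abelian_group_hom A A "row_proj i" using row_proj_hom i .
  interpret \<sigma>: abelian_group_hom A A "col_proj j" using col_proj_hom j .
  let ?H = "{a \<in> carrier A. row_proj i (col_proj j a) = col_proj j (row_proj i a)}"
  have "?H = carrier A"
  proof (rule subgroup_of_products)
    show "subgroup ?H (add_monoid A)"
    proof (rule A.add.subgroupI)
      show "?H \<noteq> {}" using \<rho>.hom_zero \<sigma>.hom_zero by force
      show "\<And>a. a \<in> ?H \<Longrightarrow> \<ominus>\<^bsub>A\<^esub> a \<in> ?H"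
        using i j by (auto simp: \<rho>.hom_a_inv \<sigma>.hom_a_inv)
    qed (use i j in auto)
  next
    fix a a' assume "a \<in> carrier A" "a' \<in> carrier A"
    \<comment> \<open>On a product both composites give \<open>row_proj i a\<close> times
      \<open>col_proj j a'\<close>, each projection acting on its own factor.\<close>
    then show "a \<otimes>\<^bsub>A\<^esub> a' \<in> ?H"
      using i j by (simp add: row_proj_mult col_proj_mult row_proj_closed col_proj_closed mult_closed)
  qed
  with a show ?thesis by blast
qed

section \<open>Homogeneous components\<close>

definition component :: "nat \<Rightarrow> nat \<Rightarrow> 'a set" where
  "component i j = {a \<in> carrier A. row_proj i a = a \<and> col_proj j a = a}"

text \<open>\<open>shear_fixed_iff\<close> is applied to every column and every row. The outcome is
  the bridge to the explicit components: support on rows \<open>0, i\<close> and columns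
  \<open>0, j\<close>, and differences that absorb the idempotents.\<close>

lemma component_iff:
  assumes i: "i \<in> {1..n}" and j: "j \<in> {1..m}" and a: "a \<in> carrier A"
  shows "a \<in> component i j \<longleftrightarrow>
    (\<forall>p\<le>n. \<forall>q\<le>m. (p \<noteq> 0 \<and> p \<noteq> i) \<or> (q \<noteq> 0 \<and> q \<noteq> j) \<longrightarrow> co p q a = \<zero>) \<and>
    (\<forall>q\<le>m. f' i \<otimes> (co 0 q a \<ominus> co i q a) = co 0 q a \<ominus> co i q a) \<and>
    (\<forall>p\<le>n. (co p 0 a \<ominus> co p j a) \<otimes> f j = co p 0 a \<ominus> co p j a)"
proof -
  have row: "row_proj i a = a \<longleftrightarrow> (\<forall>q\<le>m. \<forall>p\<le>n. rows.shear i (\<lambda>p'. co p' q a) p = co p q a)"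
  proof
    assume "row_proj i a = a"
    then show "\<forall>q\<le>m. \<forall>p\<le>n. rows.shear i (\<lambda>p'. co p' q a) p = co p q a"
      using co_row_proj[OF i a] by simp
  next
    assume "\<forall>q\<le>m. \<forall>p\<le>n. rows.shear i (\<lambda>p'. co p' q a) p = co p q a"
    then show "row_proj i a = a"
      by (intro co_inj row_proj_closed[OF i a] a) (simp add: co_row_proj[OF i a])
  qed
  have col: "col_proj j a = a \<longleftrightarrow> (\<forall>p\<le>n. \<forall>q\<le>m. cols.shear j (\<lambda>q'. co p q' a) q = co p q a)"
  proof
    assume "col_proj j a = a"
    then show "\<forall>p\<le>n. \<forall>q\<le>m. cols.shear j (\<lambda>q'. co p q' a) q = co p q a"
      using co_col_proj[OF j a] by simp
  next
    assume "\<forall>p\<le>n. \<forall>q\<le>m. cols.shear j (\<lambda>q'. co p q' a) q = co p q a"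
    then show "col_proj j a = a"
      by (intro co_inj col_proj_closed[OF j a] a) (simp add: co_col_proj[OF j a])
  qed
  have row': "(\<forall>p\<le>n. rows.shear i (\<lambda>p'. co p' q a) p = co p q a) \<longleftrightarrow>
      (\<forall>p\<le>n. p \<noteq> 0 \<longrightarrow> p \<noteq> i \<longrightarrow> co p q a = \<zero>) \<and>
      f' i \<otimes> (co 0 q a \<ominus> co i q a) = co 0 q a \<ominus> co i q a" if "q \<le> m" for q
    using rows.shear_fixed_iff[OF i, of "\<lambda>p. co p q a"] that a co_closed by simp
  have col': "(\<forall>q\<le>m. cols.shear j (\<lambda>q'. co p q' a) q = co p q a) \<longleftrightarrow>
      (\<forall>q\<le>m. q \<noteq> 0 \<longrightarrow> q \<noteq> j \<longrightarrow> co p q a = \<zero>) \<and>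
      (co p 0 a \<ominus> co p j a) \<otimes> f j = co p 0 a \<ominus> co p j a" if "p \<le> n" for p
    using cols.shear_fixed_iff[OF j, of "\<lambda>q. co p q a"] that a co_closed by simp
  have "a \<in> component i j \<longleftrightarrow>
    (\<forall>q\<le>m. \<forall>p\<le>n. rows.shear i (\<lambda>p'. co p' q a) p = co p q a) \<and>
    (\<forall>p\<le>n. \<forall>q\<le>m. cols.shear j (\<lambda>q'. co p q' a) q = co p q a)"
    using a row col by (simp add: component_def)
  then show ?thesis
    using row' col' by (simp cong: imp_cong) blast
qed

text \<open>The row condition on a product is inherited from the left factor and the column
  condition from the right one, which matches the semigroup product when all entries of
  \<open>Q\<close> are \<open>e\<close>.\<close>

lemma component_mult:
  assumes "i \<in> {1..n}" "j \<in> {1..m}" "k \<in> {1..n}" "l \<in> {1..m}"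
    and "a \<in> component i j" "a' \<in> component k l"
  shows "a \<otimes>\<^bsub>A\<^esub> a' \<in> component i l"
  using assms by (auto simp: component_def mult_closed row_proj_mult col_proj_mult)

text \<open>
  A homogeneous element is determined by its coordinate in \<open>B\<close>: its other coordinates
  are obtained from that one by multiplication with \<open>1 - f' i\<close> and \<open>1 - f j\<close>.
\<close>

lemma component_zeroI:
  assumes i: "i \<in> {1..n}" and j: "j \<in> {1..m}" and a: "a \<in> component i j" and z: "co 0 0 a = \<zero>"
  shows "a = \<zero>\<^bsub>A\<^esub>"
proof -
  have aA: "a \<in> carrier A" using a by (simp add: component_def)
  note iff = component_iff[OF i j aA, THEN iffD1, OF a]
  have row: "co i q a = \<zero>" if q: "q \<le> m" and "co 0 q a = \<zero>" for q
  proof -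
    have x: "co i q a \<in> carrier B" "co i q a \<in> R i"
      using co_closed[of i q] co_image[of i q] M_subset_R[of i q] i q aA by auto
    have "f' i \<otimes> (co 0 q a \<ominus> co i q a) = co 0 q a \<ominus> co i q a"
      using iff q by blast
    then have "f' i \<otimes> (\<ominus> co i q a) = \<ominus> co i q a"
      using that(2) x by (simp add: a_minus_def)
    then have "\<ominus> co i q a = \<zero>"
      using f'_R[OF i x(2)] f'_closed[OF i] x by (simp add: r_minus)
    then show ?thesis using x by (metis minus_minus minus_zero)
  qed
  have col: "co p j a = \<zero>" if p: "p \<le> n" and "co p 0 a = \<zero>" for p
  proof -
    have x: "co p j a \<in> carrier B" "co p j a \<in> L j"
      using co_closed[of p j] co_image[of p j] M_subset_L[of p j] j p aA by auto
    have "(co p 0 a \<ominus> co p j a) \<otimes> f j = co p 0 a \<ominus> co p j a"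
      using iff p by blast
    then have "(\<ominus> co p j a) \<otimes> f j = \<ominus> co p j a"
      using that(2) x by (simp add: a_minus_def)
    then have "\<ominus> co p j a = \<zero>"
      using L_f[OF j x(2)] f_closed[OF j] x by (simp add: l_minus)
    then show ?thesis using x by (metis minus_minus minus_zero)
  qed
  \<comment> \<open>From \<open>(0, 0)\<close> the zero spreads to \<open>(i, 0)\<close> and
    \<open>(0, j)\<close>, and then along row \<open>i\<close> to \<open>(i, j)\<close>.\<close>
  have four: "co i 0 a = \<zero>" "co 0 j a = \<zero>" "co i j a = \<zero>"
    using row[of 0] col[of 0] col[of i] z i j by auto
  show ?thesis
  proof (rule co_inj)
    fix p q assume "p \<le> n" "q \<le> m"
    then show "co p q a = co p q \<zero>\<^bsub>A\<^esub>"
      using iff four z by (cases "p = 0 \<or> p = i"; cases "q = 0 \<or> q = j") (auto simp: co_zero)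
  qed (use aA in auto)
qed

section \<open>The corner at position (0, 0)\<close>

lemma M_00: "M 0 0 = carrier B"
  using M_0_left[of 0] L_0 by simp

text \<open>The corner element keeps column \<open>0\<close> of a left factor and row
  \<open>0\<close> of a right factor, and a product depends on nothing else.\<close>

lemma mult_corner:
  assumes "a \<in> carrier A" "a' \<in> carrier A"
  shows "a \<otimes>\<^bsub>A\<^esub> single 0 0 \<one> \<otimes>\<^bsub>A\<^esub> a' = a \<otimes>\<^bsub>A\<^esub> a'"
  using assms M_00 by (intro co_inj) (auto simp: single_closed mult_closed co_mult co_single co_closed)

text \<open>The corner of \<open>A\<close> at the idempotent \<open>single 0 0 \<one>\<close> is a
  copy of \<open>B\<close>; through it an ideal of \<open>A\<close> meets the simple ring
  \<open>B\<close>.\<close>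

lemma corner_mult_corner:
  assumes "a \<in> carrier A"
  shows "single 0 0 \<one> \<otimes>\<^bsub>A\<^esub> a \<otimes>\<^bsub>A\<^esub> single 0 0 \<one> = single 0 0 (co 0 0 a)"
  using assms M_00 by (intro co_inj) (auto simp: single_closed mult_closed co_mult co_single co_closed)

lemma ideal_eq_carrier:
  assumes I: "two_sided_ideal I A" and a: "a \<in> I" and nz: "co 0 0 a \<noteq> \<zero>"
  shows "I = carrier A"
proof (rule subgroup_of_products)
  show I_sub: "subgroup I (add_monoid A)"
    using I by (simp add: two_sided_ideal_def)
  have IA: "x \<in> carrier A" if "x \<in> I" for x
    using subgroup.subset[OF I_sub] that by auto
  have I_mult: "x \<otimes>\<^bsub>A\<^esub> y \<in> I" if "x \<in> carrier A" "y \<in> carrier A" "x \<in> I \<or> y \<in> I" for x y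
    using I that by (auto simp: two_sided_ideal_def)
  let ?e = "single 0 0 \<one>"
  \<comment> \<open>The ideal of \<open>B\<close> that \<open>I\<close> cuts out in the corner.
    Multiplying \<open>a\<close> by \<open>?e\<close> on both sides puts \<open>co 0 0 a\<close>
    into it, so it is nonzero.\<close>
  let ?H = "{b \<in> carrier B. single 0 0 b \<in> I}"
  have s: "single 0 0 b \<in> carrier A" if "b \<in> carrier B" for b
    using that M_00 by (intro single_closed) auto
  have s_add: "single 0 0 (b \<oplus> c) = single 0 0 b \<oplus>\<^bsub>A\<^esub> single 0 0 c"
    if "b \<in> carrier B" "c \<in> carrier B" for b c
    using that M_00 by (intro single_add) auto
  have s_mult: "single 0 0 (b \<otimes> c) = single 0 0 b \<otimes>\<^bsub>A\<^esub> single 0 0 c"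
    if "b \<in> carrier B" "c \<in> carrier B" for b c
    using that M_00 by (intro co_inj) (auto simp: co_single co_mult s mult_closed)
  have s_zero: "single 0 0 \<zero> = \<zero>\<^bsub>A\<^esub>"
    using M_00 by (intro co_inj) (auto simp: co_single co_zero s)
  have s_neg: "single 0 0 (\<ominus> b) = \<ominus>\<^bsub>A\<^esub> single 0 0 b" if b: "b \<in> carrier B" for b
  proof (rule A.minus_equality[symmetric])
    show "single 0 0 (\<ominus> b) \<oplus>\<^bsub>A\<^esub> single 0 0 b = \<zero>\<^bsub>A\<^esub>"
      using b s_add[of "\<ominus> b" b] s_zero by (simp add: l_neg)
  qed (use b s in auto)
  have "two_sided_ideal ?H B"
    unfolding two_sided_ideal_def
  proof (intro conjI ballI)
    show "subgroup ?H (add_monoid B)"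
    proof (rule add.subgroupI)
      show "?H \<noteq> {}" using subgroup.one_closed[OF I_sub] s_zero by auto
      show "\<ominus> b \<in> ?H" if "b \<in> ?H" for b
        using that subgroup.m_inv_closed[OF I_sub] by (auto simp: s_neg a_inv_def[of A])
      show "b \<oplus> c \<in> ?H" if "b \<in> ?H" "c \<in> ?H" for b c
        using that subgroup.m_closed[OF I_sub] by (auto simp: s_add)
    qed auto
  qed (auto simp: s_mult s I_mult)
  moreover have "co 0 0 a \<in> ?H"
    using a IA I_mult[of ?e a] I_mult[of "?e \<otimes>\<^bsub>A\<^esub> a" ?e] corner_mult_corner[of a] s
    by (auto simp: co_closed mult_closed)
  ultimately have "?H = carrier B" using simple nz by blast
  then have e: "?e \<in> I" by blast
  fix x y assume "x \<in> carrier A" "y \<in> carrier A"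
  then show "x \<otimes>\<^bsub>A\<^esub> y \<in> I"
    using mult_corner[of x y] I_mult[of x ?e] I_mult[of "x \<otimes>\<^bsub>A\<^esub> ?e" y] e s
    by (simp add: mult_closed)
qed

section \<open>The grading and its graded ideals\<close>

fun degree_proj :: "'g rees \<Rightarrow> 'a \<Rightarrow> 'a" where
  "degree_proj Theta a = \<zero>\<^bsub>A\<^esub>"
| "degree_proj (Triple g i j) a = row_proj i (col_proj j a)"

text \<open>\<open>C\<close> is left abstract so that the explicit components can take the place of
  the fixed-point description once the two are known to agree.\<close>

lemma graded_simple:
  fixes e :: 'g
  assumes "1 \<le> n" and "1 \<le> m"
    and Q: "\<And>i j. \<lbrakk>i \<in> {1..n}; j \<in> {1..m}\<rbrakk> \<Longrightarrow> Q j i = Some e"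
    and C_Theta: "C Theta = {\<zero>\<^bsub>A\<^esub>}"
    and C_Triple: "\<And>i j. \<lbrakk>i \<in> {1..n}; j \<in> {1..m}\<rbrakk> \<Longrightarrow> C (Triple e i j) = component i j"
  shows "graded_simple (rees_matrix_semigroup (singleton_group e) n m Q) A C"
proof -
  let ?S = "rees_matrix_semigroup (singleton_group e) n m Q"
  let ?T = "(\<lambda>(i, j). Triple e i j) ` ({1..n} \<times> {1..m})"
  have S: "carrier ?S = insert Theta ?T"
    by (auto simp: rees_matrix_semigroup_def)
  have mult_S: "s \<otimes>\<^bsub>?S\<^esub> t = rees_mult (singleton_group e) Q s t" for s t
    by (simp add: rees_matrix_semigroup_def)
  have Theta_right: "rees_mult G P s Theta = Theta" for G :: "'g monoid" and P s
    by (cases s) auto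
  have e: "e \<otimes>\<^bsub>singleton_group e\<^esub> e = e"
    by (simp add: singleton_group_def)
  have semigroup: "semigroup_on ?S"
    unfolding semigroup_on_def mult_S S by (auto simp: Theta_right Q e)
  have hom: "abelian_group_hom A A (degree_proj s)" if "s \<in> carrier ?S" for s
  proof (cases s)
    case Theta
    have "degree_proj s = (\<lambda>a. \<zero>\<^bsub>A\<^esub>)" using Theta by (simp add: fun_eq_iff)
    then show ?thesis
      by (auto simp: hom_def A.abelian_group_axioms intro!: abelian_group_homI
            group_hom.intro group_hom_axioms.intro A.a_group)
  next
    case (Triple g i j)
    with that have ij: "i \<in> {1..n}" "j \<in> {1..m}" by (auto simp: S)
    interpret \<rho>: abelian_group_hom A A "row_proj i" by (rule row_proj_hom[OF ij(1)])
    interpret \<sigma>: abelian_group_hom A A "col_proj j" by (rule col_proj_hom[OF ij(2)])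
    have "degree_proj s = (\<lambda>a. row_proj i (col_proj j a))" using Triple by (simp add: fun_eq_iff)
    then show ?thesis
      by (auto simp: hom_def A.abelian_group_axioms intro!: abelian_group_homI
            group_hom.intro group_hom_axioms.intro A.a_group)
  qed
  have closed: "degree_proj s a \<in> carrier A" if "s \<in> carrier ?S" "a \<in> carrier A" for s a
    using abelian_group_hom.hom_closed[OF hom] that .
  have orth: "degree_proj s (degree_proj t a) = (if s = t then degree_proj s a else \<zero>\<^bsub>A\<^esub>)"
    if s: "s \<in> carrier ?S" and t: "t \<in> carrier ?S" and a: "a \<in> carrier A" for s t a
  proof (cases "s = Theta \<or> t = Theta")
    case True
    then show ?thesis
      using abelian_group_hom.hom_zero[OF hom[OF s]] by auto
  next
    case False
    with s t obtain i j k l where st: "s = Triple e i j" "t = Triple e k l"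
      and ij: "i \<in> {1..n}" "j \<in> {1..m}" "k \<in> {1..n}" "l \<in> {1..m}" by (auto simp: S)
    have "degree_proj s (degree_proj t a) = row_proj i (row_proj k (col_proj j (col_proj l a)))"
      using ij a st by (simp add: row_proj_col_proj[symmetric] col_proj_closed)
    also have "\<dots> = (if i = k then row_proj i (if j = l then col_proj j a else \<zero>\<^bsub>A\<^esub>) else \<zero>\<^bsub>A\<^esub>)"
      using ij a by (simp add: row_proj_row_proj col_proj_col_proj col_proj_closed)
    also have "\<dots> = (if s = t then degree_proj s a else \<zero>\<^bsub>A\<^esub>)"
      using st abelian_group_hom.hom_zero[OF row_proj_hom[OF ij(1)]] by auto
    finally show ?thesis .
  qed
  \<comment> \<open>\<open>Theta\<close> contributes \<open>0\<close>; the rest is a double sum in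
    which the column projections are added up first, inside the additive map
    \<open>row_proj i\<close>.\<close>
  have sum: "(\<Oplus>\<^bsub>A\<^esub>s\<in>carrier ?S. degree_proj s a) = a" if a: "a \<in> carrier A" for a
  proof -
    have "(\<Oplus>\<^bsub>A\<^esub>s\<in>carrier ?S. degree_proj s a) = (\<Oplus>\<^bsub>A\<^esub>s\<in>?T. degree_proj s a)"
      unfolding S using closed[OF _ a] by (subst A.finsum_insert) (auto simp: S intro!: A.add.finprod_closed)
    also have "\<dots> = finsum A (\<lambda>(i, j). row_proj i (col_proj j a)) ({1..n} \<times> {1..m})"
      using closed[OF _ a] by (subst A.finsum_reindex) (auto simp: S inj_on_def case_prod_unfold)
    also have "\<dots> = (\<Oplus>\<^bsub>A\<^esub>i\<in>{1..n}. \<Oplus>\<^bsub>A\<^esub>j\<in>{1..m}. row_proj i (col_proj j a))"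
      using a by (intro A.finsum_cartesian_product) (auto intro!: row_proj_closed col_proj_closed)
    also have "\<dots> = (\<Oplus>\<^bsub>A\<^esub>i\<in>{1..n}. row_proj i a)"
    proof (rule A.add.finprod_cong')
      fix i assume i: "i \<in> {1..n}"
      then show "(\<Oplus>\<^bsub>A\<^esub>j\<in>{1..m}. row_proj i (col_proj j a)) = row_proj i a"
        using abelian_group_hom.hom_finsum[OF row_proj_hom[OF i], of "{1..m}" "\<lambda>j. col_proj j a"]
          a col_proj_closed sum_col_proj[OF a] by simp
    qed (use a row_proj_closed in auto)
    also have "\<dots> = a" using sum_row_proj[OF a] .
    finally show ?thesis .
  qed
  have C: "C s = {a \<in> carrier A. degree_proj s a = a}" if s: "s \<in> carrier ?S" for s
  proof (cases "s = Theta")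
    case True
    then show ?thesis by (auto simp: C_Theta)
  next
    case False
    with s obtain i j where st: "s = Triple e i j" and ij: "i \<in> {1..n}" "j \<in> {1..m}"
      by (auto simp: S)
    \<comment> \<open>For commuting idempotent maps, an element fixed by the composite is fixed by
      each of them.\<close>
    have "row_proj i a = a \<and> col_proj j a = a \<longleftrightarrow> row_proj i (col_proj j a) = a"
      if a: "a \<in> carrier A" for a
      using row_proj_row_proj[OF ij(1,1), of "col_proj j a"] col_proj_col_proj[OF ij(2,2), of "row_proj i a"]
        row_proj_col_proj[OF ij a] row_proj_closed[OF ij(1) a] col_proj_closed[OF ij(2) a] by auto
    then show ?thesis
      by (auto simp: st C_Triple[OF ij] component_def)
  qed
  have fin: "finite (carrier ?S)" by (simp add: S)
  \<comment> \<open>Stated for every stable subgroup, since \<open>0\<close> and \<open>A\<close>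
    both have to be recognised as graded ideals.\<close>
  have decomposition: "internal_direct_sum A U (carrier ?S) (\<lambda>s. U \<inter> C s)"
    if "subgroup U (add_monoid A)" "\<And>s u. \<lbrakk>s \<in> carrier ?S; u \<in> U\<rbrakk> \<Longrightarrow> degree_proj s u \<in> U" for U
  proof (rule A.internal_direct_sum_projections[OF fin, where \<pi> = degree_proj])
    have "U \<subseteq> carrier A" using subgroup.subset[OF that(1)] by simp
    then show "\<And>s. s \<in> carrier ?S \<Longrightarrow> U \<inter> C s = {u \<in> U. degree_proj s u = u}"
      "\<And>s t u. \<lbrakk>s \<in> carrier ?S; t \<in> carrier ?S; u \<in> U\<rbrakk> \<Longrightarrow>
        degree_proj s (degree_proj t u) = (if s = t then degree_proj s u else \<zero>\<^bsub>A\<^esub>)"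
      "\<And>u. u \<in> U \<Longrightarrow> (\<Oplus>\<^bsub>A\<^esub>s\<in>carrier ?S. degree_proj s u) = u"
      using C orth sum by auto
  qed (use that hom in auto)
  have carrier_sub: "subgroup (carrier A) (add_monoid A)"
    using A.add.subgroup_self by simp
  have zero_sub: "subgroup {\<zero>\<^bsub>A\<^esub>} (add_monoid A)"
    using A.add.triv_subgroup by simp
  have C_closed: "a \<in> carrier A" if "s \<in> carrier ?S" "a \<in> C s" for s a
    using C that by auto
  have "internal_direct_sum A (carrier A) (carrier ?S) C"
    by (rule A.internal_direct_sum_projections[OF fin carrier_sub, where \<pi> = degree_proj])
      (use hom closed orth sum C in auto)
  moreover have "C s <#>\<^bsub>A\<^esub> C t \<subseteq> C (s \<otimes>\<^bsub>?S\<^esub> t)" if "s \<in> carrier ?S" "t \<in> carrier ?S" for s t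
  proof (cases "s = Theta \<or> t = Theta")
    case True
    have z: "\<zero>\<^bsub>A\<^esub> \<otimes>\<^bsub>A\<^esub> a = \<zero>\<^bsub>A\<^esub>" "a \<otimes>\<^bsub>A\<^esub> \<zero>\<^bsub>A\<^esub> = \<zero>\<^bsub>A\<^esub>" if "a \<in> carrier A" for a
      using that by (auto intro!: co_inj simp: mult_closed co_mult co_zero co_closed)
    show ?thesis
      using True C_closed that by (auto simp: set_mult_def mult_S Theta_right C_Theta z)
  next
    case False
    with that obtain i j k l where st: "s = Triple e i j" "t = Triple e k l"
      and ij: "i \<in> {1..n}" "j \<in> {1..m}" "k \<in> {1..n}" "l \<in> {1..m}" by (auto simp: S)
    then show ?thesis
      by (auto simp: set_mult_def mult_S C_Triple Q e intro: component_mult)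
  qed
  ultimately have graded: "semigroup_graded ?S A C"
    unfolding semigroup_graded_def using semigroup nonunital by blast
  have one: "single 0 0 \<one> \<in> carrier A" "co 0 0 (single 0 0 \<one>) = \<one>"
    using M_00 by (auto simp: single_closed co_single)
  \<comment> \<open>This product has entry \<open>1\<close> at \<open>(0, 0)\<close>, so it
    witnesses that the square of \<open>A\<close> is nonzero.\<close>
  have "single 0 0 \<one> \<otimes>\<^bsub>A\<^esub> single 0 0 \<one> \<in> additive_product A (carrier A) (carrier A)"
    unfolding additive_product_def using one by (intro generate.incl) (auto simp: set_mult_def)
  moreover have "single 0 0 \<one> \<otimes>\<^bsub>A\<^esub> single 0 0 \<one> \<noteq> \<zero>\<^bsub>A\<^esub>"
    using co_mult[of 0 0 "single 0 0 \<one>" "single 0 0 \<one>"] one co_zero[of 0 0] one_neq_zero by auto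
  ultimately have square: "additive_product A (carrier A) (carrier A) \<noteq> {\<zero>\<^bsub>A\<^esub>}"
    by blast
  have "graded_ideal ?S A C {\<zero>\<^bsub>A\<^esub>}"
    unfolding graded_ideal_def two_sided_ideal_def
  proof (intro conjI ballI)
    show "internal_direct_sum A {\<zero>\<^bsub>A\<^esub>} (carrier ?S) (\<lambda>s. {\<zero>\<^bsub>A\<^esub>} \<inter> C s)"
      using abelian_group_hom.hom_zero[OF hom] by (intro decomposition zero_sub) auto
  qed (auto simp: zero_sub intro!: co_inj simp: mult_closed co_mult co_zero co_closed)
  moreover have "graded_ideal ?S A C (carrier A)"
    unfolding graded_ideal_def two_sided_ideal_def
    using carrier_sub decomposition[OF carrier_sub] closed mult_closed by auto
  \<comment> \<open>Either every homogeneous part of \<open>I\<close> vanishes, and with it their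
    sum \<open>I\<close>, or \<open>I\<close> contains a nonzero element of some degree
    \<open>(e, i, j)\<close>, whose entry at \<open>(0, 0)\<close> is nonzero.\<close>
  moreover have "I = {\<zero>\<^bsub>A\<^esub>} \<or> I = carrier A" if I: "graded_ideal ?S A C I" for I
  proof (cases "\<forall>s\<in>carrier ?S. I \<inter> C s \<subseteq> {\<zero>\<^bsub>A\<^esub>}")
    case True
    then have "I \<subseteq> {\<zero>\<^bsub>A\<^esub>}"
      using I internal_direct_sum_of_zero[OF A.abelian_group_axioms]
      unfolding graded_ideal_def by blast
    moreover have "\<zero>\<^bsub>A\<^esub> \<in> I"
      using I subgroup.one_closed[of I "add_monoid A"]
      by (simp add: graded_ideal_def two_sided_ideal_def)
    ultimately show ?thesis by blast
  next
    case False
    then obtain s a where s: "s \<in> carrier ?S" and a: "a \<in> I" "a \<in> C s" "a \<noteq> \<zero>\<^bsub>A\<^esub>"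
      by blast
    then obtain i j where "a \<in> component i j" and ij: "i \<in> {1..n}" "j \<in> {1..m}"
      using C_Theta C_Triple by (auto simp: S)
    then have "co 0 0 a \<noteq> \<zero>"
      using component_zeroI a(3) by blast
    then show ?thesis
      using ideal_eq_carrier[OF _ a(1)] I by (simp add: graded_ideal_def)
  qed
  ultimately have "{I. graded_ideal ?S A C I} = {{\<zero>\<^bsub>A\<^esub>}, carrier A}" by blast
  then show ?thesis
    unfolding graded_simple_def using graded square by blast
qed

section \<open>The four summands of a component\<close>

definition quad :: "nat \<Rightarrow> nat \<Rightarrow> 'b \<Rightarrow> 'b \<Rightarrow> 'b \<Rightarrow> 'b \<Rightarrow> 'a" where
  "quad i j w x y z = mk (\<lambda>p q.
     if p = 0 \<and> q = 0 then w else if p = i \<and> q = 0 then x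
     else if p = 0 \<and> q = j then y else if p = i \<and> q = j then z else \<zero>)"

context
  fixes i j :: nat
  assumes i: "i \<in> {1..n}" and j: "j \<in> {1..m}"
begin

lemma quad:
  assumes "w \<in> carrier B" "x \<in> R i" "y \<in> L j" "z \<in> M i j"
  shows quad_closed: "quad i j w x y z \<in> carrier A"
    and co_quad: "\<lbrakk>p \<le> n; q \<le> m\<rbrakk> \<Longrightarrow> co p q (quad i j w x y z) =
      (if p = 0 \<and> q = 0 then w else if p = i \<and> q = 0 then x
       else if p = 0 \<and> q = j then y else if p = i \<and> q = j then z else \<zero>)"
proof -
  have "(if p = 0 \<and> q = 0 then w else if p = i \<and> q = 0 then x
       else if p = 0 \<and> q = j then y else if p = i \<and> q = j then z else \<zero>) \<in> M p q"
    if "p \<le> n" "q \<le> m" for p q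
    using that assms i j M_00 M_0_left[of j] M_0_right[of i] zero_M by auto
  then show "quad i j w x y z \<in> carrier A" "\<lbrakk>p \<le> n; q \<le> m\<rbrakk> \<Longrightarrow> co p q (quad i j w x y z) =
      (if p = 0 \<and> q = 0 then w else if p = i \<and> q = 0 then x
       else if p = 0 \<and> q = j then y else if p = i \<and> q = j then z else \<zero>)"
    unfolding quad_def by (auto intro: mk_closed simp: co_mk)
qed

lemma M_in_RL: "z \<in> M i j \<Longrightarrow> z \<in> R i" "z \<in> M i j \<Longrightarrow> z \<in> L j"
  using i j M_subset_R[of i j] M_subset_L[of i j] by auto

lemma RLM_carrier: "x \<in> R i \<Longrightarrow> x \<in> carrier B" "y \<in> L j \<Longrightarrow> y \<in> carrier B" "z \<in> M i j \<Longrightarrow> z \<in> carrier B"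
  using i j R_carrier[of i] L_carrier[of j] M_carrier[of i j] by auto

lemma zero_RLM: "\<zero> \<in> R i" "\<zero> \<in> L j" "\<zero> \<in> M i j"
  using i j zero_M[of i j] M_in_RL by auto

text \<open>Four conditions remain, one for each side of the square with rows \<open>0, i\<close>
  and columns \<open>0, j\<close>: the difference along a vertical side absorbs \<open>f' i\<close>,
  the one along a horizontal side absorbs \<open>f j\<close>. Elsewhere the differences are
  zero.\<close>

lemma quad_in_component_iff:
  assumes "w \<in> carrier B" "x \<in> R i" "y \<in> L j" "z \<in> M i j"
  shows "quad i j w x y z \<in> component i j \<longleftrightarrow>
     f' i \<otimes> (w \<ominus> x) = w \<ominus> x \<and> f' i \<otimes> (y \<ominus> z) = y \<ominus> z \<and>
     (w \<ominus> y) \<otimes> f j = w \<ominus> y \<and> (x \<ominus> z) \<otimes> f j = x \<ominus> z"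
proof -
  have zz: "\<zero> \<ominus> \<zero> = \<zero>" by (simp add: a_minus_def)
  \<comment> \<open>Splits off the two indices at which a quad can be nonzero.\<close>
  have all: "(\<forall>p\<le>N. P p) \<longleftrightarrow> P 0 \<and> P k \<and> (\<forall>p\<le>N. p \<noteq> 0 \<longrightarrow> p \<noteq> k \<longrightarrow> P p)"
    if "k \<le> N" for P and k N :: nat
    using that by auto
  have "(\<forall>q\<le>m. f' i \<otimes> (co 0 q (quad i j w x y z) \<ominus> co i q (quad i j w x y z)) =
          co 0 q (quad i j w x y z) \<ominus> co i q (quad i j w x y z)) \<longleftrightarrow>
        f' i \<otimes> (w \<ominus> x) = w \<ominus> x \<and> f' i \<otimes> (y \<ominus> z) = y \<ominus> z"
    using i j f'_closed[OF i] by (subst all[of j]) (auto simp: co_quad[OF assms] zz)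
  moreover have "(\<forall>p\<le>n. (co p 0 (quad i j w x y z) \<ominus> co p j (quad i j w x y z)) \<otimes> f j =
          co p 0 (quad i j w x y z) \<ominus> co p j (quad i j w x y z)) \<longleftrightarrow>
        (w \<ominus> y) \<otimes> f j = w \<ominus> y \<and> (x \<ominus> z) \<otimes> f j = x \<ominus> z"
    using i j f_closed[OF j] by (subst all[of i]) (auto simp: co_quad[OF assms] zz)
  moreover have "\<forall>p\<le>n. \<forall>q\<le>m. (p \<noteq> 0 \<and> p \<noteq> i) \<or> (q \<noteq> 0 \<and> q \<noteq> j) \<longrightarrow> co p q (quad i j w x y z) = \<zero>"
    by (auto simp: co_quad[OF assms])
  ultimately show ?thesis
    unfolding component_iff[OF i j quad_closed[OF assms]] by blast
qed

lemma component_eq_quad: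
  assumes a: "a \<in> component i j"
  shows "a = quad i j (co 0 0 a) (co i 0 a) (co 0 j a) (co i j a)"
proof -
  have aA: "a \<in> carrier A" using a by (simp add: component_def)
  have c: "co 0 0 a \<in> carrier B" "co i 0 a \<in> R i" "co 0 j a \<in> L j" "co i j a \<in> M i j"
    using aA i j co_closed[of 0 0] co_image[of i 0] co_image[of 0 j] co_image[of i j]
      M_0_left[of j] M_0_right[of i] by auto
  have sup: "co p q a = \<zero>" if "p \<le> n" "q \<le> m" "(p \<noteq> 0 \<and> p \<noteq> i) \<or> (q \<noteq> 0 \<and> q \<noteq> j)" for p q
    using component_iff[OF i j aA] a that by blast
  show ?thesis
  proof (rule co_inj)
    fix p q assume pq: "p \<le> n" "q \<le> m"
    show "co p q a = co p q (quad i j (co 0 0 a) (co i 0 a) (co 0 j a) (co i j a))"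
      using sup[OF pq] i j by (auto simp: co_quad[OF c pq])
  qed (use aA quad_closed[OF c] in auto)
qed

text \<open>
  Membership in the second, third and fourth summand forces several coordinates to agree;
  a homogeneous element is split by subtracting these repetitions, starting from the last one.
\<close>

definition part :: "nat \<Rightarrow> 'a \<Rightarrow> 'a" where
  "part s a =
     [quad i j (co 0 0 a \<ominus> co i 0 a \<ominus> (co 0 j a \<ominus> co i j a)) \<zero> \<zero> \<zero>,
      quad i j (co i 0 a \<ominus> co i j a) (co i 0 a \<ominus> co i j a) \<zero> \<zero>,
      quad i j (co 0 j a \<ominus> co i j a) \<zero> (co 0 j a \<ominus> co i j a) \<zero>,
      quad i j (co i j a) (co i j a) (co i j a) (co i j a)] ! s"

text \<open>The four sets of \<open>A_summand\<close> in coordinates. In the last one,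
  \<open>\<phi>(v)\<phi>(w)\<close>, \<open>v\<phi>(w)\<close>, \<open>\<phi>(v)w\<close> and
  \<open>\<mu>(v,w)\<close> all become the same element of \<open>B\<close>, and sums of such tuples
  account for all of \<open>M i j\<close>.\<close>

definition summand :: "nat \<Rightarrow> 'a set" where
  "summand s =
     [{quad i j (f' i \<otimes> b \<otimes> f j) \<zero> \<zero> \<zero> | b. b \<in> carrier B},
      {quad i j (r \<otimes> f j) (r \<otimes> f j) \<zero> \<zero> | r. r \<in> R i},
      {quad i j (f' i \<otimes> l) \<zero> (f' i \<otimes> l) \<zero> | l. l \<in> L j},
      {quad i j x x x x | x. x \<in> M i j}] ! s"

text \<open>\<open>M i j\<close> lies in both \<open>R i\<close> and \<open>L j\<close>, so the
  differences taken in \<open>part\<close> remain in the groups allowed at their positions.\<close>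

lemma co_RLM:
  assumes "a \<in> carrier A"
  shows "co 0 0 a \<in> carrier B" "co i 0 a \<in> R i" "co 0 j a \<in> L j" "co i j a \<in> M i j"
    and "co i 0 a \<ominus> co i j a \<in> R i" "co 0 j a \<ominus> co i j a \<in> L j"
    and "co 0 0 a \<ominus> co i 0 a \<ominus> (co 0 j a \<ominus> co i j a) \<in> carrier B"
proof -
  show 1: "co 0 0 a \<in> carrier B" "co i 0 a \<in> R i" "co 0 j a \<in> L j" "co i j a \<in> M i j"
    using assms i j co_closed[of 0 0] co_image[of i 0] co_image[of 0 j] co_image[of i j]
      M_0_left[of j] M_0_right[of i] by auto
  show 2: "co i 0 a \<ominus> co i j a \<in> R i" "co 0 j a \<ominus> co i j a \<in> L j"
    using 1 i j minus_M[of i 0] minus_M[of 0 j] M_0_left[of j] M_0_right[of i] M_in_RL by auto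
  show "co 0 0 a \<ominus> co i 0 a \<ominus> (co 0 j a \<ominus> co i j a) \<in> carrier B"
    using 1 2 RLM_carrier by auto
qed

lemma part_closed:
  assumes "s \<in> {0, 1, 2, 3}" and "a \<in> carrier A"
  shows "part s a \<in> carrier A"
  using assms co_RLM[OF assms(2)] RLM_carrier M_in_RL zero_RLM
  by (auto simp: part_def intro!: quad_closed)

lemma sub_add_sub:
  assumes "x \<in> carrier B" "y \<in> carrier B" "u \<in> carrier B" "v \<in> carrier B"
  shows "(x \<oplus> u) \<ominus> (y \<oplus> v) = (x \<ominus> y) \<oplus> (u \<ominus> v)"
  using assms by (simp add: a_minus_def minus_add a_ac)

lemma part_hom:
  assumes s: "s \<in> {0, 1, 2, 3}"
  shows "abelian_group_hom A A (part s)"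
proof (rule abelian_group_homI)
  have "part s (a \<oplus>\<^bsub>A\<^esub> a') = part s a \<oplus>\<^bsub>A\<^esub> part s a'" if a: "a \<in> carrier A" "a' \<in> carrier A" for a a'
  proof -
    note cs = co_RLM[OF a(1)] co_RLM[OF a(2)]
    have carr: "co p q b \<in> carrier B" if "p \<in> {0, i}" "q \<in> {0, j}" "b \<in> {a, a'}" for p q b
      using that a i j co_closed by auto
    have add: "co p q (a \<oplus>\<^bsub>A\<^esub> a') = co p q a \<oplus> co p q a'" if "p \<le> n" "q \<le> m" for p q
      using co_add that a .
    have eq: "quad i j w x y z = quad i j w' x' y' z' \<oplus>\<^bsub>A\<^esub> quad i j w'' x'' y'' z''"
      if "w' \<in> carrier B" "x' \<in> R i" "y' \<in> L j" "z' \<in> M i j"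
        "w'' \<in> carrier B" "x'' \<in> R i" "y'' \<in> L j" "z'' \<in> M i j"
        "w = w' \<oplus> w''" "x = x' \<oplus> x''" "y = y' \<oplus> y''" "z = z' \<oplus> z''" for w x y z w' x' y' z' w'' x'' y'' z''
    proof -
      have "w \<in> carrier B" "x \<in> R i" "y \<in> L j" "z \<in> M i j"
        using that i j add_M[of i 0 x' x''] add_M[of 0 j y' y''] add_M[of i j z' z'']
          M_0_left[of j] M_0_right[of i] by auto
      then show ?thesis
        using that i j RLM_carrier
        by (intro co_inj) (auto simp: co_quad quad_closed co_add)
    qed
    show ?thesis
      using s cs carr i j zero_RLM M_in_RL
      by (auto simp: part_def add sub_add_sub intro!: eq)
  qed
  then have "part s \<in> hom (add_monoid A) (add_monoid A)"
    using part_closed[OF s] by (auto simp: hom_def)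
  then show "group_hom (add_monoid A) (add_monoid A) (part s)"
    by (intro group_hom.intro group_hom_axioms.intro A.a_group)
qed (rule A.abelian_group_axioms)+

lemma co_part:
  assumes "s \<in> {0, 1, 2, 3}" and "a \<in> carrier A"
  shows "co i j (part s a) = (if s = 3 then co i j a else \<zero>)"
    and "co i 0 (part s a) = (if s = 3 then co i j a else if s = 1 then co i 0 a \<ominus> co i j a else \<zero>)"
    and "co 0 j (part s a) = (if s = 3 then co i j a else if s = 2 then co 0 j a \<ominus> co i j a else \<zero>)"
    and "co 0 0 (part s a) =
      (if s = 3 then co i j a else if s = 1 then co i 0 a \<ominus> co i j a
       else if s = 2 then co 0 j a \<ominus> co i j a
       else co 0 0 a \<ominus> co i 0 a \<ominus> (co 0 j a \<ominus> co i j a))"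
  using assms co_RLM[OF assms(2)] RLM_carrier M_in_RL zero_RLM i j by (auto simp: part_def co_quad)

lemma a_minus_self: "x \<in> carrier B \<Longrightarrow> x \<ominus> x = \<zero>" and a_minus_zero: "x \<in> carrier B \<Longrightarrow> x \<ominus> \<zero> = x"
  by (simp_all add: a_minus_def r_neg)

text \<open>Each part is constant on its support, which is \<open>(0, 0)\<close> alone, the side in
  column \<open>0\<close>, the side in row \<open>0\<close>, or the whole square. On such a pattern
  the expressions defining the other three parts are zero.\<close>

lemma part_part:
  assumes s: "s \<in> {0, 1, 2, 3}" and t: "t \<in> {0, 1, 2, 3}" and a: "a \<in> carrier A"
  shows "part s (part t a) = (if s = t then part s a else \<zero>\<^bsub>A\<^esub>)"
proof -
  have zero: "quad i j \<zero> \<zero> \<zero> \<zero> = \<zero>\<^bsub>A\<^esub>"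
    using zero_RLM by (intro co_inj) (auto simp: co_quad quad_closed co_zero)
  note carr = co_RLM[OF a] RLM_carrier(1)[OF co_RLM(2)[OF a]] RLM_carrier(2)[OF co_RLM(3)[OF a]]
    RLM_carrier(3)[OF co_RLM(4)[OF a]]
  show ?thesis
    unfolding part_def[of s "part t a"] co_part[OF t a]
    using s t carr by (auto simp: zero a_minus_self a_minus_zero part_def)
qed

text \<open>The parts live on the square with rows \<open>0, i\<close> and columns
  \<open>0, j\<close>; membership in the component supplies this support for
  \<open>a\<close>.\<close>

lemma sum_part:
  assumes a: "a \<in> component i j"
  shows "(\<Oplus>\<^bsub>A\<^esub>s\<in>{0, 1, 2, 3}. part s a) = a"
proof -
  have aA: "a \<in> carrier A" using a by (simp add: component_def)
  have cl: "part s a \<in> carrier A" if "s \<in> {0, 1, 2, 3}" for s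
    using part_closed that aA .
  have "(\<Oplus>\<^bsub>A\<^esub>s\<in>{0, 1, 2, 3}. part s a) = part 0 a \<oplus>\<^bsub>A\<^esub> (part 1 a \<oplus>\<^bsub>A\<^esub> (part 2 a \<oplus>\<^bsub>A\<^esub> part 3 a))"
    using cl by (simp add: A.finsum_insert)
  also have "\<dots> = a"
  proof (rule co_inj)
    fix p q assume pq: "p \<le> n" "q \<le> m"
    note carr = co_RLM[OF aA] RLM_carrier(1)[OF co_RLM(2)[OF aA]] RLM_carrier(2)[OF co_RLM(3)[OF aA]]
      RLM_carrier(3)[OF co_RLM(4)[OF aA]] RLM_carrier(1)[OF co_RLM(5)[OF aA]] RLM_carrier(2)[OF co_RLM(6)[OF aA]]
    have cancel: "(x \<ominus> y) \<oplus> y = x" if "x \<in> carrier B" "y \<in> carrier B" for x y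
      using that by (simp add: a_minus_def a_assoc l_neg)
    \<comment> \<open>At \<open>(0, 0)\<close> the four parts telescope. The last term is
      \<open>y\<close> because \<open>cancel\<close> merges the contributions of parts
      \<open>2\<close> and \<open>3\<close>.\<close>
    have four: "(w \<ominus> x \<ominus> (y \<ominus> z)) \<oplus> ((x \<ominus> z) \<oplus> y) = w"
      if c: "w \<in> carrier B" "x \<in> carrier B" "y \<in> carrier B" "z \<in> carrier B" for w x y z
    proof -
      have "(w \<ominus> x \<ominus> (y \<ominus> z)) \<oplus> ((x \<ominus> z) \<oplus> y) =
            (w \<ominus> x \<ominus> (y \<ominus> z)) \<oplus> ((x \<ominus> z) \<oplus> ((y \<ominus> z) \<oplus> z))"
        using c cancel by simp
      also have "\<dots> = ((w \<ominus> x \<ominus> (y \<ominus> z)) \<oplus> (y \<ominus> z)) \<oplus> ((x \<ominus> z) \<oplus> z)"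
        using c by (simp only: a_ac minus_closed add.m_closed)
      also have "\<dots> = w" using c cancel by simp
      finally show ?thesis .
    qed
    have sup: "co p q a = \<zero>" if "(p \<noteq> 0 \<and> p \<noteq> i) \<or> (q \<noteq> 0 \<and> q \<noteq> j)"
      using component_iff[OF i j aA] a that pq by blast
    have sup': "co p q (part s a) = \<zero>" if "(p \<noteq> 0 \<and> p \<noteq> i) \<or> (q \<noteq> 0 \<and> q \<noteq> j)" "s \<in> {0, 1, 2, 3}" for s
      using that pq carr zero_RLM M_in_RL by (auto simp: part_def co_quad)
    show "co p q (part 0 a \<oplus>\<^bsub>A\<^esub> (part 1 a \<oplus>\<^bsub>A\<^esub> (part 2 a \<oplus>\<^bsub>A\<^esub> part 3 a))) = co p q a"
    proof (cases "(p \<noteq> 0 \<and> p \<noteq> i) \<or> (q \<noteq> 0 \<and> q \<noteq> j)")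
      case True
      then show ?thesis
        using pq cl by (simp add: co_add sup sup')
    next
      case False
      then have "p = 0 \<or> p = i" "q = 0 \<or> q = j" by auto
      then show ?thesis
        using pq cl carr by (auto simp: co_add co_part[OF _ aA] cancel four)
    qed
  qed (use cl aA in auto)
  finally show ?thesis .
qed

text \<open>For the inclusion into \<open>summand s\<close> the element supplies its own witness: by
  \<open>co_part\<close> its entries on the square are zero or equal to one another, and the
  component conditions say that the idempotents occurring in the summand leave this common entry
  unchanged.\<close>

lemma summand_eq:
  assumes s: "s \<in> {0, 1, 2, 3}"
  shows "summand s = {a \<in> component i j. part s a = a}"
proof
  have idem: "f' i \<otimes> (f' i \<otimes> x) = f' i \<otimes> x" "(x \<otimes> f j) \<otimes> f j = x \<otimes> f j" if "x \<in> carrier B" for x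
    using rows.orth[OF i i that] cols.orth[OF j j that] by auto
  have RL: "\<And>r. r \<in> R i \<Longrightarrow> r \<otimes> f j \<in> R i" "\<And>l. l \<in> L j \<Longrightarrow> f' i \<otimes> l \<in> L j"
    using i j R_mult L_mult f_closed f'_closed by auto
  note fc = f_closed[OF j] f'_closed[OF i]
  show "summand s \<subseteq> {a \<in> component i j. part s a = a}"
  proof
    fix a assume "a \<in> summand s"
    then consider
        b where "s = 0" "b \<in> carrier B" "a = quad i j (f' i \<otimes> b \<otimes> f j) \<zero> \<zero> \<zero>"
      | r where "s = 1" "r \<in> R i" "a = quad i j (r \<otimes> f j) (r \<otimes> f j) \<zero> \<zero>"
      | l where "s = 2" "l \<in> L j" "a = quad i j (f' i \<otimes> l) \<zero> (f' i \<otimes> l) \<zero>"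
      | x where "s = 3" "x \<in> M i j" "a = quad i j x x x x"
      using s by (auto simp: summand_def)
    then show "a \<in> {a \<in> component i j. part s a = a}"
    proof cases
      case 1
      then have b: "f' i \<otimes> b \<otimes> f j \<in> carrier B" using fc by simp
      show ?thesis
        using 1 b fc zero_RLM i j idem[of b] idem[of "f' i \<otimes> b"] idem(1)[of "b \<otimes> f j"]
        by (auto simp: quad_in_component_iff part_def co_quad a_minus_zero a_minus_self m_assoc)
    next
      case 2
      then have r: "r \<otimes> f j \<in> R i" "r \<otimes> f j \<in> carrier B" "r \<in> carrier B" using RL RLM_carrier by auto
      show ?thesis
        using 2 r fc zero_RLM i j idem[of r]
        by (auto simp: quad_in_component_iff part_def co_quad a_minus_zero a_minus_self)
    next
      case 3
      then have l: "f' i \<otimes> l \<in> L j" "f' i \<otimes> l \<in> carrier B" "l \<in> carrier B" using RL RLM_carrier by auto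
      show ?thesis
        using 3 l fc zero_RLM i j idem[of l]
        by (auto simp: quad_in_component_iff part_def co_quad a_minus_zero a_minus_self)
    next
      case 4
      then show ?thesis
        using fc zero_RLM i j M_in_RL[of x] RLM_carrier(3)[of x]
        by (auto simp: quad_in_component_iff part_def co_quad a_minus_zero a_minus_self)
    qed
  qed
  show "{a \<in> component i j. part s a = a} \<subseteq> summand s"
  proof
    fix a assume "a \<in> {a \<in> component i j. part s a = a}"
    then have a: "a \<in> component i j" and fix_a: "part s a = a" by auto
    have aA: "a \<in> carrier A" using a by (simp add: component_def)
    note carr = co_RLM[OF aA] RLM_carrier(1)[OF co_RLM(2)[OF aA]] RLM_carrier(2)[OF co_RLM(3)[OF aA]]
      RLM_carrier(3)[OF co_RLM(4)[OF aA]] RLM_carrier(1)[OF co_RLM(5)[OF aA]] RLM_carrier(2)[OF co_RLM(6)[OF aA]]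
    have comp: "f' i \<otimes> (co 0 0 a \<ominus> co i 0 a) = co 0 0 a \<ominus> co i 0 a"
      "f' i \<otimes> (co 0 j a \<ominus> co i j a) = co 0 j a \<ominus> co i j a"
      "(co 0 0 a \<ominus> co 0 j a) \<otimes> f j = co 0 0 a \<ominus> co 0 j a"
      "(co i 0 a \<ominus> co i j a) \<otimes> f j = co i 0 a \<ominus> co i j a"
      using component_iff[OF i j aA] a i j by auto
    consider "s = 0" | "s = 1" | "s = 2" | "s = 3" using s by auto
    then show "a \<in> summand s"
    proof cases
      case 1
      have z: "co i 0 a = \<zero>" "co 0 j a = \<zero>" "co i j a = \<zero>"
        using co_part[OF s aA] 1 unfolding fix_a by auto
      have eq: "f' i \<otimes> co 0 0 a \<otimes> f j = co 0 0 a"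
        using comp(1,3) carr by (simp add: z a_minus_zero)
      have "quad i j (f' i \<otimes> co 0 0 a \<otimes> f j) \<zero> \<zero> \<zero> \<in> summand s"
        using carr 1 by (auto simp: summand_def)
      moreover have "quad i j (f' i \<otimes> co 0 0 a \<otimes> f j) \<zero> \<zero> \<zero> = a"
        using component_eq_quad[OF a] unfolding eq z by (rule sym)
      ultimately show ?thesis by simp
    next
      case 2
      have z: "co 0 0 a = co i 0 a" "co 0 j a = \<zero>" "co i j a = \<zero>"
        using co_part[OF s aA] 2 unfolding fix_a by auto
      have eq: "co i 0 a \<otimes> f j = co i 0 a"
        using comp(4) carr by (simp add: z a_minus_zero)
      have "quad i j (co i 0 a \<otimes> f j) (co i 0 a \<otimes> f j) \<zero> \<zero> \<in> summand s"
        using carr 2 by (auto simp: summand_def)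
      moreover have "quad i j (co i 0 a \<otimes> f j) (co i 0 a \<otimes> f j) \<zero> \<zero> = a"
        using component_eq_quad[OF a] unfolding eq z by (rule sym)
      ultimately show ?thesis by simp
    next
      case 3
      have z: "co 0 0 a = co 0 j a" "co i 0 a = \<zero>" "co i j a = \<zero>"
        using co_part[OF s aA] 3 unfolding fix_a by auto
      have eq: "f' i \<otimes> co 0 j a = co 0 j a"
        using comp(2) carr by (simp add: z a_minus_zero)
      have "quad i j (f' i \<otimes> co 0 j a) \<zero> (f' i \<otimes> co 0 j a) \<zero> \<in> summand s"
        using carr 3 by (auto simp: summand_def)
      moreover have "quad i j (f' i \<otimes> co 0 j a) \<zero> (f' i \<otimes> co 0 j a) \<zero> = a"
        using component_eq_quad[OF a] unfolding eq z by (rule sym)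
      ultimately show ?thesis by simp
    next
      case 4
      have z: "co 0 0 a = co i j a" "co i 0 a = co i j a" "co 0 j a = co i j a"
        using co_part[OF s aA] 4 unfolding fix_a by auto
      have "quad i j (co i j a) (co i j a) (co i j a) (co i j a) \<in> summand s"
        using carr 4 by (auto simp: summand_def)
      moreover have "quad i j (co i j a) (co i j a) (co i j a) (co i j a) = a"
        using component_eq_quad[OF a] unfolding z by (rule sym)
      ultimately show ?thesis by simp
    qed
  qed
qed

lemma component_subgroup: "subgroup (component i j) (add_monoid A)"
proof -
  interpret \<rho>: abelian_group_hom A A "row_proj i" by (rule row_proj_hom[OF i])
  interpret \<sigma>: abelian_group_hom A A "col_proj j" by (rule col_proj_hom[OF j])
  show ?thesis
  proof (rule A.add.subgroupI)
    have "\<zero>\<^bsub>A\<^esub> \<in> component i j"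
      using \<rho>.hom_zero \<sigma>.hom_zero by (simp add: component_def)
    then show "component i j \<noteq> {}" by blast
    show "\<And>a. a \<in> component i j \<Longrightarrow> \<ominus>\<^bsub>A\<^esub> a \<in> component i j"
      by (auto simp: component_def \<rho>.hom_a_inv \<sigma>.hom_a_inv)
  qed (auto simp: component_def)
qed

lemma part_in_component:
  assumes s: "s \<in> {0, 1, 2, 3}" and a: "a \<in> component i j"
  shows "part s a \<in> component i j"
proof -
  have aA: "a \<in> carrier A" using a by (simp add: component_def)
  note carr = co_RLM[OF aA] RLM_carrier(1)[OF co_RLM(2)[OF aA]] RLM_carrier(2)[OF co_RLM(3)[OF aA]]
    RLM_carrier(3)[OF co_RLM(4)[OF aA]] RLM_carrier(1)[OF co_RLM(5)[OF aA]] RLM_carrier(2)[OF co_RLM(6)[OF aA]]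
  have comp: "f' i \<otimes> (co 0 0 a \<ominus> co i 0 a) = co 0 0 a \<ominus> co i 0 a"
    "f' i \<otimes> (co 0 j a \<ominus> co i j a) = co 0 j a \<ominus> co i j a"
    "(co 0 0 a \<ominus> co 0 j a) \<otimes> f j = co 0 0 a \<ominus> co 0 j a"
    "(co i 0 a \<ominus> co i j a) \<otimes> f j = co i 0 a \<ominus> co i j a"
    using component_iff[OF i j aA] a i j by auto
  note fc = f_closed[OF j] f'_closed[OF i]
  let ?t = "co 0 0 a \<ominus> co i 0 a \<ominus> (co 0 j a \<ominus> co i j a)"
  \<comment> \<open>The double difference is grouped in two ways: \<open>?t\<close> itself is a
    difference of elements fixed by \<open>f' i\<close> from the left, while here it is a difference
    of elements fixed by \<open>f j\<close> from the right.\<close>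
  have t': "?t = (co 0 0 a \<ominus> co 0 j a) \<ominus> (co i 0 a \<ominus> co i j a)"
    using carr by (simp add: a_minus_def minus_add a_ac)
  have "f' i \<otimes> ?t = ?t"
    using abelian_group_hom.hom_a_minus[OF rows.hom[OF i], of "co 0 0 a \<ominus> co i 0 a" "co 0 j a \<ominus> co i j a"] comp carr
    by simp
  moreover have "?t \<otimes> f j = ?t"
    using abelian_group_hom.hom_a_minus[OF cols.hom[OF j], of "co 0 0 a \<ominus> co 0 j a" "co i 0 a \<ominus> co i j a"] comp carr
    unfolding t' by simp
  ultimately show ?thesis
    using s carr fc comp zero_RLM M_in_RL[OF carr(4)]
    by (auto simp: part_def quad_in_component_iff a_minus_zero a_minus_self)
qed

lemma component_direct_sum:
  assumes "\<And>s. s \<in> {0, 1, 2, 3} \<Longrightarrow> C s = summand s"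
  shows "internal_direct_sum A (component i j) {0, 1, 2, 3} C"
proof (rule A.internal_direct_sum_projections[OF _ component_subgroup, where \<pi> = part])
  show "abelian_group_hom A A (part s)" if "s \<in> {0, 1, 2, 3}" for s
    using part_hom that .
qed (use assms part_in_component part_part sum_part summand_eq in \<open>auto simp: component_def\<close>)

text \<open>\<open>A_component\<close> is written as a sum of sets, so the decomposition is also
  required in this form.\<close>

lemma component_eq_set_add:
  "component i j = summand 0 <+>\<^bsub>A\<^esub> summand 1 <+>\<^bsub>A\<^esub> summand 2 <+>\<^bsub>A\<^esub> summand 3"
proof
  have sub: "summand s \<subseteq> component i j" if "s \<in> {0, 1, 2, 3}" for s
    using summand_eq[OF that] by blast
  have add: "a \<oplus>\<^bsub>A\<^esub> a' \<in> component i j" if "a \<in> component i j" "a' \<in> component i j" for a a'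
    using subgroup.m_closed[OF component_subgroup] that by simp
  show "summand 0 <+>\<^bsub>A\<^esub> summand 1 <+>\<^bsub>A\<^esub> summand 2 <+>\<^bsub>A\<^esub> summand 3 \<subseteq> component i j"
    using sub[of 0] sub[of 1] sub[of 2] sub[of 3] by (auto simp: set_add_def' intro!: add)
  show "component i j \<subseteq> summand 0 <+>\<^bsub>A\<^esub> summand 1 <+>\<^bsub>A\<^esub> summand 2 <+>\<^bsub>A\<^esub> summand 3"
  proof
    fix a assume a: "a \<in> component i j"
    have aA: "a \<in> carrier A" using a by (simp add: component_def)
    have cl: "part s a \<in> carrier A" if "s \<in> {0, 1, 2, 3}" for s
      using part_closed that aA .
    have mem: "part s a \<in> summand s" if "s \<in> {0, 1, 2, 3}" for s
      using part_in_component[OF that a] part_part[OF that that aA] summand_eq[OF that] by simp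
    have set_add: "x \<oplus>\<^bsub>A\<^esub> y \<in> U <+>\<^bsub>A\<^esub> V" if "x \<in> U" "y \<in> V" for x y U V
      using that by (auto simp: set_add_def')
    have "part 0 a \<oplus>\<^bsub>A\<^esub> part 1 a \<oplus>\<^bsub>A\<^esub> part 2 a \<oplus>\<^bsub>A\<^esub> part 3 a = a"
      using sum_part[OF a] cl by (simp add: A.finsum_insert A.a_assoc)
    moreover have "part 0 a \<oplus>\<^bsub>A\<^esub> part 1 a \<oplus>\<^bsub>A\<^esub> part 2 a \<oplus>\<^bsub>A\<^esub> part 3 a \<in>
        summand 0 <+>\<^bsub>A\<^esub> summand 1 <+>\<^bsub>A\<^esub> summand 2 <+>\<^bsub>A\<^esub> summand 3"
      by (intro set_add mem) auto
    ultimately show "a \<in> summand 0 <+>\<^bsub>A\<^esub> summand 1 <+>\<^bsub>A\<^esub> summand 2 <+>\<^bsub>A\<^esub> summand 3"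
      by simp
  qed
qed

end

end

section \<open>The ring of the theorem\<close>

text \<open>A family in a finite direct sum arises from the zero family by inserting its entries one
  at a time. This is the way to reach all arguments of \<open>\<mu>\<close>, which is prescribed
  only on embedded elements.\<close>

lemma sum_group_embed_induct:
  assumes "finite I" and G: "\<And>i. i \<in> I \<Longrightarrow> group (G i)" and v: "v \<in> carrier (sum_group I G)"
    and one: "P \<one>\<^bsub>sum_group I G\<^esub>"
    and embed: "\<And>i x v. \<lbrakk>i \<in> I; x \<in> carrier (G i); v \<in> carrier (sum_group I G); P v\<rbrakk>
          \<Longrightarrow> P (sum_embed I G i x \<otimes>\<^bsub>sum_group I G\<^esub> v)"
  shows "P v"
proof -
  have carr: "carrier (sum_group I G) = (\<Pi>\<^sub>E i\<in>I. carrier (G i))"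
    using \<open>finite I\<close> G by (simp add: carrier_sum_group)
  \<comment> \<open>\<open>?v T\<close> keeps the entries indexed by \<open>T\<close>; the induction
    over \<open>T\<close> ends with \<open>?v I = v\<close>.\<close>
  let ?v = "\<lambda>T. \<lambda>i\<in>I. if i \<in> T then v i else \<one>\<^bsub>G i\<^esub>"
  have mem: "?v T \<in> carrier (sum_group I G)" for T
    using v G unfolding carr by (auto simp: group.is_monoid PiE_mem)
  have all: "P (?v T)" if "T \<subseteq> I" for T
    using finite_subset[OF that \<open>finite I\<close>] that
  proof (induction T rule: finite_induct)
    case empty
    then show ?case using one by (simp add: restrict_def)
  next
    case (insert t T)
    have vt: "v k \<in> carrier (G k)" if "k \<in> I" for k
      using v that unfolding carr by auto
    have eq: "?v (insert t T) = sum_embed I G t (v t) \<otimes>\<^bsub>sum_group I G\<^esub> ?v T"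
    proof
      fix k
      show "?v (insert t T) k = (sum_embed I G t (v t) \<otimes>\<^bsub>sum_group I G\<^esub> ?v T) k"
        using insert.hyps vt G[THEN group.is_monoid]
        by (auto simp: sum_embed_def monoid.l_one monoid.r_one)
    qed
    show ?case
      unfolding eq by (rule embed[OF _ _ mem insert.IH]) (use insert.prems vt in auto)
  qed
  have "P (?v I)" using all[OF subset_refl] .
  moreover have "?v I = v"
    using PiE_restrict[OF v[unfolded carr]] by (simp cong: restrict_cong)
  ultimately show ?thesis by simp
qed

lemma sum_group_comm_group:
  assumes "\<And>i. i \<in> I \<Longrightarrow> comm_group (G i)"
  shows "comm_group (sum_group I G)"
proof (rule group.group_comm_groupI)
  have G: "group (G i)" if "i \<in> I" for i
    using assms[OF that] by (simp add: comm_group_def)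
  then show "group (sum_group I G)" by simp
  fix x y assume "x \<in> carrier (sum_group I G)" "y \<in> carrier (sum_group I G)"
  then have "x i \<otimes>\<^bsub>G i\<^esub> y i = y i \<otimes>\<^bsub>G i\<^esub> x i" if "i \<in> I" for i
    using that assms[OF that] G
    by (auto simp: carrier_sum_group comm_group_def intro!: comm_monoid.m_comm)
  then show "x \<otimes>\<^bsub>sum_group I G\<^esub> y = y \<otimes>\<^bsub>sum_group I G\<^esub> x"
    by (auto simp: fun_eq_iff)
qed

lemma DirProd_comm_group:
  assumes "comm_group G" and "comm_group H"
  shows "comm_group (G \<times>\<times> H)"
proof (rule group.group_comm_groupI)
  show "group (G \<times>\<times> H)"
    using assms by (intro DirProd_group) (auto simp: comm_group_def)
  show "x \<otimes>\<^bsub>G \<times>\<times> H\<^esub> y = y \<otimes>\<^bsub>G \<times>\<times> H\<^esub> x"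
    if "x \<in> carrier (G \<times>\<times> H)" "y \<in> carrier (G \<times>\<times> H)" for x y
    using that assms by (auto simp: DirProd_def comm_group_def intro: comm_monoid.m_comm)
qed

lemma biadditive_add_left:
  "\<lbrakk>biadditive G H K \<mu>; v \<in> carrier G; v' \<in> carrier G; w \<in> carrier H\<rbrakk>
    \<Longrightarrow> \<mu> (v \<otimes>\<^bsub>G\<^esub> v') w = \<mu> v w \<otimes>\<^bsub>K\<^esub> \<mu> v' w"
  by (auto simp: biadditive_def hom_def)

lemma biadditive_add_right:
  "\<lbrakk>biadditive G H K \<mu>; v \<in> carrier G; w \<in> carrier H; w' \<in> carrier H\<rbrakk>
    \<Longrightarrow> \<mu> v (w \<otimes>\<^bsub>H\<^esub> w') = \<mu> v w \<otimes>\<^bsub>K\<^esub> \<mu> v w'"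
  by (auto simp: biadditive_def hom_def)

lemma biadditive_closed:
  "\<lbrakk>biadditive G H K \<mu>; v \<in> carrier G; w \<in> carrier H\<rbrakk> \<Longrightarrow> \<mu> v w \<in> carrier K"
  by (auto simp: biadditive_def hom_def)

lemma biadditive_one:
  assumes "biadditive G H K \<mu>" and "group G" "group H" "group K"
  shows "w \<in> carrier H \<Longrightarrow> \<mu> \<one>\<^bsub>G\<^esub> w = \<one>\<^bsub>K\<^esub>" and "v \<in> carrier G \<Longrightarrow> \<mu> v \<one>\<^bsub>H\<^esub> = \<one>\<^bsub>K\<^esub>"
  using assms hom_one[of "\<lambda>v. \<mu> v w" G K] hom_one[of "\<mu> v" H K] by (auto simp: biadditive_def)

text \<open>The matrix ring is represented by its consequences \<open>nontrivial\<close> and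
  \<open>simple_ring\<close>, so the type of the division ring and the size \<open>k\<close>
  disappear from the context.\<close>

locale module_extension = B?: ring B
  for B :: "'b ring" (structure) +
  fixes n m :: nat and f f' :: "nat \<Rightarrow> 'b"
    and J10 :: "nat \<Rightarrow> ('b, 'w) module" and J01 :: "nat \<Rightarrow> ('b, 'v) module"
    and \<phi>10 :: "nat \<Rightarrow> 'w \<Rightarrow> 'b" and \<phi>01 :: "nat \<Rightarrow> 'v \<Rightarrow> 'b"
    and J :: "nat \<Rightarrow> nat \<Rightarrow> 'u monoid" and \<Theta> :: "nat \<Rightarrow> nat \<Rightarrow> 'b \<Rightarrow> 'u"
    and \<mu> :: "(nat \<Rightarrow> 'v) \<Rightarrow> (nat \<Rightarrow> 'w) \<Rightarrow> (nat \<times> nat \<Rightarrow> 'u)"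
  assumes nontrivial: "\<one> \<noteq> \<zero>"
    and simple_ring: "two_sided_ideal H B \<Longrightarrow> H = {\<zero>} \<or> H = carrier B"
    and f: "\<forall>j\<in>{1..m}. f j \<in> carrier B \<and> f j \<otimes> f j = f j"
    and f_orthogonal: "\<forall>i\<in>{1..m}. \<forall>j\<in>{1..m}. i \<noteq> j \<longrightarrow> f i \<otimes> f j = \<zero>"
    and f': "\<forall>i\<in>{1..n}. f' i \<in> carrier B \<and> f' i \<otimes> f' i = f' i"
    and f'_orthogonal: "\<forall>i\<in>{1..n}. \<forall>j\<in>{1..n}. i \<noteq> j \<longrightarrow> f' i \<otimes> f' j = \<zero>"
    and f'_total: "(\<Oplus>i\<in>{1..n}. f' i) = \<one>"
    and f_total: "(\<Oplus>j\<in>{1..m}. f j) = \<one>"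
    and J10_module: "\<forall>j\<in>{1..m}. left_module B (J10 j)"
    and J01_module: "\<forall>i\<in>{1..n}. right_module B (J01 i)"
    and \<phi>10: "\<forall>j\<in>{1..m}. \<phi>10 j \<in> left_module_hom B (J10 j) \<and> inj_on (\<phi>10 j) (carrier (J10 j))"
    and \<phi>01: "\<forall>i\<in>{1..n}. \<phi>01 i \<in> right_module_hom B (J01 i) \<and> inj_on (\<phi>01 i) (carrier (J01 i))"
    and \<phi>10_f: "\<forall>j\<in>{1..m}. \<forall>w\<in>carrier (J10 j). \<phi>10 j w \<otimes> f j = \<zero>"
    and f'_\<phi>01: "\<forall>i\<in>{1..n}. \<forall>v\<in>carrier (J01 i). f' i \<otimes> \<phi>01 i v = \<zero>"
    and J_group: "\<forall>i\<in>{1..n}. \<forall>j\<in>{1..m}. comm_group (J i j)"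
    and \<Theta>: "\<forall>i\<in>{1..n}. \<forall>j\<in>{1..m}.
           \<Theta> i j \<in> iso ((add_monoid B)\<lparr>carrier :=
                          additive_product B (\<phi>01 i ` carrier (J01 i)) (\<phi>10 j ` carrier (J10 j))\<rparr>)
                        (J i j)"
    and \<mu>: "biadditive (J01_sum n J01) (J10_sum m J10) (J_sum n m J) \<mu>"
    and \<mu>_embed: "\<forall>i\<in>{1..n}. \<forall>j\<in>{1..m}. \<forall>v\<in>carrier (J01 i). \<forall>w\<in>carrier (J10 j).
           \<mu> (J01_embed n J01 i v) (J10_embed m J10 j w) =
             J_embed n m J i j (\<Theta> i j (\<phi>01 i v \<otimes> \<phi>10 j w))"
begin

section \<open>The modules as one-sided ideals of B\<close>

definition R :: "nat \<Rightarrow> 'b set" where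
  "R p = (if p = 0 then carrier B else \<phi>01 p ` carrier (J01 p))"

definition L :: "nat \<Rightarrow> 'b set" where
  "L q = (if q = 0 then carrier B else \<phi>10 q ` carrier (J10 q))"

lemma J01_group: "i \<in> {1..n} \<Longrightarrow> abelian_group (J01 i)"
  using J01_module by (auto simp: right_module_def)

lemma J10_group: "j \<in> {1..m} \<Longrightarrow> abelian_group (J10 j)"
  using J10_module by (auto simp: left_module_def)

lemma \<phi>01_hom:
  assumes i: "i \<in> {1..n}"
  shows "abelian_group_hom (J01 i) B (\<phi>01 i)"
proof -
  have "\<phi>01 i \<in> hom (add_monoid (J01 i)) (add_monoid B)"
    using \<phi>01 i unfolding right_module_hom_def by blast
  then show ?thesis
    by (intro abelian_group_homI group_hom.intro group_hom_axioms.intro J01_group[OF i]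
          abelian_group.a_group[OF J01_group[OF i]] a_group abelian_group_axioms)
qed

lemma \<phi>10_hom:
  assumes i: "i \<in> {1..m}"
  shows "abelian_group_hom (J10 i) B (\<phi>10 i)"
proof -
  have "\<phi>10 i \<in> hom (add_monoid (J10 i)) (add_monoid B)"
    using \<phi>10 i unfolding left_module_hom_def by blast
  then show ?thesis
    by (intro abelian_group_homI group_hom.intro group_hom_axioms.intro J10_group[OF i]
          abelian_group.a_group[OF J10_group[OF i]] a_group abelian_group_axioms)
qed

lemma \<phi>01_smult: "\<lbrakk>i \<in> {1..n}; b \<in> carrier B; v \<in> carrier (J01 i)\<rbrakk>
    \<Longrightarrow> b \<odot>\<^bsub>J01 i\<^esub> v \<in> carrier (J01 i) \<and> \<phi>01 i (b \<odot>\<^bsub>J01 i\<^esub> v) = \<phi>01 i v \<otimes> b"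
  using \<phi>01 J01_module by (auto simp: right_module_hom_def intro: right_module.smult_closed)

lemma \<phi>10_smult: "\<lbrakk>j \<in> {1..m}; b \<in> carrier B; w \<in> carrier (J10 j)\<rbrakk>
    \<Longrightarrow> b \<odot>\<^bsub>J10 j\<^esub> w \<in> carrier (J10 j) \<and> \<phi>10 j (b \<odot>\<^bsub>J10 j\<^esub> w) = b \<otimes> \<phi>10 j w"
  using \<phi>10 J10_module by (auto simp: left_module_hom_def intro: left_module.smult_closed)

lemma image_subgroup:
  assumes "abelian_group_hom G B h"
  shows "subgroup (h ` carrier G) (add_monoid B)"
  using group_hom.img_is_subgroup[OF abelian_group_hom.a_group_hom[OF assms]] by simp

text \<open>Linearity of the maps \<open>\<phi>01 p\<close> and \<open>\<phi>10 q\<close> makes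
  their images right and left ideals; the annihilation conditions are those of the theorem read on
  these images.\<close>

sublocale sandwich_data B n m R L f' f
proof (intro sandwich_data.intro sandwich_data_axioms.intro ring_axioms)
  show "R 0 = carrier B" "L 0 = carrier B" by (simp_all add: R_def L_def)
  show "subgroup (R p) (add_monoid B)" if "p \<le> n" for p
    using that image_subgroup[OF \<phi>01_hom[of p]] add.subgroup_self by (cases "p = 0") (auto simp: R_def)
  show "subgroup (L q) (add_monoid B)" if "q \<le> m" for q
    using that image_subgroup[OF \<phi>10_hom[of q]] add.subgroup_self by (cases "q = 0") (auto simp: L_def)
  show "r \<otimes> b \<in> R p" if "p \<le> n" "r \<in> R p" "b \<in> carrier B" for p r b
  proof (cases "p = 0")
    case False
    with that obtain v where "v \<in> carrier (J01 p)" "r = \<phi>01 p v" by (auto simp: R_def)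
    then have "b \<odot>\<^bsub>J01 p\<^esub> v \<in> carrier (J01 p)" "r \<otimes> b = \<phi>01 p (b \<odot>\<^bsub>J01 p\<^esub> v)"
      using \<phi>01_smult[of p b v] False that by auto
    then show ?thesis using False by (auto simp: R_def)
  qed (use that in \<open>auto simp: R_def\<close>)
  show "b \<otimes> l \<in> L q" if "q \<le> m" "l \<in> L q" "b \<in> carrier B" for q l b
  proof (cases "q = 0")
    case False
    with that obtain w where "w \<in> carrier (J10 q)" "l = \<phi>10 q w" by (auto simp: L_def)
    then have "b \<odot>\<^bsub>J10 q\<^esub> w \<in> carrier (J10 q)" "b \<otimes> l = \<phi>10 q (b \<odot>\<^bsub>J10 q\<^esub> w)"
      using \<phi>10_smult[of q b w] False that by auto
    then show ?thesis using False by (auto simp: L_def)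
  qed (use that in \<open>auto simp: L_def\<close>)
  show "f' i \<otimes> r = \<zero>" if "i \<in> {1..n}" "r \<in> R i" for i r
    using that f'_\<phi>01 by (auto simp: R_def)
  show "l \<otimes> f j = \<zero>" if "j \<in> {1..m}" "l \<in> L j" for j l
    using that \<phi>10_f by (auto simp: L_def)
qed (use f f_orthogonal f' f'_orthogonal f'_total f_total nontrivial simple_ring in auto)

section \<open>Addition and multiplication of tuples\<close>

abbreviation A :: "('b, 'v, 'w, 'u) elt ring" where
  "A \<equiv> A_ring B n m J01 J10 J \<mu>"

lemma carrier_J01_sum: "carrier (J01_sum n J01) = (\<Pi>\<^sub>E i\<in>{1..n}. carrier (J01 i))"
  unfolding J01_sum_def
  by (subst carrier_sum_group) (use abelian_group.a_group[OF J01_group] in auto)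

lemma carrier_J10_sum: "carrier (J10_sum m J10) = (\<Pi>\<^sub>E j\<in>{1..m}. carrier (J10 j))"
  unfolding J10_sum_def
  by (subst carrier_sum_group) (use abelian_group.a_group[OF J10_group] in auto)

lemma J_comm_group: "x \<in> {1..n} \<times> {1..m} \<Longrightarrow> comm_group (case x of (i, j) \<Rightarrow> J i j)"
  using J_group by auto

lemma carrier_J_sum: "carrier (J_sum n m J) = (\<Pi>\<^sub>E x\<in>{1..n} \<times> {1..m}. carrier (case x of (i, j) \<Rightarrow> J i j))"
  unfolding J_sum_def
  by (subst carrier_sum_group) (use J_comm_group in \<open>auto simp: comm_group_def\<close>)

lemma sums_comm_group:
  "comm_group (J01_sum n J01)" "comm_group (J10_sum m J10)" "comm_group (J_sum n m J)"
  unfolding J01_sum_def J10_sum_def J_sum_def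
  using abelian_group.a_comm_group[OF J01_group] abelian_group.a_comm_group[OF J10_group] J_comm_group
  by (auto intro!: sum_group_comm_group)

lemma add_monoid_A: "add_monoid A = A_group B n m J01 J10 J"
  by (simp add: A_ring_def)

lemma abelian_group_A: "abelian_group A"
proof -
  have "comm_group (add_monoid A)"
    unfolding add_monoid_A A_group_def
    by (intro DirProd_comm_group sums_comm_group a_comm_group)
  then show ?thesis
    by (simp add: abelian_group_def abelian_group_axioms_def abelian_monoid_def comm_group_def)
qed

lemma carrier_A: "carrier A = carrier B \<times> carrier (J01_sum n J01) \<times> carrier (J10_sum m J10) \<times> carrier (J_sum n m J)"
  by (simp add: A_ring_def A_group_def DirProd_def)

lemma add_A: "(b, v, w, u) \<oplus>\<^bsub>A\<^esub> (b', v', w', u') =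
   (b \<oplus> b', v \<otimes>\<^bsub>J01_sum n J01\<^esub> v', w \<otimes>\<^bsub>J10_sum m J10\<^esub> w', u \<otimes>\<^bsub>J_sum n m J\<^esub> u')"
  by (simp add: A_ring_def A_group_def DirProd_def)

lemma mult_A: "(b, v, w, u) \<otimes>\<^bsub>A\<^esub> (b', v', w', u') =
   (b \<otimes> b', \<lambda>i\<in>{1..n}. b' \<odot>\<^bsub>J01 i\<^esub> v i, \<lambda>j\<in>{1..m}. b \<odot>\<^bsub>J10 j\<^esub> w' j, \<mu> v w')"
  by (simp add: A_ring_def)

lemma M_eq: "\<lbrakk>i \<in> {1..n}; j \<in> {1..m}\<rbrakk>
    \<Longrightarrow> M i j = additive_product B (\<phi>01 i ` carrier (J01 i)) (\<phi>10 j ` carrier (J10 j))"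
  by (simp add: R_def L_def)

lemma M_monoid_group:
  assumes "i \<in> {1..n}" "j \<in> {1..m}"
  shows "group ((add_monoid B)\<lparr>carrier := M i j\<rparr>)"
  using add.subgroup_imp_group[OF M_subgroup] assms by simp

lemma \<Theta>_iso:
  assumes "i \<in> {1..n}" "j \<in> {1..m}"
  shows "\<Theta> i j \<in> iso ((add_monoid B)\<lparr>carrier := M i j\<rparr>) (J i j)"
  unfolding M_eq[OF assms] using \<Theta> assms by blast

lemma \<Theta>_bij: "\<lbrakk>i \<in> {1..n}; j \<in> {1..m}\<rbrakk> \<Longrightarrow> bij_betw (\<Theta> i j) (M i j) (carrier (J i j))"
  using \<Theta>_iso[of i j] by (simp add: iso_def)

lemma \<Theta>_closed: "\<lbrakk>i \<in> {1..n}; j \<in> {1..m}; x \<in> M i j\<rbrakk> \<Longrightarrow> \<Theta> i j x \<in> carrier (J i j)"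
  using \<Theta>_bij by (meson bij_betwE)

lemma \<Theta>_add: "\<lbrakk>i \<in> {1..n}; j \<in> {1..m}; x \<in> M i j; y \<in> M i j\<rbrakk> \<Longrightarrow> \<Theta> i j (x \<oplus> y) = \<Theta> i j x \<otimes>\<^bsub>J i j\<^esub> \<Theta> i j y"
  using \<Theta>_iso[of i j] by (auto simp: iso_def hom_def)

lemma \<Theta>_zero:
  assumes "i \<in> {1..n}" "j \<in> {1..m}"
  shows "\<Theta> i j \<zero> = \<one>\<^bsub>J i j\<^esub>"
  using hom_one[OF _ M_monoid_group[OF assms], of "\<Theta> i j" "J i j"] \<Theta>_iso[OF assms] J_group assms
  by (auto simp: iso_def comm_group_def)

definition \<Theta>_inv :: "nat \<Rightarrow> nat \<Rightarrow> 'u \<Rightarrow> 'b" where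
  "\<Theta>_inv i j = inv_into (M i j) (\<Theta> i j)"

lemma \<Theta>_inv:
  assumes "i \<in> {1..n}" "j \<in> {1..m}"
  shows "x \<in> M i j \<Longrightarrow> \<Theta>_inv i j (\<Theta> i j x) = x"
    and "u \<in> carrier (J i j) \<Longrightarrow> \<Theta>_inv i j u \<in> M i j"
    and "u \<in> carrier (J i j) \<Longrightarrow> \<Theta> i j (\<Theta>_inv i j u) = u"
    and "\<lbrakk>u \<in> carrier (J i j); u' \<in> carrier (J i j)\<rbrakk> \<Longrightarrow> \<Theta>_inv i j (u \<otimes>\<^bsub>J i j\<^esub> u') = \<Theta>_inv i j u \<oplus> \<Theta>_inv i j u'"
proof -
  note bij = \<Theta>_bij[OF assms]
  show 1: "x \<in> M i j \<Longrightarrow> \<Theta>_inv i j (\<Theta> i j x) = x" for x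
    using bij by (simp add: \<Theta>_inv_def bij_betw_inv_into_left)
  show 2: "u \<in> carrier (J i j) \<Longrightarrow> \<Theta>_inv i j u \<in> M i j" for u
    using bij by (metis \<Theta>_inv_def bij_betw_def inv_into_into)
  show 3: "u \<in> carrier (J i j) \<Longrightarrow> \<Theta> i j (\<Theta>_inv i j u) = u" for u
    using bij by (simp add: \<Theta>_inv_def bij_betw_inv_into_right)
  show "\<Theta>_inv i j (u \<otimes>\<^bsub>J i j\<^esub> u') = \<Theta>_inv i j u \<oplus> \<Theta>_inv i j u'"
    if "u \<in> carrier (J i j)" "u' \<in> carrier (J i j)"
    using 1[of "\<Theta>_inv i j u \<oplus> \<Theta>_inv i j u'"] 2 3 that assms \<Theta>_add[OF assms] add_M[of i j]
    by simp
qed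

lemma embed_apply:
  "k \<in> {1..n} \<Longrightarrow> J01_embed n J01 i v k = (if k = i then v else \<zero>\<^bsub>J01 k\<^esub>)"
  "l \<in> {1..m} \<Longrightarrow> J10_embed m J10 j w l = (if l = j then w else \<zero>\<^bsub>J10 l\<^esub>)"
  "\<lbrakk>k \<in> {1..n}; l \<in> {1..m}\<rbrakk> \<Longrightarrow> J_embed n m J i j u (k, l) = (if k = i \<and> l = j then u else \<one>\<^bsub>J k l\<^esub>)"
  by (auto simp: J01_embed_def J10_embed_def J_embed_def sum_embed_def)

lemma J01_embed_closed: "v \<in> carrier (J01 i) \<Longrightarrow> J01_embed n J01 i v \<in> carrier (J01_sum n J01)"
  using abelian_group.axioms(1)[OF J01_group] abelian_monoid.zero_closed
  by (fastforce simp: carrier_J01_sum J01_embed_def sum_embed_def)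

lemma J10_embed_closed: "w \<in> carrier (J10 j) \<Longrightarrow> J10_embed m J10 j w \<in> carrier (J10_sum m J10)"
  using abelian_group.axioms(1)[OF J10_group] abelian_monoid.zero_closed
  by (fastforce simp: carrier_J10_sum J10_embed_def sum_embed_def)

lemma mult_sums:
  "k \<in> {1..n} \<Longrightarrow> (v \<otimes>\<^bsub>J01_sum n J01\<^esub> v') k = v k \<oplus>\<^bsub>J01 k\<^esub> v' k"
  "l \<in> {1..m} \<Longrightarrow> (w \<otimes>\<^bsub>J10_sum m J10\<^esub> w') l = w l \<oplus>\<^bsub>J10 l\<^esub> w' l"
  "\<lbrakk>k \<in> {1..n}; l \<in> {1..m}\<rbrakk> \<Longrightarrow> (u \<otimes>\<^bsub>J_sum n m J\<^esub> u') (k, l) = u (k, l) \<otimes>\<^bsub>J k l\<^esub> u' (k, l)"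
  by (simp_all add: J01_sum_def J10_sum_def J_sum_def)

lemma one_sums:
  "k \<in> {1..n} \<Longrightarrow> \<one>\<^bsub>J01_sum n J01\<^esub> k = \<zero>\<^bsub>J01 k\<^esub>"
  "l \<in> {1..m} \<Longrightarrow> \<one>\<^bsub>J10_sum m J10\<^esub> l = \<zero>\<^bsub>J10 l\<^esub>"
  "\<lbrakk>k \<in> {1..n}; l \<in> {1..m}\<rbrakk> \<Longrightarrow> \<one>\<^bsub>J_sum n m J\<^esub> (k, l) = \<one>\<^bsub>J k l\<^esub>"
  by (simp_all add: J01_sum_def J10_sum_def J_sum_def)

lemma sums_apply:
  "\<lbrakk>v \<in> carrier (J01_sum n J01); i \<in> {1..n}\<rbrakk> \<Longrightarrow> v i \<in> carrier (J01 i)"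
  "\<lbrakk>w \<in> carrier (J10_sum m J10); j \<in> {1..m}\<rbrakk> \<Longrightarrow> w j \<in> carrier (J10 j)"
  "\<lbrakk>u \<in> carrier (J_sum n m J); i \<in> {1..n}; j \<in> {1..m}\<rbrakk> \<Longrightarrow> u (i, j) \<in> carrier (J i j)"
  by (auto simp: carrier_J01_sum carrier_J10_sum carrier_J_sum PiE_iff)

lemma \<phi>_prod_M: "\<lbrakk>i \<in> {1..n}; j \<in> {1..m}; v \<in> carrier (J01 i); w \<in> carrier (J10 j)\<rbrakk>
    \<Longrightarrow> \<phi>01 i v \<otimes> \<phi>10 j w \<in> M i j"
  by (rule mult_M) (auto simp: R_def L_def)

lemma \<phi>_closed:
  "\<lbrakk>i \<in> {1..n}; v \<in> carrier (J01 i)\<rbrakk> \<Longrightarrow> \<phi>01 i v \<in> carrier B"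
  "\<lbrakk>j \<in> {1..m}; w \<in> carrier (J10 j)\<rbrakk> \<Longrightarrow> \<phi>10 j w \<in> carrier B"
  by (simp_all add: abelian_group_hom.hom_closed[OF \<phi>01_hom] abelian_group_hom.hom_closed[OF \<phi>10_hom])

lemma \<phi>_zero: "i \<in> {1..n} \<Longrightarrow> \<phi>01 i \<zero>\<^bsub>J01 i\<^esub> = \<zero>" "j \<in> {1..m} \<Longrightarrow> \<phi>10 j \<zero>\<^bsub>J10 j\<^esub> = \<zero>"
  by (simp_all add: abelian_group_hom.hom_zero[OF \<phi>01_hom] abelian_group_hom.hom_zero[OF \<phi>10_hom])

lemma \<phi>_add:
  "\<lbrakk>i \<in> {1..n}; v \<in> carrier (J01 i); v' \<in> carrier (J01 i)\<rbrakk> \<Longrightarrow> \<phi>01 i (v \<oplus>\<^bsub>J01 i\<^esub> v') = \<phi>01 i v \<oplus> \<phi>01 i v'"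
  "\<lbrakk>j \<in> {1..m}; w \<in> carrier (J10 j); w' \<in> carrier (J10 j)\<rbrakk> \<Longrightarrow> \<phi>10 j (w \<oplus>\<^bsub>J10 j\<^esub> w') = \<phi>10 j w \<oplus> \<phi>10 j w'"
  by (simp_all add: abelian_group_hom.hom_add[OF \<phi>01_hom] abelian_group_hom.hom_add[OF \<phi>10_hom])

text \<open>Biadditivity extends the prescribed values from embedded pairs to all pairs: first
  \<open>w\<close> varies while \<open>v\<close> is embedded, then \<open>v\<close> varies. Only
  \<open>v i\<close> and \<open>w j\<close> matter at \<open>(i, j)\<close>, because a pair embedded
  at \<open>k\<close> and \<open>l\<close> contributes there only if \<open>k = i\<close> and
  \<open>l = j\<close>.\<close>

lemma \<mu>_apply:
  assumes i: "i \<in> {1..n}" and j: "j \<in> {1..m}"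
    and v: "v \<in> carrier (J01_sum n J01)" and w: "w \<in> carrier (J10_sum m J10)"
  shows "\<mu> v w (i, j) = \<Theta> i j (\<phi>01 i (v i) \<otimes> \<phi>10 j (w j))"
proof -
  note grp = sums_comm_group[THEN comm_group.axioms(2)]
  note one = biadditive_one[OF \<mu> grp] and closed = biadditive_closed[OF \<mu>]
  note left = biadditive_add_left[OF \<mu>] and right = biadditive_add_right[OF \<mu>]
  have zz: "\<zero>\<^bsub>J01 i\<^esub> \<in> carrier (J01 i)" "\<zero>\<^bsub>J10 j\<^esub> \<in> carrier (J10 j)"
    using J01_group[OF i] J10_group[OF j] by (simp_all add: abelian_group_def abelian_monoid.zero_closed)
  have step: "\<mu> (J01_embed n J01 k x) w (i, j) = \<Theta> i j (\<phi>01 i (J01_embed n J01 k x i) \<otimes> \<phi>10 j (w j))"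
    if k: "k \<in> {1..n}" and x: "x \<in> carrier (J01 k)" for k x
  proof -
    let ?e = "J01_embed n J01 k x"
    let ?P = "\<lambda>w. \<mu> ?e w (i, j) = \<Theta> i j (\<phi>01 i (?e i) \<otimes> \<phi>10 j (w j))"
    have e: "?e \<in> carrier (J01_sum n J01)" using J01_embed_closed x .
    have ei: "\<phi>01 i (?e i) \<in> carrier B" "?e i \<in> carrier (J01 i)"
      using sums_apply(1)[OF e i] \<phi>_closed i by auto
    show "?P w"
    proof (rule sum_group_embed_induct[where P = ?P, OF _ _ w[unfolded J10_sum_def]])
      show "group (add_monoid (J10 l))" if "l \<in> {1..m}" for l
        using J10_group abelian_group.a_group that by blast
      show "?P \<one>\<^bsub>sum_group {1..m} (\<lambda>j. add_monoid (J10 j))\<^esub>"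
        unfolding J10_sum_def[symmetric]
        using one(2)[OF e] ei i j by (simp add: one_sums \<phi>_zero \<Theta>_zero)
    next
      fix l y w
      assume l: "l \<in> {1..m}" and "y \<in> carrier (add_monoid (J10 l))"
        and "w \<in> carrier (sum_group {1..m} (\<lambda>j. add_monoid (J10 j)))" and IH: "?P w"
      then have y: "y \<in> carrier (J10 l)" and w: "w \<in> carrier (J10_sum m J10)"
        by (simp_all add: J10_sum_def)
      let ?y = "J10_embed m J10 l y"
      have ye: "?y \<in> carrier (J10_sum m J10)"
        using J10_embed_closed y .
      have "\<mu> ?e ?y = J_embed n m J k l (\<Theta> k l (\<phi>01 k x \<otimes> \<phi>10 l y))"
        using \<mu>_embed k x l y by simp
      \<comment> \<open>If \<open>k \<noteq> i\<close> or \<open>l \<noteq> j\<close>, a factor on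
        the right is \<open>0\<close>, and \<open>\<Theta> i j \<zero>\<close> is the neutral
        element found on the left.\<close>
      then have "\<mu> ?e ?y (i, j) = \<Theta> i j (\<phi>01 i (?e i) \<otimes> \<phi>10 j (?y j))"
        using i j k x l y by (auto simp: embed_apply \<phi>_zero \<Theta>_zero \<phi>_closed)
      then have "\<mu> ?e (?y \<otimes>\<^bsub>J10_sum m J10\<^esub> w) (i, j) =
          \<Theta> i j (\<phi>01 i (?e i) \<otimes> \<phi>10 j (?y j) \<oplus> \<phi>01 i (?e i) \<otimes> \<phi>10 j (w j))"
        using right[OF e ye w] IH i j ei sums_apply(2)[OF ye j] sums_apply(2)[OF w j]
        by (simp add: mult_sums \<Theta>_add \<phi>_prod_M)
      also have "\<dots> = \<Theta> i j (\<phi>01 i (?e i) \<otimes> \<phi>10 j ((?y \<otimes>\<^bsub>J10_sum m J10\<^esub> w) j))"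
        using i j ei sums_apply(2)[OF ye j] sums_apply(2)[OF w j]
        by (simp add: mult_sums \<phi>_add r_distr \<phi>_closed)
      finally show "?P (sum_embed {1..m} (\<lambda>j. add_monoid (J10 j)) l y \<otimes>\<^bsub>sum_group {1..m} (\<lambda>j. add_monoid (J10 j))\<^esub> w)"
        unfolding J10_sum_def J10_embed_def .
    qed simp
  qed
  let ?P = "\<lambda>v. \<mu> v w (i, j) = \<Theta> i j (\<phi>01 i (v i) \<otimes> \<phi>10 j (w j))"
  have wj: "\<phi>10 j (w j) \<in> carrier B" "w j \<in> carrier (J10 j)"
    using sums_apply(2)[OF w j] \<phi>_closed j by auto
  show "?P v"
  proof (rule sum_group_embed_induct[where P = ?P, OF _ _ v[unfolded J01_sum_def]])
    show "group (add_monoid (J01 k))" if "k \<in> {1..n}" for k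
      using J01_group abelian_group.a_group that by blast
    show "?P \<one>\<^bsub>sum_group {1..n} (\<lambda>i. add_monoid (J01 i))\<^esub>"
      unfolding J01_sum_def[symmetric]
      using one(1)[OF w] wj i j by (simp add: one_sums \<phi>_zero \<Theta>_zero)
  next
    fix k x v
    assume k: "k \<in> {1..n}" and "x \<in> carrier (add_monoid (J01 k))"
      and "v \<in> carrier (sum_group {1..n} (\<lambda>i. add_monoid (J01 i)))" and IH: "?P v"
    then have x: "x \<in> carrier (J01 k)" and v: "v \<in> carrier (J01_sum n J01)"
      by (simp_all add: J01_sum_def)
    let ?e = "J01_embed n J01 k x"
    have e: "?e \<in> carrier (J01_sum n J01)" using J01_embed_closed x .
    have "\<mu> (?e \<otimes>\<^bsub>J01_sum n J01\<^esub> v) w (i, j) =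
        \<Theta> i j (\<phi>01 i (?e i) \<otimes> \<phi>10 j (w j) \<oplus> \<phi>01 i (v i) \<otimes> \<phi>10 j (w j))"
      using left[OF e v w] step[OF k x] IH i j wj sums_apply(1)[OF e i] sums_apply(1)[OF v i]
      by (simp add: mult_sums \<Theta>_add \<phi>_prod_M)
    also have "\<dots> = \<Theta> i j (\<phi>01 i ((?e \<otimes>\<^bsub>J01_sum n J01\<^esub> v) i) \<otimes> \<phi>10 j (w j))"
      using i j wj sums_apply(1)[OF e i] sums_apply(1)[OF v i]
      by (simp add: mult_sums \<phi>_add l_distr \<phi>_closed)
    finally show "?P (sum_embed {1..n} (\<lambda>i. add_monoid (J01 i)) k x \<otimes>\<^bsub>sum_group {1..n} (\<lambda>i. add_monoid (J01 i))\<^esub> v)"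
      unfolding J01_sum_def J01_embed_def .
  qed simp
qed

section \<open>Coordinates of tuples\<close>

definition coord :: "nat \<Rightarrow> nat \<Rightarrow> ('b, 'v, 'w, 'u) elt \<Rightarrow> 'b" where
  "coord p q = (\<lambda>(b, v, w, u).
     if p = 0 \<and> q = 0 then b else if q = 0 then \<phi>01 p (v p)
     else if p = 0 then \<phi>10 q (w q) else \<Theta>_inv p q (u (p, q)))"

lemma coord_closed:
  assumes pq: "p \<le> n" "q \<le> m" and a: "a \<in> carrier A"
  shows "coord p q a \<in> M p q"
proof -
  obtain b v w u where a_eq: "a = (b, v, w, u)" by (cases a) auto
  with a have carr: "b \<in> carrier B" "v \<in> carrier (J01_sum n J01)" "w \<in> carrier (J10_sum m J10)"
    "u \<in> carrier (J_sum n m J)" by (auto simp: carrier_A)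
  consider "p = 0" "q = 0" | "p \<in> {1..n}" "q = 0" | "p = 0" "q \<in> {1..m}" | "p \<in> {1..n}" "q \<in> {1..m}"
    using pq by fastforce
  then show ?thesis
  proof cases
    case 1
    then show ?thesis using carr M_0_left[of 0] by (simp add: a_eq coord_def L_0)
  next
    case 2
    then have "\<phi>01 p (v p) \<in> R p" using sums_apply(1)[OF carr(2)] by (auto simp: R_def)
    then show ?thesis using 2 M_0_right[of p] by (simp add: a_eq coord_def)
  next
    case 3
    then have "\<phi>10 q (w q) \<in> L q" using sums_apply(2)[OF carr(3)] by (auto simp: L_def)
    then show ?thesis using 3 M_0_left[of q] by (simp add: a_eq coord_def)
  next
    case 4
    then show ?thesis
      using \<Theta>_inv(2)[OF 4 sums_apply(3)[OF carr(4) 4]] by (simp add: a_eq coord_def)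
  qed
qed

lemma coord_add:
  assumes pq: "p \<le> n" "q \<le> m" and a: "a \<in> carrier A" "a' \<in> carrier A"
  shows "coord p q (a \<oplus>\<^bsub>A\<^esub> a') = coord p q a \<oplus> coord p q a'"
proof -
  obtain b v w u where a_eq: "a = (b, v, w, u)" by (cases a) auto
  obtain b' v' w' u' where a'_eq: "a' = (b', v', w', u')" by (cases a') auto
  have carr: "b \<in> carrier B" "v \<in> carrier (J01_sum n J01)" "w \<in> carrier (J10_sum m J10)"
    "u \<in> carrier (J_sum n m J)" "b' \<in> carrier B" "v' \<in> carrier (J01_sum n J01)"
    "w' \<in> carrier (J10_sum m J10)" "u' \<in> carrier (J_sum n m J)"
    using a by (auto simp: carrier_A a_eq a'_eq)
  consider "p = 0" "q = 0" | "p \<in> {1..n}" "q = 0" | "p = 0" "q \<in> {1..m}" | "p \<in> {1..n}" "q \<in> {1..m}"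
    using pq by fastforce
  then show ?thesis
  proof cases
    case 1
    then show ?thesis by (simp add: a_eq a'_eq add_A coord_def)
  next
    case 2
    then show ?thesis
      using sums_apply(1)[OF carr(2) 2(1)] sums_apply(1)[OF carr(6) 2(1)]
      by (simp add: a_eq a'_eq add_A coord_def mult_sums \<phi>_add)
  next
    case 3
    then show ?thesis
      using sums_apply(2)[OF carr(3) 3(2)] sums_apply(2)[OF carr(7) 3(2)]
      by (simp add: a_eq a'_eq add_A coord_def mult_sums \<phi>_add)
  next
    case 4
    then show ?thesis
      using sums_apply(3)[OF carr(4) 4] sums_apply(3)[OF carr(8) 4]
      by (simp add: a_eq a'_eq add_A coord_def mult_sums \<Theta>_inv(4))
  qed
qed

lemma A_mult_closed:
  assumes "a \<in> carrier A" "a' \<in> carrier A"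
  shows "a \<otimes>\<^bsub>A\<^esub> a' \<in> carrier A"
proof -
  obtain b v w u where a_eq: "a = (b, v, w, u)" by (cases a) auto
  obtain b' v' w' u' where a'_eq: "a' = (b', v', w', u')" by (cases a') auto
  have carr: "b \<in> carrier B" "v \<in> carrier (J01_sum n J01)" "b' \<in> carrier B" "w' \<in> carrier (J10_sum m J10)"
    using assms by (auto simp: carrier_A a_eq a'_eq)
  have "(\<lambda>i\<in>{1..n}. b' \<odot>\<^bsub>J01 i\<^esub> v i) \<in> carrier (J01_sum n J01)"
    using \<phi>01_smult carr sums_apply(1)[OF carr(2)] by (auto simp: carrier_J01_sum)
  moreover have "(\<lambda>j\<in>{1..m}. b \<odot>\<^bsub>J10 j\<^esub> w' j) \<in> carrier (J10_sum m J10)"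
    using \<phi>10_smult carr sums_apply(2)[OF carr(4)] by (auto simp: carrier_J10_sum)
  ultimately show ?thesis
    using carr biadditive_closed[OF \<mu> carr(2,4)] by (simp add: a_eq a'_eq mult_A carrier_A)
qed

text \<open>On the border this is linearity of the maps \<open>\<phi>01\<close> and
  \<open>\<phi>10\<close>; in the inner positions it is \<open>\<mu>_apply\<close> with
  \<open>\<Theta>\<close> undone.\<close>

lemma coord_mult:
  assumes pq: "p \<le> n" "q \<le> m" and a: "a \<in> carrier A" "a' \<in> carrier A"
  shows "coord p q (a \<otimes>\<^bsub>A\<^esub> a') = coord p 0 a \<otimes> coord 0 q a'"
proof -
  obtain b v w u where a_eq: "a = (b, v, w, u)" by (cases a) auto
  obtain b' v' w' u' where a'_eq: "a' = (b', v', w', u')" by (cases a') auto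
  have carr: "b \<in> carrier B" "v \<in> carrier (J01_sum n J01)" "b' \<in> carrier B" "w' \<in> carrier (J10_sum m J10)"
    using a by (auto simp: carrier_A a_eq a'_eq)
  consider "p = 0" "q = 0" | "p \<in> {1..n}" "q = 0" | "p = 0" "q \<in> {1..m}" | "p \<in> {1..n}" "q \<in> {1..m}"
    using pq by fastforce
  then show ?thesis
  proof cases
    case 1
    then show ?thesis by (simp add: a_eq a'_eq mult_A coord_def)
  next
    case 2
    then show ?thesis
      using sums_apply(1)[OF carr(2) 2(1)] carr by (simp add: a_eq a'_eq mult_A coord_def \<phi>01_smult)
  next
    case 3
    then show ?thesis
      using sums_apply(2)[OF carr(4) 3(2)] carr by (simp add: a_eq a'_eq mult_A coord_def \<phi>10_smult)
  next
    case 4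
    then show ?thesis
      using \<mu>_apply[OF 4 carr(2,4)] \<phi>_prod_M[OF 4 sums_apply(1)[OF carr(2) 4(1)] sums_apply(2)[OF carr(4) 4(2)]]
      by (simp add: a_eq a'_eq mult_A coord_def \<Theta>_inv(1))
  qed
qed

lemma coord_inj:
  assumes a: "a \<in> carrier A" "a' \<in> carrier A"
    and eq: "\<And>p q. \<lbrakk>p \<le> n; q \<le> m\<rbrakk> \<Longrightarrow> coord p q a = coord p q a'"
  shows "a = a'"
proof -
  obtain b v w u where a_eq: "a = (b, v, w, u)" by (cases a) auto
  obtain b' v' w' u' where a'_eq: "a' = (b', v', w', u')" by (cases a') auto
  have carr: "v \<in> carrier (J01_sum n J01)" "w \<in> carrier (J10_sum m J10)"
    "u \<in> carrier (J_sum n m J)" "v' \<in> carrier (J01_sum n J01)"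
    "w' \<in> carrier (J10_sum m J10)" "u' \<in> carrier (J_sum n m J)"
    using a by (auto simp: carrier_A a_eq a'_eq)
  have "b = b'" using eq[of 0 0] by (simp add: a_eq a'_eq coord_def)
  moreover have "v = v'"
  proof (rule PiE_ext[OF carr(1,4)[unfolded carrier_J01_sum]])
    fix i assume i: "i \<in> {1..n}"
    then have "\<phi>01 i (v i) = \<phi>01 i (v' i)" using eq[of i 0] by (simp add: a_eq a'_eq coord_def)
    then show "v i = v' i"
      using \<phi>01 i sums_apply(1)[OF carr(1) i] sums_apply(1)[OF carr(4) i] by (meson inj_onD)
  qed
  moreover have "w = w'"
  proof (rule PiE_ext[OF carr(2,5)[unfolded carrier_J10_sum]])
    fix j assume j: "j \<in> {1..m}"
    then have "\<phi>10 j (w j) = \<phi>10 j (w' j)" using eq[of 0 j] by (simp add: a_eq a'_eq coord_def)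
    then show "w j = w' j"
      using \<phi>10 j sums_apply(2)[OF carr(2) j] sums_apply(2)[OF carr(5) j] by (meson inj_onD)
  qed
  moreover have "u = u'"
  proof (rule PiE_ext[OF carr(3,6)[unfolded carrier_J_sum]])
    fix x assume "x \<in> {1..n} \<times> {1..m}"
    then obtain i j where x: "x = (i, j)" and ij: "i \<in> {1..n}" "j \<in> {1..m}" by auto
    then have "\<Theta>_inv i j (u (i, j)) = \<Theta>_inv i j (u' (i, j))"
      using eq[of i j] by (simp add: a_eq a'_eq coord_def)
    then have "\<Theta> i j (\<Theta>_inv i j (u (i, j))) = \<Theta> i j (\<Theta>_inv i j (u' (i, j)))" by simp
    then show "u x = u' x"
      using \<Theta>_inv(3)[OF ij sums_apply(3)[OF carr(3) ij]] \<Theta>_inv(3)[OF ij sums_apply(3)[OF carr(6) ij]]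
      by (simp add: x)
  qed
  ultimately show ?thesis by (simp add: a_eq a'_eq)
qed

text \<open>By \<open>M_0_right\<close> and \<open>M_0_left\<close> the border entries range over
  the images of the module maps, so preimages can be chosen index by index.\<close>

lemma coord_surj:
  assumes y: "\<And>p q. \<lbrakk>p \<le> n; q \<le> m\<rbrakk> \<Longrightarrow> y p q \<in> M p q"
  shows "\<exists>a\<in>carrier A. \<forall>p\<le>n. \<forall>q\<le>m. coord p q a = y p q"
proof -
  have "\<exists>v\<in>carrier (J01 i). \<phi>01 i v = y i 0" if i: "i \<in> {1..n}" for i
    using y[of i 0] M_0_right[of i] i by (auto simp: R_def)
  then obtain v where v: "\<And>i. i \<in> {1..n} \<Longrightarrow> v i \<in> carrier (J01 i) \<and> \<phi>01 i (v i) = y i 0"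
    by metis
  have "\<exists>w\<in>carrier (J10 j). \<phi>10 j w = y 0 j" if j: "j \<in> {1..m}" for j
    using y[of 0 j] M_0_left[of j] j by (auto simp: L_def)
  then obtain w where w: "\<And>j. j \<in> {1..m} \<Longrightarrow> w j \<in> carrier (J10 j) \<and> \<phi>10 j (w j) = y 0 j"
    by metis
  let ?a = "(y 0 0, restrict v {1..n}, restrict w {1..m}, \<lambda>(i, j)\<in>{1..n} \<times> {1..m}. \<Theta> i j (y i j))"
  have "?a \<in> carrier A"
    unfolding carrier_A carrier_J01_sum carrier_J10_sum carrier_J_sum
    using y[of 0 0] M_0_left[of 0] L_0 v w y \<Theta>_closed by auto
  moreover have "coord p q ?a = y p q" if "p \<le> n" "q \<le> m" for p q
    using that v[of p] w[of q] \<Theta>_inv(1)[of p q "y p q"] y[of p q] by (auto simp: coord_def)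
  ultimately show ?thesis by blast
qed

sublocale sandwich_ring B n m R L f' f A coord
proof (intro sandwich_ring.intro sandwich_ring_axioms.intro sandwich_data_axioms abelian_group_A)
  show "abelian_group_hom A B (coord p q)" if pq: "p \<le> n" "q \<le> m" for p q
  proof (intro abelian_group_homI group_hom.intro group_hom_axioms.intro abelian_group_A
      abelian_group.a_group[OF abelian_group_A] a_group abelian_group_axioms)
    show "coord p q \<in> hom (add_monoid A) (add_monoid B)"
      using coord_closed[OF pq] coord_add[OF pq] M_carrier[OF pq] by (auto simp: hom_def)
  qed
qed (fact A_mult_closed coord_mult coord_inj coord_closed coord_surj)+

section \<open>The summands of the theorem in coordinates\<close>

context
  fixes i j :: nat
  assumes i: "i \<in> {1..n}" and j: "j \<in> {1..m}"
begin

lemma coord_tuple: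
  assumes v: "v \<in> carrier (J01 i)" and w: "w \<in> carrier (J10 j)"
    and pq: "p \<le> n" "q \<le> m"
  shows "coord p q (b, J01_embed n J01 i v, J10_embed m J10 j w, u) =
    (if p = 0 \<and> q = 0 then b else if p = i \<and> q = 0 then \<phi>01 i v
     else if p = 0 \<and> q = j then \<phi>10 j w else if p = 0 \<or> q = 0 then \<zero> else \<Theta>_inv p q (u (p, q)))"
  using i j pq embed_apply(1)[of p i v] embed_apply(2)[of q j w] by (auto simp: coord_def \<phi>_zero)

lemma embed_zero:
  "J01_embed n J01 i \<zero>\<^bsub>J01 i\<^esub> = \<one>\<^bsub>J01_sum n J01\<^esub>" "J10_embed m J10 j \<zero>\<^bsub>J10 j\<^esub> = \<one>\<^bsub>J10_sum m J10\<^esub>"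
  by (auto simp: J01_embed_def J10_embed_def sum_embed_def J01_sum_def J10_sum_def fun_eq_iff)

lemma module_zero_closed: "\<zero>\<^bsub>J01 i\<^esub> \<in> carrier (J01 i)" "\<zero>\<^bsub>J10 j\<^esub> \<in> carrier (J10 j)"
  using J01_group[OF i] J10_group[OF j] by (simp_all add: abelian_group_def abelian_monoid.zero_closed)

text \<open>The dictionary between the two descriptions: the zero entries of the direct sums have
  coordinate \<open>0\<close>, so a tuple concentrated at the indices \<open>i\<close> and
  \<open>j\<close> has only the four entries of a quad.\<close>

lemma tuple_eq_quad:
  assumes b: "b \<in> carrier B" and v: "v \<in> carrier (J01 i)" and w: "w \<in> carrier (J10 j)"
    and x: "x \<in> M i j" and u: "u \<in> carrier (J_sum n m J)"
    and ux: "\<And>k l. \<lbrakk>k \<in> {1..n}; l \<in> {1..m}\<rbrakk> \<Longrightarrow> u (k, l) = (if k = i \<and> l = j then \<Theta> i j x else \<one>\<^bsub>J k l\<^esub>)"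
  shows "(b, J01_embed n J01 i v, J10_embed m J10 j w, u) = quad i j b (\<phi>01 i v) (\<phi>10 j w) x"
proof (rule coord_inj)
  have RL: "\<phi>01 i v \<in> R i" "\<phi>10 j w \<in> L j"
    using i j v w by (auto simp: R_def L_def)
  note q = b RL x
  show "quad i j b (\<phi>01 i v) (\<phi>10 j w) x \<in> carrier A"
    using quad_closed[OF i j q] .
  show "(b, J01_embed n J01 i v, J10_embed m J10 j w, u) \<in> carrier A"
    using b u J01_embed_closed[OF v] J10_embed_closed[OF w] by (simp add: carrier_A)
  fix p q assume pq: "p \<le> n" "q \<le> m"
  have "\<Theta>_inv p q (u (p, q)) = (if p = i \<and> q = j then x else \<zero>)" if "p \<noteq> 0" "q \<noteq> 0"
    using that pq ux[of p q] \<Theta>_inv(1)[of p q x] \<Theta>_inv(1)[of p q \<zero>] \<Theta>_zero[of p q] zero_M[OF pq] x by auto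
  then show "coord p q (b, J01_embed n J01 i v, J10_embed m J10 j w, u) =
      coord p q (quad i j b (\<phi>01 i v) (\<phi>10 j w) x)"
    using co_quad[OF i j \<open>b \<in> carrier B\<close> RL x pq] i j by (auto simp: coord_tuple[OF v w pq])
qed

lemma one_J_sum: "\<one>\<^bsub>J_sum n m J\<^esub> \<in> carrier (J_sum n m J)"
  using sums_comm_group(3) by (simp add: comm_group_def group.is_monoid monoid.one_closed)

lemma tuple_eq_quad_zero:
  assumes b: "b \<in> carrier B" and v: "v \<in> carrier (J01 i)" and w: "w \<in> carrier (J10 j)"
  shows "(b, J01_embed n J01 i v, J10_embed m J10 j w, \<one>\<^bsub>J_sum n m J\<^esub>) = quad i j b (\<phi>01 i v) (\<phi>10 j w) \<zero>"
  by (rule tuple_eq_quad[OF b v w _ one_J_sum]) (use i j zero_M[of i j] one_sums(3) \<Theta>_zero in auto)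

text \<open>Linearity gives
  \<open>\<phi>(v\<phi>(w)) = \<phi>(v)\<phi>(w) = \<phi>(\<phi>(v)w)\<close>, so the generators of
  the fourth summand are quads with four equal entries.\<close>

lemma product_tuple_eq_quad:
  assumes v: "v \<in> carrier (J01 i)" and w: "w \<in> carrier (J10 j)"
  defines "x \<equiv> \<phi>01 i v \<otimes> \<phi>10 j w"
  shows "(x, J01_embed n J01 i (\<phi>10 j w \<odot>\<^bsub>J01 i\<^esub> v), J10_embed m J10 j (\<phi>01 i v \<odot>\<^bsub>J10 j\<^esub> w),
          \<mu> (J01_embed n J01 i v) (J10_embed m J10 j w)) = quad i j x x x x"
proof -
  have c: "\<phi>01 i v \<in> carrier B" "\<phi>10 j w \<in> carrier B" using \<phi>_closed i j v w by auto
  have x: "x \<in> M i j" unfolding x_def using \<phi>_prod_M i j v w .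
  have v': "\<phi>10 j w \<odot>\<^bsub>J01 i\<^esub> v \<in> carrier (J01 i)" "\<phi>01 i (\<phi>10 j w \<odot>\<^bsub>J01 i\<^esub> v) = x"
    using \<phi>01_smult[OF i c(2) v] by (auto simp: x_def)
  have w': "\<phi>01 i v \<odot>\<^bsub>J10 j\<^esub> w \<in> carrier (J10 j)" "\<phi>10 j (\<phi>01 i v \<odot>\<^bsub>J10 j\<^esub> w) = x"
    using \<phi>10_smult[OF j c(1) w] by (auto simp: x_def)
  have \<mu>_eq: "\<mu> (J01_embed n J01 i v) (J10_embed m J10 j w) = J_embed n m J i j (\<Theta> i j x)"
    using \<mu>_embed i j v w by (simp add: x_def)
  have xB: "x \<in> carrier B" using c by (simp add: x_def)
  have "\<mu> (J01_embed n J01 i v) (J10_embed m J10 j w) \<in> carrier (J_sum n m J)"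
    by (rule biadditive_closed[OF \<mu> J01_embed_closed[OF v] J10_embed_closed[OF w]])
  from tuple_eq_quad[OF xB v'(1) w'(1) x this] show ?thesis
    unfolding v' w' by (auto simp: \<mu>_eq embed_apply)
qed

text \<open>An additive map carries generated subgroups to generated subgroups; this turns the
  fourth summand, defined by generators, into the image of \<open>M i j\<close>.\<close>

lemma quad_diagonal_hom: "(\<lambda>x. quad i j x x x x) \<in> hom ((add_monoid B)\<lparr>carrier := M i j\<rparr>) (add_monoid A)"
proof -
  have mem: "x \<in> carrier B" "x \<in> R i" "x \<in> L j" if "x \<in> M i j" for x
    using that M_in_RL[OF i j] RLM_carrier[OF i j] by auto
  have "quad i j (x \<oplus> y) (x \<oplus> y) (x \<oplus> y) (x \<oplus> y) = quad i j x x x x \<oplus>\<^bsub>A\<^esub> quad i j y y y y"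
    if "x \<in> M i j" "y \<in> M i j" for x y
    using that mem add_M[of i j] i j
    by (intro coord_inj) (auto simp: co_quad[OF i j] quad_closed[OF i j] co_add)
  then show ?thesis
    using mem quad_closed[OF i j] by (auto simp: hom_def)
qed

lemma A_summand_eq:
  assumes "s \<in> {0, 1, 2, 3}"
  shows "A_summand B n m J01 J10 J \<mu> f' f \<phi>01 \<phi>10 i j s = summand i j s"
proof -
  note z = embed_zero module_zero_closed
  consider "s = 0" | "s = 1" | "s = 2" | "s = 3" using assms by auto
  then show ?thesis
  proof cases
    case 1
    have eq: "(f' i \<otimes> b \<otimes> f j, \<one>\<^bsub>J01_sum n J01\<^esub>, \<one>\<^bsub>J10_sum m J10\<^esub>, \<one>\<^bsub>J_sum n m J\<^esub>) =
        quad i j (f' i \<otimes> b \<otimes> f j) \<zero> \<zero> \<zero>" if "b \<in> carrier B" for b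
      using tuple_eq_quad_zero[of "f' i \<otimes> b \<otimes> f j", OF _ z(3,4)] that f'_closed[OF i] f_closed[OF j]
      by (simp add: z \<phi>_zero(1)[OF i] \<phi>_zero(2)[OF j])
    have "A_summand B n m J01 J10 J \<mu> f' f \<phi>01 \<phi>10 i j s =
        (\<lambda>b. (f' i \<otimes> b \<otimes> f j, \<one>\<^bsub>J01_sum n J01\<^esub>, \<one>\<^bsub>J10_sum m J10\<^esub>, \<one>\<^bsub>J_sum n m J\<^esub>)) ` carrier B"
      using 1 by (simp add: A_summand_def setcompr_eq_image)
    also have "\<dots> = (\<lambda>b. quad i j (f' i \<otimes> b \<otimes> f j) \<zero> \<zero> \<zero>) ` carrier B"
      by (rule image_cong[OF refl eq])
    also have "\<dots> = summand i j s"
      using 1 by (simp add: summand_def[OF i j] setcompr_eq_image)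
    finally show ?thesis .
  next
    case 2
    have eq: "(\<phi>01 i v, J01_embed n J01 i v, \<one>\<^bsub>J10_sum m J10\<^esub>, \<one>\<^bsub>J_sum n m J\<^esub>) =
        quad i j (\<phi>01 i v) (\<phi>01 i v) \<zero> \<zero>" if "v \<in> carrier (J01 i)" for v
      using tuple_eq_quad_zero[OF _ that z(4)] \<phi>_closed(1)[OF i that] by (simp add: z \<phi>_zero(2)[OF j])
    have "A_summand B n m J01 J10 J \<mu> f' f \<phi>01 \<phi>10 i j s =
        (\<lambda>v. (\<phi>01 i v, J01_embed n J01 i v, \<one>\<^bsub>J10_sum m J10\<^esub>, \<one>\<^bsub>J_sum n m J\<^esub>)) `
          (\<lambda>x. f j \<odot>\<^bsub>J01 i\<^esub> x) ` carrier (J01 i)"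
      using 2 by (simp add: A_summand_def setcompr_eq_image del: image_image)
    also have "\<dots> = (\<lambda>x. quad i j (\<phi>01 i x \<otimes> f j) (\<phi>01 i x \<otimes> f j) \<zero> \<zero>) ` carrier (J01 i)"
      unfolding image_image
    proof (rule image_cong[OF refl])
      fix x assume x: "x \<in> carrier (J01 i)"
      show "(\<phi>01 i (f j \<odot>\<^bsub>J01 i\<^esub> x), J01_embed n J01 i (f j \<odot>\<^bsub>J01 i\<^esub> x), \<one>\<^bsub>J10_sum m J10\<^esub>, \<one>\<^bsub>J_sum n m J\<^esub>) = quad i j (\<phi>01 i x \<otimes> f j) (\<phi>01 i x \<otimes> f j) \<zero> \<zero>"
        using eq[of "f j \<odot>\<^bsub>J01 i\<^esub> x"] \<phi>01_smult[OF i f_closed[OF j] x] by simp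
    qed
    also have "\<dots> = summand i j s"
      using 2 i by (simp add: summand_def[OF i j] setcompr_eq_image R_def image_image)
    finally show ?thesis .
  next
    case 3
    have eq: "(\<phi>10 j w, \<one>\<^bsub>J01_sum n J01\<^esub>, J10_embed m J10 j w, \<one>\<^bsub>J_sum n m J\<^esub>) =
        quad i j (\<phi>10 j w) \<zero> (\<phi>10 j w) \<zero>" if "w \<in> carrier (J10 j)" for w
      using tuple_eq_quad_zero[OF _ z(3) that] \<phi>_closed(2)[OF j that] by (simp add: z \<phi>_zero(1)[OF i])
    have "A_summand B n m J01 J10 J \<mu> f' f \<phi>01 \<phi>10 i j s =
        (\<lambda>w. (\<phi>10 j w, \<one>\<^bsub>J01_sum n J01\<^esub>, J10_embed m J10 j w, \<one>\<^bsub>J_sum n m J\<^esub>)) `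
          (\<lambda>x. f' i \<odot>\<^bsub>J10 j\<^esub> x) ` carrier (J10 j)"
      using 3 by (simp add: A_summand_def setcompr_eq_image del: image_image)
    also have "\<dots> = (\<lambda>x. quad i j (f' i \<otimes> \<phi>10 j x) \<zero> (f' i \<otimes> \<phi>10 j x) \<zero>) ` carrier (J10 j)"
      unfolding image_image
    proof (rule image_cong[OF refl])
      fix x assume x: "x \<in> carrier (J10 j)"
      show "(\<phi>10 j (f' i \<odot>\<^bsub>J10 j\<^esub> x), \<one>\<^bsub>J01_sum n J01\<^esub>, J10_embed m J10 j (f' i \<odot>\<^bsub>J10 j\<^esub> x), \<one>\<^bsub>J_sum n m J\<^esub>) = quad i j (f' i \<otimes> \<phi>10 j x) \<zero> (f' i \<otimes> \<phi>10 j x) \<zero>"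
        using eq[of "f' i \<odot>\<^bsub>J10 j\<^esub> x"] \<phi>10_smult[OF j f'_closed[OF i] x] by simp
    qed
    also have "\<dots> = summand i j s"
      using 3 j by (simp add: summand_def[OF i j] setcompr_eq_image L_def image_image)
    finally show ?thesis .
  next
    case 4
    let ?M = "(add_monoid B)\<lparr>carrier := M i j\<rparr>" and ?D = "\<lambda>x. quad i j x x x x"
    let ?K = "R i <#> L j"
    have K: "?K \<subseteq> M i j"
      using mult_M by (auto simp: set_mult_def)
    interpret D: group_hom ?M "add_monoid A" ?D
      by (intro group_hom.intro group_hom_axioms.intro M_monoid_group[OF i j]
            abelian_group.a_group[OF abelian_group_A] quad_diagonal_hom)
    have ij: "i \<le> n" "j \<le> m" using i j by auto
    \<comment> \<open>Generation inside \<open>M i j\<close> and inside \<open>B\<close> gives the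
      same subgroup. The smaller group is the domain on which \<open>?D\<close> is known to be
      additive.\<close>
    have gen: "generate ?M ?K = M i j"
      using add.generate_consistent[OF K M_subgroup[OF ij]] by (simp add: additive_product_def)
    have "{(\<phi>01 i v \<otimes> \<phi>10 j w,
          J01_embed n J01 i (\<phi>10 j w \<odot>\<^bsub>J01 i\<^esub> v),
          J10_embed m J10 j (\<phi>01 i v \<odot>\<^bsub>J10 j\<^esub> w),
          \<mu> (J01_embed n J01 i v) (J10_embed m J10 j w)) | v w.
         v \<in> carrier (J01 i) \<and> w \<in> carrier (J10 j)} =
        {?D (\<phi>01 i v \<otimes> \<phi>10 j w) | v w. v \<in> carrier (J01 i) \<and> w \<in> carrier (J10 j)}"
      by (simp only: product_tuple_eq_quad cong: rev_conj_cong)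
    also have "\<dots> = ?D ` ?K"
      using i j by (auto simp: set_mult_def R_def L_def)
    finally have "A_summand B n m J01 J10 J \<mu> f' f \<phi>01 \<phi>10 i j s = generate (add_monoid A) (?D ` ?K)"
      unfolding add_monoid_A using 4 by (simp add: A_summand_def)
    also have "\<dots> = ?D ` M i j"
      using D.generate_img[of ?K] K gen by simp
    also have "\<dots> = summand i j s"
      using 4 by (auto simp: summand_def[OF i j])
    finally show ?thesis .
  qed
qed

lemma A_component_eq: "A_component B n m J01 J10 J \<mu> f' f \<phi>01 \<phi>10 i j = component i j"
  unfolding A_component_def Let_def
  using component_eq_set_add[OF i j] A_summand_eq by simp

lemma A_component_direct_sum:
  "internal_direct_sum A (A_component B n m J01 J10 J \<mu> f' f \<phi>01 \<phi>10 i j) {0, 1, 2, 3}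
     (A_summand B n m J01 J10 J \<mu> f' f \<phi>01 \<phi>10 i j)"
  unfolding A_component_eq using component_direct_sum[OF i j] A_summand_eq by blast

end

lemma A_graded_simple:
  assumes "1 \<le> n" and "1 \<le> m" and "\<And>i j. \<lbrakk>i \<in> {1..n}; j \<in> {1..m}\<rbrakk> \<Longrightarrow> Q j i = Some e"
  shows "graded_simple (rees_matrix_semigroup (singleton_group e) n m Q) A
           (A_grading B n m J01 J10 J \<mu> f' f \<phi>01 \<phi>10)"
  using assms by (intro graded_simple) (simp_all add: A_component_eq)

end

theorem theorem5p1:
  fixes k m n :: nat
    and B :: "'b ring"
    and f f' :: "nat \<Rightarrow> 'b"
    and J10 :: "nat \<Rightarrow> ('b, 'w) module"
    and J01 :: "nat \<Rightarrow> ('b, 'v) module"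
    and \<phi>10 :: "nat \<Rightarrow> 'w \<Rightarrow> 'b"
    and \<phi>01 :: "nat \<Rightarrow> 'v \<Rightarrow> 'b"
    and J :: "nat \<Rightarrow> nat \<Rightarrow> 'u monoid"
    and \<Theta> :: "nat \<Rightarrow> nat \<Rightarrow> 'b \<Rightarrow> 'u"
    and \<mu> :: "(nat \<Rightarrow> 'v) \<Rightarrow> (nat \<Rightarrow> 'w) \<Rightarrow> (nat \<times> nat \<Rightarrow> 'u)"
    and e :: 'g
    and Q :: "nat \<Rightarrow> nat \<Rightarrow> 'g option"
  assumes "k \<ge> 1" and "m \<ge> 1" and "n \<ge> 1"
    and "ring B"
    and "B \<simeq> ring_mat TYPE('d :: division_ring) k ()"
    and "\<forall>j\<in>{1..m}. f j \<in> carrier B \<and> f j \<otimes>\<^bsub>B\<^esub> f j = f j"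
    and "\<forall>i\<in>{1..m}. \<forall>j\<in>{1..m}. i \<noteq> j \<longrightarrow> f i \<otimes>\<^bsub>B\<^esub> f j = \<zero>\<^bsub>B\<^esub>"
    and "\<forall>i\<in>{1..n}. f' i \<in> carrier B \<and> f' i \<otimes>\<^bsub>B\<^esub> f' i = f' i"
    and "\<forall>i\<in>{1..n}. \<forall>j\<in>{1..n}. i \<noteq> j \<longrightarrow> f' i \<otimes>\<^bsub>B\<^esub> f' j = \<zero>\<^bsub>B\<^esub>"
    and "(\<Oplus>\<^bsub>B\<^esub>i\<in>{1..n}. f' i) = \<one>\<^bsub>B\<^esub>"
    and "(\<Oplus>\<^bsub>B\<^esub>j\<in>{1..m}. f j) = \<one>\<^bsub>B\<^esub>"
    and "\<forall>j\<in>{1..m}. left_module B (J10 j)"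
    and "\<forall>i\<in>{1..n}. right_module B (J01 i)"
    and "\<forall>j\<in>{1..m}. \<phi>10 j \<in> left_module_hom B (J10 j) \<and> inj_on (\<phi>10 j) (carrier (J10 j))"
    and "\<forall>i\<in>{1..n}. \<phi>01 i \<in> right_module_hom B (J01 i) \<and> inj_on (\<phi>01 i) (carrier (J01 i))"
    and "\<forall>j\<in>{1..m}. \<forall>w\<in>carrier (J10 j). \<phi>10 j w \<otimes>\<^bsub>B\<^esub> f j = \<zero>\<^bsub>B\<^esub>"
    and "\<forall>i\<in>{1..n}. \<forall>v\<in>carrier (J01 i). f' i \<otimes>\<^bsub>B\<^esub> \<phi>01 i v = \<zero>\<^bsub>B\<^esub>"
    and "\<forall>i\<in>{1..n}. \<forall>j\<in>{1..m}. comm_group (J i j)"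
    and "\<forall>i\<in>{1..n}. \<forall>j\<in>{1..m}.
           \<Theta> i j \<in> iso ((add_monoid B)\<lparr>carrier :=
                          additive_product B (\<phi>01 i ` carrier (J01 i)) (\<phi>10 j ` carrier (J10 j))\<rparr>)
                        (J i j)"
    and "biadditive (J01_sum n J01) (J10_sum m J10) (J_sum n m J) \<mu>"
    and "\<forall>i\<in>{1..n}. \<forall>j\<in>{1..m}. \<forall>v\<in>carrier (J01 i). \<forall>w\<in>carrier (J10 j).
           \<mu> (J01_embed n J01 i v) (J10_embed m J10 j w) =
             J_embed n m J i j (\<Theta> i j (\<phi>01 i v \<otimes>\<^bsub>B\<^esub> \<phi>10 j w))"
    and "\<forall>j\<in>{1..m}. \<forall>i\<in>{1..n}. Q j i = Some e"
  shows "(\<forall>i\<in>{1..n}. \<forall>j\<in>{1..m}.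
            internal_direct_sum (A_ring B n m J01 J10 J \<mu>)
              (A_component B n m J01 J10 J \<mu> f' f \<phi>01 \<phi>10 i j) {0, 1, 2, 3 :: nat}
              (A_summand B n m J01 J10 J \<mu> f' f \<phi>01 \<phi>10 i j)) \<and>
         graded_simple (rees_matrix_semigroup (singleton_group e) n m Q)
           (A_ring B n m J01 J10 J \<mu>)
           (A_grading B n m J01 J10 J \<mu> f' f \<phi>01 \<phi>10)"
proof -
  interpret module_extension B n m f f' J10 J01 \<phi>10 \<phi>01 J \<Theta> \<mu>
    by (intro module_extension.intro module_extension_axioms.intro)
      (fact assms ring_iso_ring_mat_simple[OF assms(1,4,5)])+
  show ?thesis
  proof (intro conjI ballI)
    fix i j assume "i \<in> {1..n}" "j \<in> {1..m}"
    then show "internal_direct_sum A (A_component B n m J01 J10 J \<mu> f' f \<phi>01 \<phi>10 i j) {0, 1, 2, 3}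
        (A_summand B n m J01 J10 J \<mu> f' f \<phi>01 \<phi>10 i j)"
      by (rule A_component_direct_sum)
  next
    show "graded_simple (rees_matrix_semigroup (singleton_group e) n m Q) A
        (A_grading B n m J01 J10 J \<mu> f' f \<phi>01 \<phi>10)"
      by (rule A_graded_simple[OF assms(3,2)]) (use assms(22) in auto)
  qed
qed

end
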